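(* The maximal girth of a $4$-regular induced subgraph of the $5$-dimensional grid is $10$.
   Context: The $n$-dimensional grid is the graph with vertex set $\mathbb{Z}^n$ in which two points are adjacent if and only if their Euclidean distance is $1$. An induced subgraph $H$ of a graph $G$ is a subgraph that contains an edge between any two of its vertices that are adjacent in $G$. A graph is $k$-regular if every vertex has exactly $k$ neighbours; the null graph (with no vertices) is not considered a $k$-regular graph. Regular subgraphs may be infinite. The girth of a graph is the length of its shortest cycle (infinite if there is no cycle). *)

theory Defs
  imports
    "HOL-Analysis.Finite_Cartesian_Product"
    "HOL-Library.Extended_Nat"
    "Graph_Theory.Graph_Theory"
begin

text \<open>
  Undirected simple graphs are encoded as symmetric, loop-free digraphs whose arcs are ordered
  pairs, so an undirected edge between x and y is the pair of arcs (x, y) and (y, x).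
\<close>

definition grid :: "(int ^ 'n::finite) pair_pre_digraph" where
  "grid = \<lparr> pverts = UNIV,
            parcs = {(x, y). dist (\<chi> i. real_of_int (x $ i)) (\<chi> i. real_of_int (y $ i)) = 1} \<rparr>"

definition neighbours :: "'a pair_pre_digraph \<Rightarrow> 'a \<Rightarrow> 'a set" where
  "neighbours G v = {w. (v, w) \<in> parcs G}"

definition regular_graph :: "nat \<Rightarrow> 'a pair_pre_digraph \<Rightarrow> bool" where
  "regular_graph k G \<longleftrightarrow>
     pverts G \<noteq> {} \<and>
     (\<forall>v \<in> pverts G. finite (neighbours G v) \<and> card (neighbours G v) = k)"

text \<open>
  In a symmetric digraph, going along an edge and back is a cycle with two arcs; the length bound
  excludes exactly these, leaving the cycles of the undirected graph. The infimum of the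
  empty set is infinity.
\<close>

definition girth :: "'a pair_pre_digraph \<Rightarrow> enat" where
  "girth G = (INF p \<in> {p. pre_digraph.cycle (with_proj G) p \<and> 3 \<le> length p}. enat (length p))"

end

theory Submission
  imports Defs "HOL-Real_Asymp.Real_Asymp"
begin

text \<open>
  Lower bound: the points \<open>x\<close> for which \<open>x\<^sub>1 + 2 x\<^sub>2 + 3 x\<^sub>3 + 4 x\<^sub>4 + 5 x\<^sub>5\<close> is a nonzero
  square modulo 11 induce a 4-regular graph, because the ten unit steps change this value by each
  nonzero residue exactly once, so that a point has one neighbour for each of the other four
  squares. A bounded search excludes closed walks of length less than 10.

  Upper bound: suppose that the vertex set \<open>S\<close> induces a 4-regular graph of girth greater than 10.
  In a unit 5-cube, a nonempty subset of \<open>S\<close> with minimal degree 2 is an induced cycle of length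
  12 or 14, which has one of eight shapes. So the part of \<open>S\<close> in a unit cube has at most as many
  edges as vertices, and fewer if it is nonempty and acyclic; and a cube that contains a cycle is
  next to a nonempty cube that contains none. An edge lies in 16 unit cubes and a point in 32.
  As \<open>S\<close> has twice as many edges as points, up to a boundary term the average over the cubes
  meeting a large box is tight, and the deficit at the acyclic cubes forces \<open>S\<close> to grow
  exponentially with the size of the box, which is impossible.
\<close>

section \<open>Sparse point sets in the unit cube\<close>

text \<open>A point lies in twice as many unit cubes as an edge does, so the two edges per point of
  \<open>S\<close> become one edge per point inside the cubes, which is exactly the ratio of a
  cycle. Counting alone therefore excludes nothing: every cube might hold a cycle. Only cubes whose
  part of \<open>S\<close> is a nonempty forest give a gain, and they must be frequent in proportion
  to \<open>S\<close>, not merely exist. Each point of \<open>S\<close> is the lowest corner of a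
  cube that meets \<open>S\<close>, and this cube or one of its ten neighbours is such a forest; so
  there is at least one deficient cube for every eleven points. This is where the growth factor
  353/352 comes from.

  The finite part concerns subsets of a cube with 32 points and of the adjacent cubes, too many to
  enumerate. It is split in two: a search along walks finds the possible shapes of a cycle, where
  girth prunes early, and questions about one fixed shape become propositional, with just those
  short cycles as clauses that the refutation uses.\<close>

type_synonym point = "int \<times> int \<times> int \<times> int \<times> int"

datatype step = U0 | U1 | U2 | U3 | U4 | D0 | D1 | D2 | D3 | D4

fun go :: "step \<Rightarrow> point \<Rightarrow> point" where
  "go U0 (a, b, c, d, e) = (a + 1, b, c, d, e)"
| "go U1 (a, b, c, d, e) = (a, b + 1, c, d, e)"
| "go U2 (a, b, c, d, e) = (a, b, c + 1, d, e)"
| "go U3 (a, b, c, d, e) = (a, b, c, d + 1, e)"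
| "go U4 (a, b, c, d, e) = (a, b, c, d, e + 1)"
| "go D0 (a, b, c, d, e) = (a - 1, b, c, d, e)"
| "go D1 (a, b, c, d, e) = (a, b - 1, c, d, e)"
| "go D2 (a, b, c, d, e) = (a, b, c - 1, d, e)"
| "go D3 (a, b, c, d, e) = (a, b, c, d - 1, e)"
| "go D4 (a, b, c, d, e) = (a, b, c, d, e - 1)"

fun opp :: "step \<Rightarrow> step" where
  "opp U0 = D0" | "opp U1 = D1" | "opp U2 = D2" | "opp U3 = D3" | "opp U4 = D4"
| "opp D0 = U0" | "opp D1 = U1" | "opp D2 = U2" | "opp D3 = U3" | "opp D4 = U4"

fun endpoint :: "point \<Rightarrow> step list \<Rightarrow> point" where
  "endpoint p [] = p"
| "endpoint p (d # w) = endpoint (go d p) w"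

text \<open>The endpoint is left out: in a closed walk it is the starting point, whose membership is
  tested already.\<close>

fun along :: "(point \<Rightarrow> bool) \<Rightarrow> point \<Rightarrow> step list \<Rightarrow> bool" where
  "along s p [] = True"
| "along s p (d # w) = (s p \<and> along s (go d p) w)"

fun reduced :: "step list \<Rightarrow> bool" where
  "reduced (d # e # w) = (e \<noteq> opp d \<and> reduced (e # w))"
| "reduced w = True"

text \<open>Reversals are forbidden only between consecutive steps, not where the walk closes up,
  and points may repeat. \<open>sparse_phi\<close> needs no more, since it only looks for a repeated
  entry in a non-backtracking vertex list.\<close>

definition short_closed :: "point \<times> step list \<Rightarrow> bool" where
  "short_closed = (\<lambda>(p, w). endpoint p w = p \<and> reduced w \<and> w \<noteq> [] \<and> length w \<le> 10)"

definition sparse :: "(point \<Rightarrow> bool) \<Rightarrow> bool" where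
  "sparse s \<longleftrightarrow> (\<forall>p w. short_closed (p, w) \<longrightarrow> \<not> along s p w)"

text \<open>Turns a list of certificates into clauses. That the walks are short, closed and reduced
  is settled by evaluation; what simplification leaves of each walk is that one of its points lies
  outside the set.\<close>

lemma sparse_list:
  assumes "sparse s" "list_all short_closed cs"
  shows "list_all (\<lambda>(p, w). \<not> along s p w) cs"
  using assms by (auto simp: sparse_def list_all_iff)

fun flips :: "point \<Rightarrow> point list" where
  "flips (a, b, c, d, e) = [(1 - a, b, c, d, e), (a, 1 - b, c, d, e), (a, b, 1 - c, d, e),
     (a, b, c, 1 - d, e), (a, b, c, d, 1 - e)]"

fun omit1 :: "'a list \<Rightarrow> 'a list list" where
  "omit1 [] = []"
| "omit1 (x # xs) = xs # map ((#) x) (omit1 xs)"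

definition unit_cube :: "point list" where
  "unit_cube = [(a, b, c, d, e). a \<leftarrow> [0, 1], b \<leftarrow> [0, 1], c \<leftarrow> [0, 1], d \<leftarrow> [0, 1], e \<leftarrow> [0, 1]]"

text \<open>
  Every point of a core has two neighbours in it: whichever of the five flips is omitted,
  another one remains.
\<close>

definition core :: "(point \<Rightarrow> bool) \<Rightarrow> bool" where
  "core k \<longleftrightarrow> list_ex k unit_cube \<and>
     list_all (\<lambda>p. k p \<longrightarrow> list_all (list_ex k) (omit1 (flips p))) unit_cube"

lemmas core_unfold = core_def [unfolded unit_cube_def]

text \<open>
  Up to symmetry of the cube, the coils are the eight induced cycles of length 12 or 14 that a
  sparse set can have in the unit cube. The closed walks in \<open>inner\<close> and \<open>outer\<close> are certificates:
  sparseness excludes each of them, and the resulting clauses contradict the assumption that the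
  core has a point off the coil, or that one or two given neighbours of the unit cube have a core
  as well, by propositional reasoning alone.
\<close>

definition coil0 :: "point list" where
 "coil0 = [(0,0,0,0,1), (0,0,1,0,1), (0,0,1,0,0), (1,0,1,0,0), (1,0,1,1,0), (1,0,0,1,0), (0,0,0,1,0), (0,1,0,1,0), (0,1,0,0,0), (1,1,0,0,0), (1,1,0,0,1), (1,0,0,0,1)]"

definition inner0 :: "(point \<times> step list) list" where
 "inner0 =
[((0,0,0,0,0),[U1,U3,D1,D3]),
 ((0,0,0,0,1),[U2,D4,U0,U3,D2,D0,U4,D3]),
 ((0,0,0,1,0),[U1,D3,U0,U3,D1,D0]),
 ((0,0,1,0,0),[U0,U4,D0,D4]),
 ((0,0,0,1,0),[U1,U4,U2,D1,D3,D4,U0,U3,D2,D0]),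
 ((0,0,0,0,1),[U2,D4,U0,U3,D2,U4,D3,D0]),
 ((0,1,0,0,0),[U4,U0,D4,D0]),
 ((0,0,0,1,0),[U1,D3,U0,U4,D1,D4,U3,D0]),
 ((0,0,0,1,0),[U1,D3,U0,U2,D1,U3,D2,D0]),
 ((0,0,0,1,0),[U1,D3,U2,D1,U0,U3,D2,D0]),
 ((0,0,0,0,1),[U2,U1,U0,D2,D1,D0]),
 ((0,0,0,0,1),[U2,D4,U3,D2,U1,D3,U0,U4,D1,D0]),
 ((0,0,0,1,0),[U1,U2,U0,D1,D2,D0]),
 ((0,0,0,1,0),[U0,U2,U1,U4,D2,D3,D4,D0,U3,D1]),
 ((0,1,0,0,0),[U0,U4,U3,U2,D0,D4,D2,D3]),
 ((0,0,1,0,0),[U0,U3,U4,D0,D3,D4]),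
 ((0,0,0,1,0),[U0,U2,U4,U1,D3,D2,D4,D0,U3,D1]),
 ((0,1,0,0,0),[U0,U4,U3,D0,D4,D3]),
 ((0,0,0,1,0),[U1,U4,U2,D3,D1,D4,U0,U3,D2,D0]),
 ((0,0,0,0,1),[U2,U1,U3,U0,D2,D3,D1,D0]),
 ((0,0,0,1,0),[U0,U2,U1,U4,D3,D2,D4,D0,U3,D1]),
 ((0,0,0,0,1),[U2,U3,U1,U0,D3,D2,D1,D0]),
 ((0,0,0,1,0),[U1,U4,U2,U0,D1,D4,D2,D0]),
 ((0,1,0,0,0),[U0,U4,U2,U3,D0,D4,D2,D3]),
 ((1,1,0,0,1),[U2,U3,D2,D3]),
 ((0,0,1,0,0),[U0,U3,U1,U4,D0,D3,D1,D4]),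
 ((0,0,1,0,0),[U0,U3,U4,U1,D0,D3,D1,D4]),
 ((0,0,0,0,1),[U2,U1,U3,D4,D2,D3,U0,U4,D1,D0]),
 ((0,0,0,1,0),[U1,U2,U4,D1,D3,D4,U0,U3,D2,D0]),
 ((0,1,0,0,0),[U0,U4,U2,U3,D0,D2,D4,D3]),
 ((0,0,1,0,1),[U1,U3,D1,D3]),
 ((1,0,1,1,0),[U1,U4,D1,D4]),
 ((0,0,0,0,1),[U2,D4,U0,U3,U4,U1,D2,D3,D1,D0]),
 ((0,0,1,0,0),[U0,U3,U1,U4,D0,D1,D3,D4]),
 ((0,0,0,1,0),[U1,U2,U4,U0,D1,D4,D2,D0]),
 ((0,0,0,1,0),[U1,U4,U2,U0,D4,D1,D2,D0]),
 ((0,1,0,1,0),[U4,U2,D4,D2]),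
 ((0,0,0,0,1),[U2,U3,U1,U0,D2,D3,D1,D0])]"

definition outer0 :: "(point \<times> step list) list" where
 "outer0 =
[((0,0,0,0,0),[U2,U0,U3,D2,D0,U1,D3,D1]),
 ((0,0,0,0,1),[U2,D4,U0,U3,D2,U1,D3,U4,D1,D0]),
 ((0,0,0,0,1),[U2,D4,U0,U3,D2,U4,D3,D0]),
 ((1,0,0,0,0),[U2,U3,D2,D3]),
 ((0,1,0,0,0),[U4,U0,D4,D0]),
 ((0,0,0,1,0),[U1,D3,U2,D1,U0,U3,D2,D0]),
 ((0,0,0,1,0),[U0,U2,D0,D2]),
 ((0,0,0,0,1),[U0,U2,D0,D2]),
 ((0,0,0,0,1),[U2,D4,U0,U3,D2,D0,U4,D3]),
 ((0,0,0,1,0),[U1,D3,U0,U2,D1,U3,D2,D0]),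
 ((0,0,0,0,1),[U2,U1,U0,D2,D1,D0]),
 ((1,0,1,0,0),[U0,U3,D0,D3]),
 ((0,0,1,0,0),[U0,U3,U4,D0,D3,D4]),
 ((0,1,0,0,0),[U0,U4,U3,D0,D4,D3]),
 ((-1,0,0,1,0),[U1,U0,D1,D0]),
 ((0,0,0,0,1),[U2,D4,U0,U3,U4,U1,D2,D3,D1,D0]),
 ((1,0,1,1,0),[U1,U0,D1,D0]),
 ((-1,0,0,0,0),[U4,U0,U0,U1,D4,D0,U3,D1,D0,D3]),
 ((1,1,0,0,0),[U4,U0,D4,D0]),
 ((-1,0,0,0,1),[U2,U0,D2,D0]),
 ((-1,1,0,0,0),[U3,U0,D3,D0]),
 ((-1,0,1,0,0),[U0,U4,D0,D4]),
 ((0,0,0,1,0),[U1,D3,U0,U0,D1,U3,D0,D0]),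
 ((0,0,0,1,0),[U1,D3,U0,U0,U3,D1,D0,D0]),
 ((0,0,0,0,1),[U2,D4,U0,U3,U4,U1,D3,D2,D1,D0]),
 ((-1,0,0,1,1),[U1,U2,D1,D2]),
 ((0,0,0,0,1),[U2,D4,U0,U3,U4,U0,D2,D3,D0,D0]),
 ((2,0,0,1,1),[U1,U2,D1,D2]),
 ((-1,1,0,0,1),[U2,U3,D2,D3]),
 ((1,0,0,0,1),[U0,U1,D0,D1]),
 ((0,0,0,0,1),[U2,D4,U0,U0,U4,D2,D0,D0]),
 ((0,0,0,0,1),[U2,D4,U0,U0,D2,U4,D0,D0]),
 ((1,0,0,1,0),[U2,D3,U0,D2,U3,D0]),
 ((1,1,0,0,1),[U0,U2,D0,D2]),
 ((0,0,0,0,1),[U2,D4,U0,U3,D2,U0,D3,U4,D0,D0]),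
 ((1,0,0,1,0),[U2,U0,D2,D0]),
 ((-1,0,0,1,0),[U2,D3,U0,U0,U3,D2,D0,D0]),
 ((-1,0,0,0,0),[U2,U0,U0,U3,D2,D0,D0,D3]),
 ((0,0,0,1,0),[U0,U0,U4,D3,D0,U1,D4,D0,U3,D1]),
 ((-1,0,0,1,0),[U4,U2,D4,D2]),
 ((-1,0,0,0,0),[U2,U0,U4,D2,D0,D4]),
 ((1,1,0,0,1),[U2,U3,D2,D3]),
 ((-1,0,0,0,1),[U0,U2,D4,D0,U3,U4,D2,D3]),
 ((-1,0,0,0,1),[U0,U0,U1,D4,D0,D0,U4,D1]),
 ((-1,0,0,0,0),[U4,U0,U0,U1,D4,D0,D0,D1]),
 ((0,0,0,0,1),[U2,D4,U0,U3,U0,U4,D3,D2,D0,D0]),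
 ((-1,0,0,0,1),[U3,U1,D3,D1]),
 ((1,0,0,1,0),[U2,D3,U0,U4,U3,D2,D4,D0]),
 ((-1,0,0,0,0),[U1,U0,U3,D1,D0,D3]),
 ((2,0,0,0,1),[U2,U3,D2,D3]),
 ((-1,0,0,1,0),[U4,U1,D3,D4,U0,U3,D1,D0]),
 ((-1,0,0,0,0),[U2,U0,U4,D2,U0,U1,D4,D0,D0,D1]),
 ((1,0,0,0,1),[U0,D4,U1,D0,U4,D1]),
 ((-1,0,1,0,0),[U0,U4,D2,U0,U1,D4,D0,D0,U2,D1]),
 ((1,0,0,1,0),[U2,U1,U0,D2,D1,D0]),
 ((1,0,1,0,0),[U0,U1,U3,D0,D1,D3]),
 ((-1,0,0,1,1),[U2,D4,D3,U1,U4,D2,U3,D1]),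
 ((2,0,0,1,0),[U1,U4,D1,D4]),
 ((-1,1,0,0,0),[U4,U2,D4,D2]),
 ((0,0,0,1,0),[U0,U0,U4,U1,D0,D3,D4,D0,U3,D1]),
 ((-1,0,1,0,1),[U0,D2,U0,U1,D4,D0,D0,U2,U4,D1]),
 ((0,0,0,1,0),[U0,U0,U1,U4,D0,D3,D4,D0,U3,D1]),
 ((1,0,0,0,1),[U0,U3,U1,D0,D3,D1]),
 ((-1,0,0,1,1),[U2,D3,U1,D2,U3,D1]),
 ((0,0,0,0,1),[U2,D4,U0,U0,D2,U1,D0,U4,D1,D0]),
 ((-1,0,1,0,1),[U3,D4,U1,D2,U4,D3,U2,D1]),
 ((0,0,0,0,1),[U2,D4,U0,U0,U1,D2,D0,U4,D1,D0]),
 ((-1,0,0,1,1),[U2,D4,U1,D2,U4,D1]),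
 ((2,0,1,0,0),[U4,U1,D4,D1]),
 ((-1,0,0,1,1),[U2,D3,U1,D4,U3,D2,U4,D1]),
 ((1,1,0,0,1),[U0,U3,D0,D3]),
 ((-1,0,0,1,1),[U2,D4,U1,D3,U4,D2,U3,D1]),
 ((1,1,0,0,0),[U0,U3,U4,D0,D3,D4]),
 ((-1,0,0,1,1),[U2,D4,U1,D3,D2,U4,U3,D1]),
 ((-1,1,0,0,1),[U3,D4,U2,D3,U4,D2]),
 ((1,1,0,0,0),[U0,U2,U4,D1,U3,D2,U1,D0,D3,D4]),
 ((2,0,0,1,1),[U1,D3,U2,D1,U3,D2]),
 ((-1,0,0,1,0),[U2,U1,D3,U4,D2,U3,D1,D4]),
 ((1,1,0,0,0),[U0,U2,U4,D0,D2,D4]),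
 ((-1,0,0,0,1),[U1,U2,D4,U3,D1,U4,D2,D3]),
 ((-1,0,0,0,1),[U0,U2,D4,U0,U3,D2,D0,D0,U4,D3]),
 ((2,0,0,1,1),[U1,D4,D3,U2,U4,D1,U3,D2]),
 ((-1,0,1,0,1),[U3,D4,U1,D3,U4,D1]),
 ((1,0,1,0,0),[U0,U4,U3,D2,U1,D4,U2,D0,D1,D3]),
 ((-1,0,1,0,0),[U3,U1,D3,D1]),
 ((1,0,0,0,1),[U0,U3,U1,D4,D3,D0,U4,D1]),
 ((-1,1,0,1,0),[U2,U4,D2,D4]),
 ((-1,0,1,1,0),[U1,U4,D1,D4]),
 ((1,0,0,0,1),[U0,U2,U1,D0,D2,D1]),
 ((-1,0,1,0,1),[U1,U3,D1,D3]),
 ((0,0,0,1,0),[U0,U0,U4,U1,D3,D0,D4,D0,U3,D1]),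
 ((-1,1,1,0,0),[U3,U4,D3,D4]),
 ((0,0,0,0,1),[U2,D4,U0,U0,U4,U1,D2,D0,D1,D0]),
 ((-1,0,0,1,0),[U2,U1,U4,D2,D1,D4]),
 ((-1,0,0,0,1),[U3,U2,U1,D3,D2,D1]),
 ((1,1,0,0,0),[U0,U3,U4,D1,U2,D3,U1,D0,D2,D4]),
 ((0,0,0,0,1),[U2,D4,U0,U0,U1,U4,D2,D0,D1,D0]),
 ((0,0,0,1,0),[U0,U0,U1,U4,D3,D0,D4,D0,U3,D1]),
 ((-1,0,1,0,0),[U3,U4,U1,D3,D4,D1]),
 ((1,0,0,0,1),[U0,U2,U1,D4,D2,D0,U4,D1]),
 ((-1,1,0,0,0),[U4,U3,U2,D4,D3,D2]),
 ((1,1,0,0,1),[U3,U0,D1,U2,D3,U1,D0,D2]),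
 ((-1,0,0,0,1),[U0,U2,D4,D0,U3,U1,U4,D3,D2,D1]),
 ((1,1,0,0,1),[U3,U0,D4,U2,D3,U4,D0,D2]),
 ((-1,0,0,0,1),[U0,U2,D4,D0,U3,U1,U4,D2,D1,D3]),
 ((-1,0,0,0,1),[U0,U2,D4,D0,U1,U3,U4,D2,D1,D3]),
 ((1,0,0,1,0),[U2,U1,U0,D3,U4,D1,U3,D2,D4,D0]),
 ((-1,0,0,0,1),[U0,U2,D4,D0,U3,U1,U4,D2,D3,D1]),
 ((1,1,0,0,1),[U3,U0,D4,U2,D1,U4,D3,U1,D0,D2]),
 ((0,0,0,0,1),[U2,D4,U0,U0,U4,U1,D0,D2,D1,D0]),
 ((-1,0,0,0,1),[U0,U2,D4,D0,U1,U3,U4,D1,D2,D3]),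
 ((-1,0,1,0,0),[U0,U0,U3,D2,D0,U1,D0,U2,D3,D1]),
 ((-1,0,0,0,1),[U0,U0,U1,D4,D0,U3,D0,U4,D1,D3]),
 ((1,0,0,0,1),[U1,U2,U0,D4,U3,D2,U4,D1,D3,D0]),
 ((1,0,0,1,0),[U2,D3,U0,U1,U3,D2,D1,D0]),
 ((-1,0,0,0,1),[U0,U2,D4,D0,U1,U3,U4,D2,D3,D1]),
 ((-1,0,0,0,1),[U0,U2,D4,D0,U1,U4,U3,D2,D1,D3]),
 ((2,0,0,1,0),[U4,U2,D3,U1,D4,U3,D2,D1]),
 ((0,0,0,1,0),[U0,U2,U0,U1,D3,D2,D0,D0,U3,D1]),
 ((-1,0,0,0,1),[U0,U2,D4,D0,U3,U4,U1,D3,D2,D1]),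
 ((-1,0,0,0,1),[U0,U2,D4,D0,U1,U4,D2,D1]),
 ((2,0,0,1,1),[U1,D4,U2,D3,D1,U4,U3,D2]),
 ((2,1,0,0,0),[U3,U2,D3,D2]),
 ((-1,0,0,0,1),[U0,U2,D4,D0,U1,U4,U3,D1,D2,D3]),
 ((0,0,0,0,1),[U2,D4,U0,U3,U0,U4,D2,D3,D0,D0]),
 ((0,0,0,1,0),[U1,D3,U0,U0,U3,U2,D1,D0,D2,D0]),
 ((-1,0,0,0,1),[U0,U2,D4,D0,U3,U4,U1,D2,D3,D1]),
 ((-1,0,0,0,1),[U0,U0,U1,D4,D0,U3,D0,U4,D3,D1]),
 ((-1,0,1,0,0),[U0,U0,U3,D2,D0,U1,D0,U2,D1,D3]),
 ((1,0,0,0,1),[U0,U2,U1,D4,U3,D2,U4,D0,D3,D1]),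
 ((0,0,0,1,0),[U1,U2,U0,D1,D2,D0]),
 ((0,0,0,1,0),[U1,D3,U0,U0,U3,U2,D0,D1,D2,D0]),
 ((-1,0,1,0,0),[U0,U4,U3,D0,U1,D4,D3,D1]),
 ((2,0,0,0,1),[U2,U1,D4,U3,D2,U4,D1,D3]),
 ((-1,0,0,0,1),[U0,U2,U3,D0,D4,U1,D3,U4,D2,D1]),
 ((2,0,0,1,1),[U1,D4,U2,D3,U4,D1,U3,D2]),
 ((0,0,0,1,0),[U0,U2,U1,U0,D3,D2,D0,D0,U3,D1]),
 ((1,0,0,0,1),[U0,U3,U2,U1,D3,D0,D2,D1]),
 ((-1,0,0,0,1),[U0,U2,U3,D0,U1,D2,D3,D1]),
 ((1,1,0,0,0),[U0,U3,U2,U4,D3,D0,D2,D4]),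
 ((1,0,0,0,1),[U0,U3,U2,U1,D4,D2,D3,D0,U4,D1]),
 ((-1,0,0,0,1),[U0,U2,U3,D0,D2,D3]),
 ((1,1,0,0,1),[U3,U0,D1,U2,D4,U1,D3,U4,D0,D2]),
 ((-1,0,0,1,0),[U2,U4,U1,D3,D4,D2,U0,U3,D1,D0]),
 ((-1,0,0,1,0),[U2,U1,D3,D2,U0,U3,D1,D0]),
 ((-1,0,1,0,0),[U0,U4,U3,D0,D4,D3]),
 ((2,0,0,1,1),[U1,D4,U2,D1,U4,D2]),
 ((2,1,0,0,1),[U3,D4,U2,D3,U4,D2]),
 ((2,0,0,1,1),[U1,D3,U2,D4,U3,D1,U4,D2]),
 ((-1,0,1,0,0),[U0,U4,U3,D0,U1,D3,D4,D1]),
 ((2,0,1,0,1),[U1,D2,U3,D4,U2,D1,U4,D3]),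
 ((2,0,1,0,1),[U1,D4,U3,D1,U4,D3]),
 ((-1,0,0,1,1),[U2,U0,D3,D4,D0,U1,U4,D2,U3,D1]),
 ((-1,0,0,1,0),[U2,U4,D3,U0,D4,U0,U3,D2,D0,D0]),
 ((1,0,1,0,0),[U0,U1,U3,D2,U4,D1,U2,D0,D4,D3]),
 ((-1,0,1,0,1),[U0,U3,D0,D3]),
 ((2,1,1,0,0),[U4,U3,D4,D3]),
 ((1,0,0,0,1),[U0,U2,U1,U3,D2,D0,D3,D1]),
 ((-1,0,0,0,1),[U0,U2,U1,D0,D2,D1]),
 ((1,0,1,0,0),[U0,U4,U3,D0,D4,D3]),
 ((-1,0,0,0,1),[U0,U2,U1,D0,U3,D1,D2,D3]),
 ((1,0,0,1,0),[U2,U4,U0,D3,U1,D4,U3,D2,D1,D0]),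
 ((2,0,0,0,1),[U2,U1,U3,D2,D1,D3]),
 ((-1,0,0,0,1),[U0,U2,U3,D0,U1,D3,D2,D1]),
 ((-1,0,0,1,0),[U2,U4,U1,D3,D2,D4,U0,U3,D1,D0]),
 ((1,0,0,0,1),[U0,U2,U3,U1,D4,D2,D3,D0,U4,D1]),
 ((1,0,0,0,1),[U0,U2,U1,U3,D4,D2,D3,D0,U4,D1]),
 ((-1,0,0,1,0),[U2,U4,U1,D2,D3,D4,U0,U3,D1,D0]),
 ((2,1,0,1,0),[U4,U2,D4,D2]),
 ((1,0,0,0,1),[U0,U3,U1,U2,D0,D3,D2,D1]),
 ((-1,0,0,1,0),[U4,U2,U1,D3,D2,D4,U0,U3,D1,D0]),
 ((2,0,1,0,1),[U3,U1,D3,D1]),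
 ((-1,0,0,1,0),[U2,U1,U4,D3,D2,D4,U0,U3,D1,D0]),
 ((1,0,0,1,0),[U2,D3,U0,U4,U1,U3,D4,D2,D1,D0]),
 ((1,0,0,1,0),[U2,D3,U0,U4,U3,U1,D4,D2,D1,D0]),
 ((1,0,1,1,0),[U4,U0,D4,D0]),
 ((-1,0,0,1,0),[U4,U1,U2,D3,D4,D2,U0,U3,D1,D0]),
 ((1,0,0,1,0),[U2,U4,U0,D2,D4,D0]),
 ((-1,0,0,1,0),[U4,U2,U1,D3,D4,D2,U0,U3,D1,D0]),
 ((-1,0,0,1,0),[U4,U1,U2,D4,D3,D2,U0,U3,D1,D0]),
 ((1,0,1,1,0),[U4,U0,D2,U1,D4,U2,D0,D1]),
 ((-1,0,0,1,0),[U4,U2,U1,D4,D3,D2,U0,U3,D1,D0]),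
 ((-1,0,0,1,0),[U2,U1,U4,D2,D3,D4,U0,U3,D1,D0]),
 ((0,0,0,0,1),[U2,D4,U0,U0,U1,U4,D0,D2,D1,D0]),
 ((-1,1,0,0,0),[U0,U3,U4,D0,U2,D3,D4,D2]),
 ((1,0,1,1,0),[U4,U0,D3,U1,D4,U3,D0,D1]),
 ((-1,1,0,0,0),[U0,U3,U4,D0,U2,D4,D3,D2]),
 ((1,0,1,1,0),[U4,U0,D2,U1,D3,U2,D4,U3,D0,D1]),
 ((-1,0,0,1,0),[U2,U1,U4,D2,U0,D4,D1,D0]),
 ((1,0,1,0,0),[U0,U1,U4,U3,D1,D0,D4,D3]),
 ((0,0,0,0,1),[U2,D4,U0,U3,U4,U0,D3,D2,D0,D0]),
 ((1,0,1,1,1),[U1,U0,D1,D0]),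
 ((-1,0,0,1,0),[U2,U4,U1,D2,U0,D4,D1,D0]),
 ((1,0,0,0,1),[U0,U2,U3,U1,D4,D3,D2,D0,U4,D1]),
 ((-1,1,0,1,0),[U4,U0,D4,D0]),
 ((1,0,1,1,0),[U4,U0,D3,U1,D2,U3,D4,U2,D0,D1]),
 ((1,1,0,1,1),[U2,U0,D2,D0]),
 ((2,0,1,0,0),[U4,U3,U1,D4,D3,D1]),
 ((2,1,0,0,1),[U2,U3,D2,D3]),
 ((1,0,1,1,0),[U4,U0,U1,D4,D0,D1]),
 ((1,0,1,0,0),[U0,U1,U3,U4,D0,D1,D4,D3]),
 ((0,0,0,1,0),[U1,U4,U2,U0,D4,D1,D2,D0]),
 ((1,0,1,0,0),[U0,U4,U3,U1,D4,D0,D1,D3]),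
 ((1,0,1,0,0),[U0,U4,U1,U3,D0,D1,D4,D3]),
 ((-1,0,0,1,0),[U4,U1,U0,D4,D1,D0]),
 ((1,0,0,1,0),[U2,U4,U1,U0,D2,D1,D4,D0]),
 ((-1,1,0,0,0),[U0,U3,U4,D0,D3,D4]),
 ((1,0,0,0,1),[U0,U3,U2,U1,D0,D3,D2,D1]),
 ((1,1,1,0,1),[U3,U0,D3,D0]),
 ((2,0,0,1,0),[U4,U2,U1,D4,D2,D1]),
 ((-1,0,0,1,1),[U2,D4,U1,D3,D2,U0,U3,U4,D0,D1]),
 ((1,1,0,0,0),[U0,U3,U2,U4,D0,D3,D2,D4]),
 ((-1,0,0,1,0),[U2,U1,D3,U4,D2,U3,U0,D4,D1,D0]),
 ((2,0,1,1,0),[U4,U1,D4,D1]),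
 ((-1,0,1,1,1),[U0,D3,U1,D0,U3,D1]),
 ((1,0,0,1,0),[U2,D3,U0,U1,U3,U4,D1,D2,D4,D0]),
 ((1,1,0,0,1),[U3,U0,U2,D3,D0,D2]),
 ((-1,0,0,1,0),[U4,U2,D3,U0,D4,U0,U3,D2,D0,D0]),
 ((1,0,0,0,1),[U0,U2,U3,U1,D2,D0,D3,D1]),
 ((1,0,0,1,0),[U2,D3,U0,U1,U4,U3,D2,D1,D4,D0]),
 ((-1,0,1,1,0),[U4,U0,D3,U1,D0,D4,U3,D1]),
 ((1,0,0,1,0),[U2,D3,U0,U4,U1,U3,D2,D1,D4,D0]),
 ((-1,0,0,0,1),[U0,U2,U1,D0,D4,U3,D1,U4,D2,D3]),
 ((1,1,0,0,0),[U0,U2,U3,U4,D0,D3,D2,D4]),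
 ((1,0,0,0,1),[U0,U2,U3,U1,D0,D3,D2,D1]),
 ((1,1,0,0,1),[U0,U3,U2,D0,D3,D2]),
 ((-1,0,1,0,0),[U0,U4,U1,D0,U3,D4,D1,D3]),
 ((-1,1,0,0,0),[U0,U0,U4,D1,D0,U2,U1,D0,D4,D2]),
 ((1,0,0,1,0),[U2,D3,U0,U1,U4,U3,D1,D2,D4,D0]),
 ((1,0,0,0,1),[U0,U2,U1,U3,D2,D4,D3,D0,U4,D1]),
 ((-1,0,0,1,1),[U2,U0,D3,U1,D0,D4,U3,D2,U4,D1]),
 ((1,0,0,1,0),[U2,D3,U0,U4,U1,U3,D2,D4,D1,D0]),
 ((-1,0,1,1,0),[U4,U0,D3,U1,D0,D2,U3,D4,U2,D1]),
 ((-1,0,0,1,1),[U2,U0,D3,U1,D0,D2,U3,D1]),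
 ((-1,0,1,0,1),[U1,U0,D1,D0]),
 ((1,0,0,1,0),[U2,U1,U0,U4,D1,D2,D4,D0]),
 ((-1,0,0,1,0),[U2,U4,U0,D3,D4,U0,U3,D2,D0,D0]),
 ((1,0,0,1,0),[U2,U1,U0,U4,D2,D1,D4,D0]),
 ((1,1,0,0,0),[U0,U3,U4,U2,D3,D0,D2,D4]),
 ((1,0,0,0,1),[U0,U3,U1,U2,D3,D0,D2,D1]),
 ((1,0,0,1,0),[U2,U4,U1,U0,D2,D4,D1,D0]),
 ((1,1,0,0,0),[U0,U3,U4,U2,D0,D3,D2,D4]),
 ((1,0,0,1,0),[U2,D3,U0,U1,U3,U4,D2,D1,D4,D0]),
 ((-1,0,0,1,1),[U2,D4,D3,U0,U4,U1,D0,D2,U3,D1]),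
 ((-1,0,1,0,0),[U0,U4,U1,D0,D4,D1]),
 ((1,0,1,0,0),[U0,U4,U1,U3,D4,D0,D1,D3]),
 ((1,0,0,1,0),[U2,U4,U1,U0,D4,D2,D1,D0]),
 ((2,1,0,0,0),[U3,U4,U2,D3,D4,D2]),
 ((1,0,0,1,0),[U2,D3,U0,U1,U4,U3,D2,D4,D1,D0]),
 ((1,0,0,0,1),[U0,U2,U3,U1,D2,D4,D3,D0,U4,D1]),
 ((1,0,0,1,0),[U2,U4,U0,U1,D2,D4,D1,D0]),
 ((1,0,0,1,0),[U2,D3,U0,U4,U3,U1,D2,D4,D1,D0]),
 ((0,0,1,0,0),[U0,U3,U1,U4,D0,D1,D3,D4]),
 ((1,1,0,0,0),[U0,U2,U4,U3,D2,D0,D3,D4]),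
 ((1,1,0,0,0),[U0,U2,U3,U4,D0,D2,D3,D4]),
 ((1,1,0,0,0),[U0,U3,U2,U4,D0,D2,D3,D4]),
 ((-1,0,0,0,1),[U0,U2,U1,D0,U3,D2,D1,D3]),
 ((1,0,0,0,1),[U1,D4,U0,U2,U3,U4,D1,D2,D3,D0]),
 ((1,0,0,0,1),[U1,D4,U0,U2,U4,U3,D1,D2,D3,D0]),
 ((-1,1,0,0,0),[U0,U0,U4,D1,D0,U2,U1,D0,D2,D4]),
 ((1,1,0,0,0),[U0,U2,U4,U3,D0,D2,D3,D4]),
 ((1,0,0,0,1),[U0,U3,U1,U2,D4,D3,D2,D0,U4,D1]),
 ((1,1,0,0,0),[U0,U2,U3,U4,D2,D0,D3,D4]),
 ((1,0,0,0,1),[U0,U3,U1,U2,D3,D4,D2,D0,U4,D1]),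
 ((1,0,0,1,0),[U2,U4,U0,U1,D4,D2,D1,D0]),
 ((-1,0,1,0,0),[U0,U4,U1,D0,U3,D1,D4,D3]),
 ((1,0,1,0,0),[U0,U1,U3,U4,D1,D0,D4,D3]),
 ((1,0,0,0,1),[U0,U2,U3,U1,D0,D2,D3,D1]),
 ((1,0,0,0,1),[U0,U3,U2,U1,D0,D2,D3,D1]),
 ((0,0,1,0,0),[U0,U3,U1,U4,D0,D3,D1,D4]),
 ((1,0,0,0,1),[U0,U2,U1,U3,D0,D2,D3,D1]),
 ((1,0,1,0,0),[U0,U1,U4,U3,D0,D1,D4,D3]),
 ((1,0,1,1,0),[U4,U1,U0,D4,D1,D0]),
 ((1,1,0,0,1),[U0,U2,U3,D0,D2,D3])]"

lemma inner0_short: "list_all short_closed inner0"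
  by code_simp

lemma outer0_short: "list_all short_closed outer0"
  by code_simp

text \<open>A core point off the coil would drag further core points with it, as each has two
  neighbours, and the cube has no room for them without a cycle of length at most 10. The
  consequence needed later is that a core containing a coil is that coil, so that its degrees can be
  read off.\<close>

lemma core_coil0:
  assumes s: "sparse k" and c: "list_all k coil0" and k: "core k"
  shows "list_all (\<lambda>p. k p \<longrightarrow> p \<in> set coil0) unit_cube"
proof (rule ccontr)
  assume n: "\<not> ?thesis"
  have w: "list_all (\<lambda>(p, w). \<not> along k p w) inner0"
    by (rule sparse_list [OF s inner0_short])
  show False
    \<comment> \<open>After unfolding, all facts are propositional in the atoms
      \<open>k p\<close>.\<close>
    using c [unfolded coil0_def, simplified] n [unfolded coil0_def unit_cube_def, simplified]
      w [unfolded inner0_def, simplified] k [unfolded core_unfold, simplified] by sat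
qed

text \<open>\<open>k0\<close> and \<open>k1\<close> stand for cores of two neighbouring cubes,
  written in the coordinates of the unit cube and shifted by one step. They are predicates of their
  own, and only included in \<open>s\<close>, because a core need not be the whole part of
  \<open>s\<close> in its cube.\<close>

lemma coil0_blocked:
  assumes s: "sparse s" and c: "list_all s coil0"
    and k0: "core k0" "\<And>a b c d e. k0 (a, b, c, d, e) \<Longrightarrow> s (a + 1, b, c, d, e)"
    and k1: "core k1" "\<And>a b c d e. k1 (a, b, c, d, e) \<Longrightarrow> s (a - 1, b, c, d, e)"
  shows False
proof -
  have w: "list_all (\<lambda>(p, w). \<not> along s p w) outer0"
    by (rule sparse_list [OF s outer0_short])
  \<comment> \<open>For the propositional solver, the inclusion of the neighbour's core in
    \<open>s\<close> is spelled out point by point.\<close>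
  have m0: "list_all (\<lambda>p. k0 p \<longrightarrow> s (go U0 p)) unit_cube"
    using k0(2) by (auto simp: list_all_iff split_paired_all)
  note m0 = m0 [unfolded unit_cube_def, simplified]
  have m1: "list_all (\<lambda>p. k1 p \<longrightarrow> s (go D0 p)) unit_cube"
    using k1(2) by (auto simp: list_all_iff split_paired_all)
  note m1 = m1 [unfolded unit_cube_def, simplified]
  show False
    using c [unfolded coil0_def, simplified] w [unfolded outer0_def, simplified]
      k0(1) [unfolded core_unfold, simplified] m0
      k1(1) [unfolded core_unfold, simplified] m1 by sat
qed

text \<open>\<open>coil0\<close> with (1,0,0,1,0) and (0,0,0,1,0) replaced by (1,1,1,1,0) and
  (0,1,1,1,0). It is excluded with the same two neighbours.\<close>

definition coil1 :: "point list" where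
 "coil1 = [(0,0,0,0,1), (0,0,1,0,1), (0,0,1,0,0), (1,0,1,0,0), (1,0,1,1,0), (1,1,1,1,0), (0,1,1,1,0), (0,1,0,1,0), (0,1,0,0,0), (1,1,0,0,0), (1,1,0,0,1), (1,0,0,0,1)]"

definition inner1 :: "(point \<times> step list) list" where
 "inner1 =
[((0,0,1,0,0),[U0,U4,D0,D4]),
 ((0,0,0,0,0),[U4,U0,U1,D4,D0,D1]),
 ((1,0,0,0,0),[U1,U4,D1,D4]),
 ((0,1,0,0,0),[U0,U3,U2,D0,D2,D3]),
 ((0,1,0,1,0),[U4,U2,D4,D2]),
 ((0,0,0,0,1),[U2,D4,U0,U3,D2,U4,D3,D0]),
 ((0,0,0,0,1),[U2,D4,U0,U3,U1,D0,D2,D3,U4,D1]),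
 ((0,0,1,0,0),[U0,U3,U4,D0,D3,D4]),
 ((0,0,0,0,1),[U3,U2,D3,D2]),
 ((0,0,0,0,1),[U2,U1,U0,D2,D1,D0]),
 ((1,0,1,1,0),[U1,U4,D1,D4]),
 ((0,0,0,0,1),[U2,D4,U0,U3,U1,U4,D3,D2,D1,D0]),
 ((0,0,1,0,0),[U0,U3,U1,D0,D1,D3]),
 ((0,0,1,0,0),[U0,U3,U1,D0,D2,D3,U2,D1]),
 ((0,0,0,0,1),[U2,D4,U0,U3,U1,D0,D2,D1,U4,D3]),
 ((1,0,0,0,1),[U1,U3,D1,D3]),
 ((0,0,0,0,1),[U3,U0,D3,D0]),
 ((1,0,1,0,0),[U3,U1,D3,D1]),
 ((0,0,1,0,0),[U0,U3,U1,D0,U4,D3,D1,D4]),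
 ((0,0,0,1,0),[U1,U2,U0,D1,D2,D0]),
 ((0,1,0,0,0),[U0,U4,D1,U3,U2,D4,U1,D0,D2,D3]),
 ((0,0,0,0,1),[U2,D4,U0,U3,U1,U4,D2,D3,D1,D0]),
 ((0,0,0,0,1),[U0,U1,D4,D0,U3,U4,D1,D3]),
 ((0,0,0,0,1),[U2,U3,U1,D4,D2,D3,U0,U4,D1,D0]),
 ((0,1,0,0,0),[U0,U4,U3,D0,D4,D3]),
 ((0,1,1,1,0),[U0,U4,D0,D4])]"

definition outer1 :: "(point \<times> step list) list" where
 "outer1 =
[((0,1,0,0,0),[U0,U4,D1,U2,D4,U3,U1,D0,D2,D3]),
 ((0,1,0,0,0),[U0,U3,U2,D0,D2,D3]),
 ((0,0,1,0,0),[U0,U3,U1,D0,D1,D3]),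
 ((0,1,0,0,0),[U0,U4,D1,D4,U2,U3,U1,D0,D2,D3]),
 ((0,1,0,0,0),[U4,U0,D4,D0]),
 ((0,1,0,0,0),[U2,U3,D2,D3]),
 ((0,1,0,0,0),[U0,U2,U3,D0,D2,D3]),
 ((0,0,0,0,1),[U2,D4,U0,U3,D2,U4,D3,D0]),
 ((0,0,1,0,0),[U0,U3,U4,D0,D3,D4]),
 ((0,0,0,0,0),[U4,U2,D4,U0,U3,U1,D0,D2,D3,D1]),
 ((-1,0,1,0,0),[U0,U4,D0,D4]),
 ((0,1,0,0,0),[U0,U4,U2,U3,D4,D0,D2,D3]),
 ((-1,0,0,0,1),[U2,U0,D2,D0]),
 ((1,0,1,1,0),[U1,U4,D1,D4]),
 ((-1,1,0,1,0),[U2,U0,D2,D0]),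
 ((1,1,0,0,0),[U4,U0,D4,D0]),
 ((1,0,1,1,0),[U1,U0,D1,D0]),
 ((1,0,0,0,1),[U1,U3,D1,D3]),
 ((1,0,0,0,1),[U0,U1,D0,D1]),
 ((1,0,1,0,0),[U0,U3,D0,D3]),
 ((-1,0,0,0,0),[U4,U0,U0,U1,D4,D0,D0,D1]),
 ((-1,0,0,0,1),[U3,U0,D3,D0]),
 ((-1,0,0,0,1),[U0,U0,U1,D4,D0,D0,U4,D1]),
 ((-1,0,0,1,1),[U1,U2,D1,D2]),
 ((0,0,0,0,1),[U2,U1,U0,D2,D1,D0]),
 ((0,1,0,0,0),[U0,U4,U3,D0,D4,D3]),
 ((0,0,0,0,1),[U2,D4,U0,U0,D2,U4,D0,D0]),
 ((0,0,0,0,1),[U2,D4,U0,U0,U4,D2,D0,D0]),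
 ((0,1,0,0,0),[U0,U0,U2,U3,D0,D0,D2,D3]),
 ((0,1,0,0,0),[U0,U0,U3,U2,D0,D0,D2,D3]),
 ((2,1,1,0,0),[U4,U3,D4,D3]),
 ((2,0,0,1,1),[U1,U2,D1,D2]),
 ((2,0,0,1,0),[U1,U4,D1,D4]),
 ((2,0,0,0,1),[U2,U3,D2,D3]),
 ((1,0,0,0,1),[U0,U3,D0,D3]),
 ((-1,0,0,0,0),[U3,U4,D3,D4]),
 ((2,0,0,0,0),[U4,U3,D4,D3]),
 ((-1,0,0,0,0),[U3,U2,D3,D2]),
 ((0,0,0,0,1),[U2,D4,U0,U3,U4,D2,D3,D0]),
 ((-1,0,0,0,0),[U2,U0,U4,D2,D0,D4]),
 ((0,0,0,0,1),[U2,D4,U0,U3,U0,D2,D3,U4,D0,D0]),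
 ((-1,0,0,0,1),[U0,U2,D4,D0,U3,U4,D2,D3]),
 ((0,0,0,0,1),[U2,D4,U0,U3,U1,U4,D2,D3,D1,D0]),
 ((-1,0,0,1,0),[U4,U2,D4,D2]),
 ((0,0,0,0,1),[U2,D4,U0,U3,U0,D2,U4,D3,D0,D0]),
 ((-1,0,0,0,0),[U2,U0,U4,D2,U0,U1,D4,D0,D0,D1]),
 ((2,0,0,1,0),[U4,U2,D4,D2]),
 ((-1,0,1,0,1),[U0,D2,U0,U1,D4,D0,D0,U4,U2,D1]),
 ((1,0,1,0,0),[U0,U4,U3,D0,D4,D3]),
 ((-1,0,0,0,1),[U0,U2,D4,D0,U3,D2,U4,D3]),
 ((1,0,1,0,0),[U0,D2,U3,U4,U2,D0,D4,D3]),
 ((-1,1,0,0,0),[U3,U0,D3,D0]),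
 ((1,0,0,0,1),[U3,U0,D4,D3,U1,D0,U4,D1]),
 ((1,0,1,1,0),[U4,U0,D4,D0]),
 ((-1,0,0,1,0),[U4,U1,D4,D1]),
 ((-1,0,0,0,1),[U3,U1,D3,D1]),
 ((-1,0,0,0,1),[U0,U0,U1,D4,D0,U3,D0,D1,U4,D3]),
 ((2,0,0,0,0),[U2,U4,U3,D2,D4,D3]),
 ((-1,0,0,0,0),[U1,U4,U3,D1,D4,D3]),
 ((0,0,0,0,1),[U2,D4,U0,U0,D2,U1,D0,U4,D1,D0]),
 ((-1,0,1,0,0),[U0,U0,U3,U1,D0,D2,D3,D0,U2,D1]),
 ((1,0,0,0,1),[U0,U3,D4,U1,D3,D0,U4,D1]),
 ((-1,0,0,0,0),[U2,U1,U4,D2,U3,D1,D4,D3]),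
 ((1,0,0,0,1),[U0,D4,U1,D0,U4,D1]),
 ((2,0,0,0,0),[U3,U1,D3,D1]),
 ((-1,0,0,1,0),[U2,D3,U1,U4,D2,U3,D1,D4]),
 ((0,0,0,0,1),[U2,D4,U0,U3,U0,U4,D3,D2,D0,D0]),
 ((0,1,0,0,0),[U0,U0,U3,D1,U2,D0,U1,D0,D2,D3]),
 ((-1,0,0,1,1),[U2,D4,D3,U1,U4,D2,U3,D1]),
 ((1,0,0,0,1),[U3,U0,D4,U1,D3,D0,U4,D1]),
 ((-1,0,0,1,1),[U2,D3,U1,D2,U3,D1]),
 ((1,1,0,0,0),[U0,D1,U3,U4,U1,D0,D3,D4]),
 ((-1,0,0,1,0),[U2,U4,D3,U1,D2,U3,D4,D1]),
 ((-1,0,0,0,0),[U2,U0,U0,U3,U1,D0,D2,D0,D1,D3]),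
 ((1,0,0,0,1),[U3,U0,U1,D4,D3,D0,U4,D1]),
 ((-1,0,0,1,0),[U2,D3,U0,U0,U3,U1,D0,D2,D0,D1]),
 ((1,1,0,0,0),[U0,U3,U4,D0,D3,D4]),
 ((-1,1,0,0,0),[U4,U2,D4,D2]),
 ((1,0,0,0,1),[U0,U3,U1,D4,D3,D0,U4,D1]),
 ((1,0,0,0,1),[U3,U0,U1,D3,D0,D1]),
 ((-1,0,1,0,1),[U0,D2,U0,U1,D4,D0,D0,U2,U4,D1]),
 ((-1,0,0,0,1),[U0,U2,D4,D0,U1,U4,D2,D1]),
 ((1,0,0,0,1),[U0,D4,U3,U1,U4,D0,D3,D1]),
 ((1,0,0,0,1),[U0,U3,U1,D0,D3,D1]),
 ((-1,0,0,0,0),[U4,U1,U2,D4,U3,D1,D2,D3]),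
 ((1,1,0,0,1),[U0,U3,D0,D3]),
 ((-1,0,0,0,1),[U1,U2,D4,U3,D1,D2,U4,D3]),
 ((0,1,0,0,0),[U0,U0,U2,D1,D0,U3,U1,D0,D2,D3]),
 ((-1,0,0,0,1),[U1,U2,D4,U3,D1,U4,D2,D3]),
 ((-1,1,0,0,0),[U0,U3,U2,D0,D3,D2]),
 ((0,0,0,0,1),[U2,D4,U0,U0,U1,U4,D0,D2,D1,D0]),
 ((-1,0,0,1,1),[U2,D4,U1,U0,D2,D3,D0,U4,U3,D1]),
 ((2,0,0,0,0),[U3,U4,U2,D3,U1,D4,D2,D1]),
 ((-1,0,0,1,1),[U2,D4,U1,D3,U4,D2,U3,D1]),
 ((-1,0,0,1,0),[U2,U1,D3,U4,D2,U3,D1,D4]),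
 ((1,1,0,0,0),[U0,D1,U3,U4,U2,D3,U1,D0,D2,D4]),
 ((-1,0,1,0,1),[U0,D4,U0,U3,U1,D0,D0,D3,U4,D1]),
 ((0,0,0,0,1),[U2,D4,U0,U0,U1,U4,D2,D0,D1,D0]),
 ((-1,0,1,0,0),[U0,U0,U3,U1,D0,D0,D1,D3]),
 ((-1,0,1,0,0),[U0,U0,U3,U1,D0,D0,D3,D1]),
 ((1,1,0,0,0),[U0,U2,U4,D0,D2,D4]),
 ((-1,1,1,0,0),[U3,U4,D3,D4]),
 ((-1,1,0,0,1),[U2,U3,D2,D3]),
 ((1,0,0,0,1),[U0,U2,U1,D4,D2,D0,U4,D1]),
 ((0,0,0,0,1),[U2,D4,U0,U0,U4,U1,D2,D0,D1,D0]),
 ((-1,0,0,0,0),[U1,U4,U2,U3,D1,D2,D4,D3]),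
 ((-1,0,1,1,0),[U1,U4,D1,D4]),
 ((-1,1,0,0,0),[U4,U2,U3,D4,U0,D2,D3,D0]),
 ((-1,0,0,0,0),[U1,U0,U3,U2,D0,D1,D2,D3]),
 ((-1,0,0,0,0),[U1,U4,U2,U3,D1,D4,D2,D3]),
 ((1,1,0,0,0),[U0,U3,U4,D1,U2,D3,U1,D0,D2,D4]),
 ((0,1,0,0,0),[U0,U0,D1,U3,U2,D0,U1,D0,D2,D3]),
 ((-1,0,0,0,0),[U4,U1,U2,U3,D1,D4,D2,D3]),
 ((-1,0,0,0,1),[U0,U2,D4,D0,U3,U4,U1,D3,D2,D1]),
 ((1,0,0,0,1),[U3,U0,U2,D3,U1,D4,D2,D0,U4,D1]),
 ((1,1,0,0,0),[U0,U2,U4,D1,U3,D2,U1,D0,D3,D4]),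
 ((-1,0,0,0,0),[U4,U1,U2,U3,D4,D1,D2,D3]),
 ((2,0,0,1,1),[U1,D4,D3,U2,U4,D1,U3,D2]),
 ((-1,0,0,0,1),[U1,U2,U3,D4,D1,D2,U4,D3]),
 ((-1,0,0,0,1),[U3,U2,U1,D3,D2,D1]),
 ((2,0,0,1,0),[U4,U2,D3,U1,D4,D2,U3,D1]),
 ((-1,0,0,0,0),[U4,U1,U3,U2,D4,D1,D2,D3]),
 ((1,1,0,0,0),[U0,U3,D1,U4,U2,D3,U1,D0,D2,D4]),
 ((1,1,0,0,1),[U0,U2,D0,D2]),
 ((-1,0,0,0,0),[U4,U1,U3,U2,D1,D4,D2,D3]),
 ((1,0,0,0,1),[U3,U0,U2,D3,U1,D0,D2,D1]),
 ((-1,0,0,0,1),[U0,U2,D4,D0,U3,U4,U1,D2,D3,D1]),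
 ((0,0,0,0,1),[U2,D4,U0,U0,U4,U1,D0,D2,D1,D0]),
 ((-1,0,0,0,0),[U1,U4,U3,U2,D1,D4,D2,D3]),
 ((-1,0,0,1,0),[U2,U1,U4,D2,D1,D4]),
 ((1,1,0,0,1),[U3,U0,D4,D1,U2,U4,D3,U1,D0,D2]),
 ((-1,0,0,1,0),[U2,U4,U1,D2,D4,D1]),
 ((2,0,0,1,0),[U2,U4,D3,U1,D2,U3,D4,D1]),
 ((2,0,1,0,0),[U4,U1,D4,D1]),
 ((-1,0,0,0,0),[U2,U1,U4,U3,D2,D1,D4,D3]),
 ((1,0,0,0,1),[U0,U2,U1,D0,D2,D1]),
 ((-1,0,0,0,0),[U1,U2,U4,U3,D2,D1,D4,D3]),
 ((1,0,0,0,1),[U3,U0,U2,D3,U1,D2,D0,D1]),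
 ((-1,0,0,1,0),[U2,D3,U1,U4,U3,D2,D1,D4]),
 ((1,1,0,0,1),[U3,U0,D1,U2,D3,U1,D0,D2]),
 ((-1,0,0,0,1),[U0,U2,D4,D0,U1,U4,U3,D2,D1,D3]),
 ((2,0,0,1,1),[U1,D3,U2,D1,U3,D2]),
 ((-1,0,0,0,1),[U0,U2,D4,D0,U1,U4,U3,D1,D2,D3]),
 ((0,0,0,0,1),[U2,D4,U0,U3,U4,U0,D3,D2,D0,D0]),
 ((-1,0,1,0,0),[U3,U4,U1,D3,D4,D1]),
 ((1,0,1,1,0),[U4,U0,D2,D4,U1,U2,D0,D1]),
 ((-1,0,0,0,0),[U2,U1,U4,U3,D1,D2,D4,D3]),
 ((0,1,0,0,0),[U0,U4,U3,U0,D4,U2,D0,D0,D2,D3]),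
 ((-1,0,0,0,0),[U1,U2,U4,U3,D1,D2,D4,D3]),
 ((1,0,1,1,0),[U4,U0,D2,U1,D4,U2,D0,D1]),
 ((-1,0,0,0,0),[U1,U2,U4,U3,D1,D4,D2,D3]),
 ((-1,0,1,0,1),[U1,U3,D1,D3]),
 ((1,0,1,0,0),[U0,D2,U3,U1,U2,D0,D1,D3]),
 ((1,0,1,0,0),[U0,U4,U3,D2,U1,D4,U2,D0,D1,D3]),
 ((0,0,0,1,0),[U1,U2,U0,D1,D2,D0]),
 ((-1,0,0,1,1),[U0,D3,U2,D4,D0,U1,U4,U3,D2,D1]),
 ((-1,0,0,1,1),[U2,U1,D3,D4,D1,U0,U4,D2,U3,D0]),
 ((-1,0,1,0,0),[U0,U0,U3,U1,D0,U4,D0,D3,D4,D1]),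
 ((-1,1,0,0,0),[U0,U3,U2,U4,D0,D3,D4,D2]),
 ((-1,1,0,0,0),[U0,U3,U2,U4,D0,D3,D2,D4]),
 ((-1,0,0,1,1),[U2,D4,D3,U0,U4,D2,U3,D0]),
 ((-1,0,0,0,0),[U4,U0,U0,U1,D4,D0,U3,D0,D1,D3]),
 ((-1,0,1,0,1),[U0,D4,U0,U3,U1,D0,U4,D0,D3,D1]),
 ((-1,1,0,1,0),[U0,U2,U4,D0,D2,D4]),
 ((-1,0,0,1,1),[U0,D3,U2,D0,U1,U3,D2,D1]),
 ((-1,0,1,0,1),[U0,D4,U0,U3,U1,D0,D0,U4,D3,D1]),
 ((-1,0,0,1,1),[U0,D3,U2,D0,U1,D2,U3,D1]),
 ((-1,0,0,1,1),[U0,D3,U2,D4,D0,U1,U4,D2,U3,D1]),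
 ((-1,0,0,1,0),[U2,U1,U0,D2,D3,D0,U4,U3,D1,D4]),
 ((-1,0,0,1,1),[U2,D3,U0,D2,U3,D0]),
 ((-1,0,0,0,0),[U2,U0,U4,D2,U3,D0,D4,D3]),
 ((-1,0,0,1,0),[U2,D3,U0,U4,D2,U3,D0,D4]),
 ((-1,0,0,1,0),[U4,U2,U1,U0,D4,D2,D0,D1]),
 ((-1,0,0,1,0),[U2,U4,U1,U0,D4,D2,D0,D1]),
 ((-1,0,0,0,0),[U1,U0,U3,U2,U4,D0,D1,D4,D2,D3]),
 ((-1,0,0,0,0),[U1,U0,U3,U2,U4,D0,D1,D2,D4,D3]),
 ((-1,0,0,0,0),[U1,U0,U3,U2,U4,D0,D2,D1,D4,D3]),
 ((-1,1,0,0,0),[U0,U3,U2,U4,D0,D2,D3,D4]),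
 ((-1,0,0,0,0),[U1,U0,U3,U2,D0,U4,D2,D1,D4,D3]),
 ((-1,1,0,0,0),[U4,U3,U2,D4,U0,D2,D3,D0]),
 ((1,0,0,1,0),[U2,U1,U0,D3,U4,D1,U3,D2,D4,D0]),
 ((0,1,0,0,0),[U0,U4,U0,U3,D4,U2,D0,D0,D2,D3]),
 ((0,1,0,0,0),[U0,U4,U0,U2,D4,U3,D0,D0,D2,D3]),
 ((0,1,0,0,0),[U0,U4,U2,U0,D4,U3,D0,D0,D2,D3]),
 ((1,0,1,0,0),[U0,U1,U3,D0,D1,D3]),
 ((1,0,1,0,0),[U0,D2,U3,U4,U1,U2,D4,D0,D1,D3]),
 ((2,1,0,0,1),[U2,U3,D2,D3]),
 ((1,0,1,0,0),[U0,D2,U3,U1,U4,U2,D1,D0,D4,D3]),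
 ((1,0,1,1,0),[U4,U0,U1,D4,D0,D1]),
 ((0,1,0,0,0),[U0,U4,U2,U0,U3,D4,D0,D0,D2,D3]),
 ((1,0,0,1,0),[U2,D3,U0,D2,U3,D0]),
 ((1,1,0,0,1),[U3,U0,U2,D3,D0,D2]),
 ((-1,0,0,0,0),[U1,U0,U3,U2,D0,U4,D1,D2,D4,D3]),
 ((1,0,1,0,0),[U0,U1,U4,U3,D0,D4,D1,D3]),
 ((1,0,1,0,0),[U0,D2,U3,U4,U2,U1,D0,D4,D1,D3]),
 ((2,0,0,0,0),[U2,U1,U4,U3,D1,D2,D4,D3]),
 ((1,0,1,0,0),[U0,U4,U3,D2,D4,U1,U2,D0,D1,D3]),
 ((0,0,0,0,1),[U2,D4,U0,U3,D2,U0,U4,D3,D0,D0]),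
 ((1,0,0,1,0),[U2,D3,U0,U4,U3,D2,D4,D0]),
 ((2,0,0,0,0),[U2,U4,U3,U1,D2,D4,D1,D3]),
 ((1,0,0,1,0),[U2,U4,U0,D2,D4,D0]),
 ((1,0,1,0,0),[U0,D2,U3,U4,U2,U1,D4,D0,D1,D3]),
 ((1,0,0,0,1),[U3,U0,U2,U1,D3,D0,D2,D1]),
 ((0,0,0,0,1),[U2,D4,U0,U3,D2,U0,D3,U4,D0,D0]),
 ((1,0,0,1,0),[U2,U1,U0,D2,D1,D0]),
 ((2,0,0,0,0),[U3,U1,U2,D3,U4,D1,D2,D4]),
 ((1,0,0,1,0),[U2,U0,D2,D0]),
 ((2,0,1,0,1),[U3,U1,D3,D1]),
 ((1,0,0,0,1),[U0,U2,U1,U3,D2,D4,D3,D0,U4,D1]),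
 ((1,0,0,0,1),[U0,U2,U1,U3,D2,D0,D3,D1]),
 ((0,1,0,0,0),[U0,U0,D1,U3,D0,U2,U1,D0,D2,D3]),
 ((-1,1,1,1,0),[U4,U0,D4,D0]),
 ((0,1,0,0,0),[U0,U0,U3,D1,D0,U2,U1,D0,D2,D3]),
 ((1,0,0,1,0),[U2,U4,U0,D3,U1,D2,U3,D4,D1,D0]),
 ((1,0,1,1,0),[U4,U0,D3,U1,D4,U3,D0,D1]),
 ((2,0,0,1,1),[U1,D4,U2,D3,U4,D1,U3,D2]),
 ((2,0,0,1,0),[U4,U2,D3,U1,D4,U3,D2,D1]),
 ((1,0,0,1,0),[U2,D3,U0,U4,U1,U3,D2,D1,D4,D0]),
 ((1,0,0,0,1),[U0,U2,U3,U1,D2,D0,D3,D1]),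
 ((1,0,0,0,1),[U0,U2,U3,U1,D2,D4,D3,D0,U4,D1]),
 ((1,1,0,0,0),[U0,U3,U4,U2,D3,D0,D2,D4]),
 ((2,0,0,0,1),[U2,U1,D4,U3,D2,D1,U4,D3]),
 ((1,0,0,1,0),[U2,D3,U0,U4,U3,U1,D2,D4,D1,D0]),
 ((2,0,0,0,1),[U2,U1,D4,U3,D2,U4,D1,D3]),
 ((1,1,0,0,0),[U0,U3,D1,U4,U2,U1,D3,D0,D2,D4]),
 ((1,1,0,0,0),[U0,D1,U3,U4,U2,U1,D3,D0,D2,D4]),
 ((1,0,0,0,1),[U0,U3,U2,U1,D3,D0,D2,D1]),
 ((2,0,0,0,0),[U2,U4,U1,U3,D2,D1,D4,D3]),
 ((2,0,0,0,1),[U2,U1,U3,D2,D1,D3]),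
 ((2,0,0,0,0),[U3,U1,U4,U2,D3,D1,D2,D4]),
 ((2,0,0,0,0),[U3,U1,U4,U2,D1,D3,D2,D4]),
 ((2,0,0,0,0),[U3,U1,U2,U4,D1,D3,D2,D4]),
 ((2,0,0,0,0),[U3,U1,U2,U4,D3,D1,D2,D4]),
 ((2,0,0,0,1),[U2,U1,U3,D4,D2,D1,U4,D3]),
 ((1,0,0,0,1),[U0,U3,U1,U2,D3,D4,D2,D0,U4,D1]),
 ((1,0,0,0,1),[U1,D4,U0,U2,U4,U3,D1,D2,D3,D0]),
 ((2,0,0,1,0),[U4,U2,U1,D3,D4,D2,U3,D1]),
 ((0,1,0,0,0),[U0,U4,U0,U2,U3,D4,D0,D0,D2,D3]),
 ((2,0,0,1,0),[U4,U2,U1,D4,D2,D1]),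
 ((1,0,1,1,0),[U0,D2,U1,U4,U2,D0,D4,D1]),
 ((2,0,0,1,0),[U2,U4,U1,D2,D4,D1]),
 ((1,0,1,1,0),[U0,D2,U4,U1,U2,D0,D4,D1]),
 ((0,1,0,0,0),[U0,U4,U0,U2,U3,D0,D4,D0,D2,D3]),
 ((0,0,0,0,1),[U2,D4,U0,U3,U0,D2,U4,D0,D3,D0]),
 ((2,0,0,0,0),[U2,U1,U4,U3,D2,D1,D4,D3]),
 ((1,0,1,0,0),[U0,D2,U3,U4,U1,U2,D0,D4,D1,D3]),
 ((2,0,0,0,0),[U3,U4,U2,U1,D3,D4,D2,D1]),
 ((2,0,0,0,0),[U3,U4,U1,U2,D3,D4,D2,D1]),
 ((2,0,0,0,0),[U2,U1,U4,U3,D2,D4,D1,D3]),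
 ((2,0,0,0,0),[U2,U4,U1,U3,D2,D4,D1,D3]),
 ((1,0,1,0,0),[U0,D2,U3,U1,U4,U2,D0,D4,D1,D3]),
 ((2,1,0,1,0),[U4,U2,D4,D2]),
 ((1,0,1,0,0),[U0,U4,U3,U1,D4,D0,D1,D3]),
 ((1,0,1,0,0),[U0,U4,U1,U3,D4,D0,D1,D3]),
 ((1,0,1,0,0),[U0,U4,U1,U3,D0,D4,D1,D3]),
 ((1,0,1,0,0),[U0,U4,U3,U1,D0,D4,D1,D3]),
 ((1,1,1,1,0),[U4,U0,D4,D0]),
 ((1,0,0,0,1),[U3,U0,U2,U1,D3,D4,D2,D0,U4,D1]),
 ((1,0,0,0,1),[U3,U0,U2,U1,D3,D2,D0,D1]),
 ((1,0,1,1,0),[U0,U4,U1,D0,D4,D1]),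
 ((1,0,0,0,1),[U3,U0,U1,U2,D3,D4,D2,D0,U4,D1]),
 ((2,1,0,0,0),[U3,U4,U2,D3,D4,D2]),
 ((1,0,0,1,0),[U2,U1,U0,U4,D1,D2,D4,D0]),
 ((1,1,0,0,0),[U0,U2,U4,U3,D2,D0,D3,D4]),
 ((1,0,0,0,1),[U0,D4,U3,U1,U4,U2,D3,D0,D2,D1]),
 ((1,0,1,0,0),[U0,U1,U4,U3,D1,D0,D4,D3]),
 ((1,1,0,0,0),[U0,D1,U3,U4,U1,U2,D3,D0,D2,D4]),
 ((1,0,0,1,0),[U2,U1,U4,U0,D2,D4,D1,D0]),
 ((1,0,0,1,0),[U2,U1,U4,U0,D1,D2,D4,D0]),
 ((1,0,0,1,0),[U2,U1,U4,U0,D2,D1,D4,D0]),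
 ((1,0,0,0,1),[U3,U0,U1,U2,D3,D0,D2,D1]),
 ((1,0,0,0,1),[U0,U3,U1,U2,D3,D0,D2,D1]),
 ((1,0,0,1,0),[U2,U1,U0,U4,D2,D1,D4,D0]),
 ((1,0,0,1,0),[U2,D3,U0,U1,U4,U3,D2,D1,D4,D0]),
 ((1,0,0,1,0),[U2,D3,U0,U1,U4,U3,D1,D2,D4,D0]),
 ((1,0,0,1,0),[U2,D3,U0,U1,U4,U3,D2,D4,D1,D0]),
 ((1,0,0,1,0),[U2,U4,U0,U1,D2,D4,D1,D0]),
 ((1,0,0,1,0),[U2,D3,U0,U4,U1,U3,D2,D4,D1,D0])]"

lemma inner1_short: "list_all short_closed inner1"
  by code_simp

lemma outer1_short: "list_all short_closed outer1"
  by code_simp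

lemma core_coil1:
  assumes s: "sparse k" and c: "list_all k coil1" and k: "core k"
  shows "list_all (\<lambda>p. k p \<longrightarrow> p \<in> set coil1) unit_cube"
proof (rule ccontr)
  assume n: "\<not> ?thesis"
  have w: "list_all (\<lambda>(p, w). \<not> along k p w) inner1"
    by (rule sparse_list [OF s inner1_short])
  show False
    using c [unfolded coil1_def, simplified] n [unfolded coil1_def unit_cube_def, simplified]
      w [unfolded inner1_def, simplified] k [unfolded core_unfold, simplified] by sat
qed

lemma coil1_blocked:
  assumes s: "sparse s" and c: "list_all s coil1"
    and k0: "core k0" "\<And>a b c d e. k0 (a, b, c, d, e) \<Longrightarrow> s (a + 1, b, c, d, e)"
    and k1: "core k1" "\<And>a b c d e. k1 (a, b, c, d, e) \<Longrightarrow> s (a - 1, b, c, d, e)"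
  shows False
proof -
  have w: "list_all (\<lambda>(p, w). \<not> along s p w) outer1"
    by (rule sparse_list [OF s outer1_short])
  have m0: "list_all (\<lambda>p. k0 p \<longrightarrow> s (go U0 p)) unit_cube"
    using k0(2) by (auto simp: list_all_iff split_paired_all)
  note m0 = m0 [unfolded unit_cube_def, simplified]
  have m1: "list_all (\<lambda>p. k1 p \<longrightarrow> s (go D0 p)) unit_cube"
    using k1(2) by (auto simp: list_all_iff split_paired_all)
  note m1 = m1 [unfolded unit_cube_def, simplified]
  show False
    using c [unfolded coil1_def, simplified] w [unfolded outer1_def, simplified]
      k0(1) [unfolded core_unfold, simplified] m0
      k1(1) [unfolded core_unfold, simplified] m1 by sat
qed

section \<open>Coils of length 12 that are excluded with a single neighbour\<close>

definition coil2 :: "point list" where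
 "coil2 = [(0,0,0,0,1), (0,0,1,0,1), (1,0,1,0,1), (1,0,1,0,0), (1,0,1,1,0), (0,0,1,1,0), (0,0,0,1,0), (0,1,0,1,0), (1,1,0,1,0), (1,1,0,0,0), (1,1,0,0,1), (0,1,0,0,1)]"

definition inner2 :: "(point \<times> step list) list" where
 "inner2 =
[((0,0,0,1,0),[U2,U0,U1,D2,D0,D1]),
 ((0,0,0,1,0),[U2,U0,D3,U1,D2,U3,D0,D1]),
 ((0,0,0,0,0),[U4,U1,U0,D4,U3,D0,D1,D3]),
 ((0,0,0,1,0),[U2,U0,D3,U4,U1,D2,D4,U3,D0,D1]),
 ((1,0,1,0,0),[U3,U4,D3,D4]),
 ((1,1,0,0,0),[U4,U3,D4,D3]),
 ((0,0,0,0,1),[U2,U0,D4,U3,D2,U1,D3,U4,D0,D1]),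
 ((0,0,0,0,1),[U0,U2,D0,D2]),
 ((0,0,0,0,1),[U2,U0,D4,D2,U1,U4,D0,D1]),
 ((0,0,0,1,0),[U1,U2,D1,D2]),
 ((0,0,0,0,1),[U1,U2,D1,D2]),
 ((0,1,0,0,1),[U3,D4,U0,D3,U4,D0]),
 ((0,0,0,0,1),[U2,U0,D4,U3,D0,D2,U1,D3,U4,D1]),
 ((0,0,0,0,1),[U2,U3,D4,D2,U1,U0,D3,U4,D0,D1]),
 ((0,0,0,0,1),[U2,D4,U3,D2,U1,U0,D3,U4,D0,D1]),
 ((0,0,0,0,1),[U1,U0,D4,U3,D0,D1,U4,D3])]"

definition outer2 :: "(point \<times> step list) list" where
 "outer2 =
[((0,0,0,1,0),[U2,U0,D3,D2,U1,U3,D0,D1]),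
 ((0,0,0,0,1),[U2,U0,D4,U1,D2,U4,D0,D1]),
 ((0,0,0,0,1),[U2,U0,D4,U3,D2,U1,D3,U4,D0,D1]),
 ((0,0,0,1,0),[U2,U0,U1,D2,D0,D1]),
 ((0,0,0,1,0),[U2,U0,D3,U4,U1,D2,D4,U3,D0,D1]),
 ((1,1,0,0,0),[U0,U3,D0,D3]),
 ((1,0,1,0,0),[U3,U4,D3,D4]),
 ((0,0,0,0,1),[U1,U0,D1,D0]),
 ((1,1,0,0,0),[U4,U3,D4,D3]),
 ((1,0,1,0,0),[U0,U4,D0,D4]),
 ((1,0,1,0,0),[U0,U3,D0,D3]),
 ((1,0,1,0,0),[U3,U0,U4,D3,D0,D4]),
 ((1,1,0,0,0),[U4,U0,D4,D0]),
 ((2,0,0,0,0),[U4,U3,D4,D3]),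
 ((2,0,0,0,1),[U1,U3,D1,D3]),
 ((2,1,0,0,1),[U2,U3,D2,D3]),
 ((2,1,1,0,0),[U4,U3,D4,D3]),
 ((2,0,0,0,0),[U3,U4,U1,U2,D4,D3,D2,D1]),
 ((2,0,0,1,0),[U4,U2,D4,D2]),
 ((0,0,0,0,1),[U2,U0,D4,U0,U1,D2,D0,U4,D0,D1]),
 ((1,1,0,0,0),[U3,U0,U4,D3,D0,D4]),
 ((2,0,0,1,0),[U1,U4,D1,D4]),
 ((0,0,0,0,1),[U2,U0,U0,U1,D2,D0,D0,D1]),
 ((0,0,0,0,1),[U2,U0,D4,U0,U1,U4,D2,D0,D0,D1]),
 ((0,0,0,0,1),[U2,U0,U0,U1,D4,D2,D0,U4,D0,D1]),
 ((2,0,0,1,0),[U4,U2,D3,U1,D4,U3,D2,D1]),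
 ((0,0,0,1,0),[U2,U0,U0,U1,D2,D0,D0,D1]),
 ((0,0,0,1,0),[U2,U0,U0,D2,U1,D0,D0,D1]),
 ((1,1,0,0,0),[U3,U0,U2,D3,U4,D2,D0,D4]),
 ((1,0,1,0,0),[U3,U0,U1,D3,U4,D1,D0,D4]),
 ((2,0,0,1,1),[U1,D4,U2,D3,U4,D1,U3,D2]),
 ((2,0,0,1,1),[U1,D3,U2,D4,U3,D1,U4,D2]),
 ((2,0,0,1,0),[U2,U1,D3,U4,D2,U3,D1,D4]),
 ((0,0,0,1,0),[U2,U0,D3,U0,U1,U3,D2,D0,D0,D1]),
 ((0,0,0,1,0),[U2,U0,D3,U0,D2,U3,U1,D0,D0,D1]),
 ((0,0,0,1,0),[U2,U0,U0,D2,D3,U1,D0,U3,D0,D1]),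
 ((0,0,0,1,0),[U2,U0,U0,U1,D3,D2,D0,U3,D0,D1]),
 ((2,0,1,1,0),[U4,U1,D4,D1]),
 ((2,0,0,0,0),[U2,U1,U3,U4,D1,D2,D4,D3]),
 ((2,0,0,0,0),[U3,U4,U2,U1,D4,D3,D2,D1]),
 ((2,0,0,1,0),[U2,U1,U4,D2,D1,D4]),
 ((2,0,0,0,0),[U2,U1,U3,U4,D2,D1,D4,D3]),
 ((2,0,0,1,1),[U1,U2,D1,D2]),
 ((2,1,0,1,0),[U4,U2,D4,D2]),
 ((2,0,0,1,0),[U4,U2,U1,D4,D2,D1]),
 ((1,0,1,0,0),[U3,U0,D2,U4,U1,U2,D3,D1,D0,D4]),
 ((2,0,0,0,0),[U3,U4,U1,U2,D3,D4,D2,D1]),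
 ((2,0,0,0,0),[U2,U1,U4,U3,D2,D1,D4,D3]),
 ((2,0,0,0,0),[U2,U1,U4,U3,D1,D2,D4,D3]),
 ((2,0,0,0,0),[U3,U4,U2,U1,D3,D4,D2,D1]),
 ((2,0,1,0,1),[U3,U1,D3,D1]),
 ((1,1,0,0,0),[U3,U0,D1,U4,U2,U1,D3,D2,D0,D4]),
 ((1,1,0,0,0),[U3,U0,U2,U4,D3,D2,D0,D4]),
 ((1,0,1,0,0),[U3,U0,U1,U4,D3,D1,D0,D4]),
 ((2,0,0,0,1),[U1,U2,U3,D4,D1,D2,U4,D3]),
 ((2,0,0,0,0),[U3,U2,U1,U4,D3,D2,D1,D4]),
 ((1,0,1,0,0),[U3,U0,D2,U4,D3,U2,D0,D4]),
 ((2,0,0,0,1),[U2,U3,D2,D3]),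
 ((1,1,0,0,0),[U3,U0,D1,U4,D3,U1,D0,D4]),
 ((2,0,0,0,1),[U2,U1,D4,U3,D2,D1,U4,D3]),
 ((2,0,0,0,1),[U2,U1,D4,U3,D2,U4,D1,D3]),
 ((2,0,0,0,1),[U1,U2,D4,U3,D1,D2,U4,D3]),
 ((2,0,0,0,1),[U1,U2,D4,U3,D1,U4,D2,D3]),
 ((1,1,0,0,0),[U3,U0,U2,U4,D1,D2,D3,U1,D0,D4]),
 ((2,0,0,0,1),[U1,U2,U3,D1,D2,D3]),
 ((2,0,0,0,1),[U2,U1,U3,D2,D1,D3]),
 ((0,0,0,0,1),[U2,U0,U0,D2,U1,D0,D0,D1]),
 ((1,0,1,0,0),[U3,U0,U1,U4,D2,D1,D3,U2,D0,D4]),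
 ((2,0,0,0,1),[U2,U1,U3,D4,D2,D1,U4,D3]),
 ((2,0,0,0,0),[U1,U2,U4,U3,D2,D1,D3,D4]),
 ((2,0,0,0,0),[U2,U1,U4,U3,D2,D1,D3,D4]),
 ((2,0,0,0,0),[U2,U1,U4,U3,D1,D2,D3,D4]),
 ((2,0,0,0,0),[U1,U2,U4,U3,D1,D2,D3,D4]),
 ((2,0,0,0,0),[U3,U2,U4,U1,D3,D2,D1,D4]),
 ((2,0,0,0,0),[U3,U1,U4,U2,D3,D1,D2,D4]),
 ((2,0,0,0,0),[U3,U1,U4,U2,D1,D3,D2,D4]),
 ((2,0,0,0,0),[U2,U1,U3,U4,D1,D2,D3,D4]),
 ((2,0,0,0,0),[U1,U2,U3,U4,D1,D2,D3,D4]),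
 ((2,0,0,0,0),[U2,U1,U3,U4,D2,D1,D3,D4]),
 ((2,0,0,0,0),[U1,U2,U3,U4,D2,D1,D3,D4]),
 ((2,0,0,0,0),[U3,U1,U2,D3,U4,D1,D2,D4]),
 ((1,1,0,0,0),[U3,U0,D1,D3,U4,U1,D0,D4]),
 ((2,0,0,0,0),[U3,U1,U2,U4,D3,D1,D2,D4]),
 ((2,0,0,0,0),[U3,U1,U2,U4,D1,D3,D2,D4]),
 ((0,0,0,0,1),[U2,U0,U0,D2,D4,U1,D0,U4,D0,D1]),
 ((0,0,0,0,1),[U2,U0,D4,U0,D2,U4,U1,D0,D0,D1]),
 ((2,0,0,0,0),[U3,U2,U1,U4,D2,D3,D1,D4]),
 ((2,0,0,0,0),[U3,U2,U4,U1,D2,D3,D1,D4]),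
 ((1,0,1,0,0),[U3,U0,D2,D3,U4,U2,D0,D4]),
 ((2,0,0,0,0),[U3,U2,U1,D3,U4,D2,D1,D4])]"

lemma inner2_short: "list_all short_closed inner2"
  by code_simp

lemma outer2_short: "list_all short_closed outer2"
  by code_simp

lemma core_coil2:
  assumes s: "sparse k" and c: "list_all k coil2" and k: "core k"
  shows "list_all (\<lambda>p. k p \<longrightarrow> p \<in> set coil2) unit_cube"
proof (rule ccontr)
  assume n: "\<not> ?thesis"
  have w: "list_all (\<lambda>(p, w). \<not> along k p w) inner2"
    by (rule sparse_list [OF s inner2_short])
  show False
    using c [unfolded coil2_def, simplified] n [unfolded coil2_def unit_cube_def, simplified]
      w [unfolded inner2_def, simplified] k [unfolded core_unfold, simplified] by sat
qed

lemma coil2_blocked: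
  assumes s: "sparse s" and c: "list_all s coil2"
    and k0: "core k0" "\<And>a b c d e. k0 (a, b, c, d, e) \<Longrightarrow> s (a + 1, b, c, d, e)"
  shows False
proof -
  have w: "list_all (\<lambda>(p, w). \<not> along s p w) outer2"
    by (rule sparse_list [OF s outer2_short])
  have m0: "list_all (\<lambda>p. k0 p \<longrightarrow> s (go U0 p)) unit_cube"
    using k0(2) by (auto simp: list_all_iff split_paired_all)
  note m0 = m0 [unfolded unit_cube_def, simplified]
  show False
    using c [unfolded coil2_def, simplified] w [unfolded outer2_def, simplified]
      k0(1) [unfolded core_unfold, simplified] m0 by sat
qed

text \<open>\<open>coil2\<close> with the corner (0,0,0,1,0) replaced by (0,1,1,1,0), the other way
  round the same square.\<close>

definition coil3 :: "point list" where
 "coil3 = [(0,0,0,0,1), (0,0,1,0,1), (1,0,1,0,1), (1,0,1,0,0), (1,0,1,1,0), (0,0,1,1,0), (0,1,1,1,0), (0,1,0,1,0), (1,1,0,1,0), (1,1,0,0,0), (1,1,0,0,1), (0,1,0,0,1)]"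

definition inner3 :: "(point \<times> step list) list" where
 "inner3 =
[((0,0,0,0,1),[U2,U0,U1,D2,D0,D1]),
 ((0,0,1,1,0),[U0,U1,D0,D1]),
 ((0,0,0,0,1),[U2,U0,D4,U3,D0,U1,D2,D3,U4,D1]),
 ((0,0,1,1,0),[U0,D3,U1,D2,U3,D0,U2,D1]),
 ((0,0,1,0,1),[U3,D4,U0,D3,U4,D0]),
 ((1,1,0,0,0),[U4,U3,D4,D3]),
 ((0,0,0,0,1),[U2,U0,D4,U3,D0,U1,D2,U4,D3,D1]),
 ((0,0,0,0,1),[U2,U0,D4,D2,U1,U4,D0,D1]),
 ((0,0,1,1,0),[U0,D2,U1,D0,U2,D1]),
 ((1,0,1,0,0),[U3,U4,D3,D4]),
 ((0,0,0,0,1),[U1,U2,D1,D2]),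
 ((0,0,1,1,0),[U0,D3,U4,D2,U1,D4,U3,D0,U2,D1]),
 ((0,0,0,1,0),[U1,U2,D1,D2]),
 ((0,0,0,0,1),[U2,D4,U3,U1,D2,U0,D3,U4,D0,D1])]"

definition outer3 :: "(point \<times> step list) list" where
 "outer3 =
[((0,0,0,0,1),[U2,U0,U1,D2,D0,D1]),
 ((0,0,1,1,0),[U0,D3,D2,U1,U3,D0,U2,D1]),
 ((0,0,0,0,1),[U2,U0,D4,U3,D2,U1,D3,U4,D0,D1]),
 ((0,0,0,0,1),[U2,U0,D4,U1,D2,U4,D0,D1]),
 ((0,0,1,1,0),[U0,U1,D0,D1]),
 ((1,1,0,0,0),[U0,U3,D0,D3]),
 ((1,0,1,0,0),[U3,U4,D3,D4]),
 ((1,1,0,0,0),[U4,U3,D4,D3]),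
 ((0,0,1,1,0),[U0,D3,U4,D2,U1,D4,U3,D0,U2,D1]),
 ((1,0,1,0,0),[U0,U4,D0,D4]),
 ((1,0,1,0,0),[U0,U3,D0,D3]),
 ((1,0,1,0,0),[U3,U0,U4,D3,D0,D4]),
 ((1,1,0,0,0),[U4,U0,D4,D0]),
 ((2,0,0,0,0),[U4,U3,D4,D3]),
 ((2,0,0,0,1),[U1,U3,D1,D3]),
 ((2,1,0,0,1),[U2,U3,D2,D3]),
 ((2,1,1,0,0),[U4,U3,D4,D3]),
 ((2,0,0,0,0),[U3,U4,U1,U2,D4,D3,D2,D1]),
 ((2,0,0,1,0),[U4,U2,D4,D2]),
 ((0,0,0,0,1),[U2,U0,D4,U0,U1,D2,D0,U4,D0,D1]),
 ((1,1,0,0,0),[U3,U0,U4,D3,D0,D4]),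
 ((2,0,0,1,0),[U1,U4,D1,D4]),
 ((0,0,0,0,1),[U2,U0,U0,U1,D2,D0,D0,D1]),
 ((0,0,0,0,1),[U2,U0,D4,U0,U1,U4,D2,D0,D0,D1]),
 ((0,0,0,0,1),[U2,U0,U0,U1,D4,D2,D0,U4,D0,D1]),
 ((2,0,0,1,0),[U4,U2,D3,U1,D4,U3,D2,D1]),
 ((0,0,1,1,0),[U0,U0,D2,U1,D0,D0,U2,D1]),
 ((0,0,1,1,0),[U0,U0,U1,D2,D0,D0,U2,D1]),
 ((1,1,0,0,0),[U3,U0,U2,D3,U4,D2,D0,D4]),
 ((1,0,1,0,0),[U3,U0,U1,D3,U4,D1,D0,D4]),
 ((2,0,0,1,1),[U1,D4,U2,D3,U4,D1,U3,D2]),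
 ((2,0,0,1,1),[U1,D3,U2,D4,U3,D1,U4,D2]),
 ((2,0,0,1,0),[U2,U1,D3,U4,D2,U3,D1,D4]),
 ((0,0,1,1,0),[U0,D3,U0,U1,U3,D2,D0,D0,U2,D1]),
 ((0,0,1,1,0),[U0,D3,U0,D2,U3,U1,D0,D0,U2,D1]),
 ((0,0,1,1,0),[U0,U0,D2,D3,U1,D0,U3,D0,U2,D1]),
 ((0,0,1,1,0),[U0,U0,U1,D3,D2,D0,U3,D0,U2,D1]),
 ((2,0,1,1,0),[U4,U1,D4,D1]),
 ((2,0,0,0,0),[U2,U1,U3,U4,D1,D2,D4,D3]),
 ((2,0,0,0,0),[U3,U4,U2,U1,D4,D3,D2,D1]),
 ((2,0,0,1,0),[U2,U1,U4,D2,D1,D4]),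
 ((2,0,0,0,0),[U2,U1,U3,U4,D2,D1,D4,D3]),
 ((2,0,0,1,1),[U1,U2,D1,D2]),
 ((2,1,0,1,0),[U4,U2,D4,D2]),
 ((2,0,0,1,0),[U4,U2,U1,D4,D2,D1]),
 ((1,0,1,0,0),[U3,U0,D2,U4,U1,U2,D3,D1,D0,D4]),
 ((2,0,0,0,0),[U3,U4,U1,U2,D3,D4,D2,D1]),
 ((2,0,0,0,0),[U2,U1,U4,U3,D2,D1,D4,D3]),
 ((2,0,0,0,0),[U2,U1,U4,U3,D1,D2,D4,D3]),
 ((2,0,0,0,0),[U3,U4,U2,U1,D3,D4,D2,D1]),
 ((2,0,1,0,1),[U3,U1,D3,D1]),
 ((1,1,0,0,0),[U3,U0,D1,U4,U2,U1,D3,D2,D0,D4]),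
 ((1,1,0,0,0),[U3,U0,U2,U4,D3,D2,D0,D4]),
 ((1,0,1,0,0),[U3,U0,U1,U4,D3,D1,D0,D4]),
 ((2,0,0,0,1),[U1,U2,U3,D4,D1,D2,U4,D3]),
 ((2,0,0,0,0),[U3,U2,U1,U4,D3,D2,D1,D4]),
 ((1,0,1,0,0),[U3,U0,D2,U4,D3,U2,D0,D4]),
 ((2,0,0,0,1),[U2,U3,D2,D3]),
 ((1,1,0,0,0),[U3,U0,D1,U4,D3,U1,D0,D4]),
 ((2,0,0,0,1),[U2,U1,D4,U3,D2,D1,U4,D3]),
 ((2,0,0,0,1),[U2,U1,D4,U3,D2,U4,D1,D3]),
 ((2,0,0,0,1),[U1,U2,D4,U3,D1,D2,U4,D3]),
 ((2,0,0,0,1),[U1,U2,D4,U3,D1,U4,D2,D3]),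
 ((1,1,0,0,0),[U3,U0,U2,U4,D1,D2,D3,U1,D0,D4]),
 ((2,0,0,0,1),[U1,U2,U3,D1,D2,D3]),
 ((2,0,0,0,1),[U2,U1,U3,D2,D1,D3]),
 ((0,0,0,0,1),[U2,U0,U0,D2,U1,D0,D0,D1]),
 ((1,0,1,0,0),[U3,U0,U1,U4,D2,D1,D3,U2,D0,D4]),
 ((2,0,0,0,1),[U2,U1,U3,D4,D2,D1,U4,D3]),
 ((2,0,0,0,0),[U1,U2,U4,U3,D2,D1,D3,D4]),
 ((2,0,0,0,0),[U2,U1,U4,U3,D2,D1,D3,D4]),
 ((2,0,0,0,0),[U2,U1,U4,U3,D1,D2,D3,D4]),
 ((2,0,0,0,0),[U1,U2,U4,U3,D1,D2,D3,D4]),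
 ((2,0,0,0,0),[U3,U2,U4,U1,D3,D2,D1,D4]),
 ((2,0,0,0,0),[U3,U1,U4,U2,D3,D1,D2,D4]),
 ((2,0,0,0,0),[U3,U1,U4,U2,D1,D3,D2,D4]),
 ((2,0,0,0,0),[U2,U1,U3,U4,D1,D2,D3,D4]),
 ((2,0,0,0,0),[U1,U2,U3,U4,D1,D2,D3,D4]),
 ((2,0,0,0,0),[U2,U1,U3,U4,D2,D1,D3,D4]),
 ((2,0,0,0,0),[U1,U2,U3,U4,D2,D1,D3,D4]),
 ((2,0,0,0,0),[U3,U1,U2,D3,U4,D1,D2,D4]),
 ((1,1,0,0,0),[U3,U0,D1,D3,U4,U1,D0,D4]),
 ((2,0,0,0,0),[U3,U1,U2,U4,D3,D1,D2,D4]),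
 ((2,0,0,0,0),[U3,U1,U2,U4,D1,D3,D2,D4]),
 ((0,0,0,0,1),[U2,U0,U0,D2,D4,U1,D0,U4,D0,D1]),
 ((0,0,0,0,1),[U2,U0,D4,U0,D2,U4,U1,D0,D0,D1]),
 ((2,0,0,0,0),[U3,U2,U1,U4,D2,D3,D1,D4]),
 ((2,0,0,0,0),[U3,U2,U4,U1,D2,D3,D1,D4]),
 ((1,0,1,0,0),[U3,U0,D2,D3,U4,U2,D0,D4]),
 ((2,0,0,0,0),[U3,U2,U1,D3,U4,D2,D1,D4])]"

lemma inner3_short: "list_all short_closed inner3"
  by code_simp

lemma outer3_short: "list_all short_closed outer3"
  by code_simp

lemma core_coil3:
  assumes s: "sparse k" and c: "list_all k coil3" and k: "core k"
  shows "list_all (\<lambda>p. k p \<longrightarrow> p \<in> set coil3) unit_cube"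
proof (rule ccontr)
  assume n: "\<not> ?thesis"
  have w: "list_all (\<lambda>(p, w). \<not> along k p w) inner3"
    by (rule sparse_list [OF s inner3_short])
  show False
    using c [unfolded coil3_def, simplified] n [unfolded coil3_def unit_cube_def, simplified]
      w [unfolded inner3_def, simplified] k [unfolded core_unfold, simplified] by sat
qed

lemma coil3_blocked:
  assumes s: "sparse s" and c: "list_all s coil3"
    and k0: "core k0" "\<And>a b c d e. k0 (a, b, c, d, e) \<Longrightarrow> s (a + 1, b, c, d, e)"
  shows False
proof -
  have w: "list_all (\<lambda>(p, w). \<not> along s p w) outer3"
    by (rule sparse_list [OF s outer3_short])
  have m0: "list_all (\<lambda>p. k0 p \<longrightarrow> s (go U0 p)) unit_cube"
    using k0(2) by (auto simp: list_all_iff split_paired_all)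
  note m0 = m0 [unfolded unit_cube_def, simplified]
  show False
    using c [unfolded coil3_def, simplified] w [unfolded outer3_def, simplified]
      k0(1) [unfolded core_unfold, simplified] m0 by sat
qed

section \<open>A coil of length 14 that is excluded with two neighbours along different axes\<close>

definition coil4 :: "point list" where
 "coil4 = [(0,0,0,0,1), (0,0,0,1,1), (0,0,0,1,0), (1,0,0,1,0), (1,1,0,1,0), (1,1,1,1,0), (0,1,1,1,0), (0,1,1,0,0), (0,0,1,0,0), (1,0,1,0,0), (1,0,1,0,1), (1,1,1,0,1), (1,1,0,0,1), (0,1,0,0,1)]"

definition inner4 :: "(point \<times> step list) list" where
 "inner4 =
[((0,0,0,0,0),[U4,U3,D4,D3]),
 ((1,0,0,1,0),[U2,U1,D2,D1]),
 ((0,0,0,0,1),[U1,U0,U2,U3,D4,D2,D1,D0,U4,D3]),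
 ((0,1,0,0,1),[U2,U0,D2,D0]),
 ((0,0,1,0,0),[U0,U4,U1,D4,U3,D0,D3,D1]),
 ((0,0,0,1,0),[U4,U0,D4,D0]),
 ((0,0,1,0,0),[U0,U4,U1,D2,U3,D4,U2,D0,D3,D1]),
 ((0,0,0,0,1),[U3,U1,D3,D1]),
 ((0,0,0,1,0),[U2,U1,U0,D2,D1,D0]),
 ((0,0,1,0,0),[U0,U4,U1,D2,D4,U3,U2,D0,D3,D1]),
 ((0,0,0,0,1),[U2,D4,U1,U3,U0,D2,D1,D0,U4,D3]),
 ((0,0,0,0,1),[U1,U0,U2,D1,D2,D0]),
 ((0,0,1,0,0),[U0,D2,U3,U1,U2,D0,D3,D1]),
 ((0,0,0,1,0),[U4,U2,U1,D4,U0,D2,D1,D0]),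
 ((0,0,0,1,0),[U1,U2,U0,D2,D1,D0]),
 ((0,0,1,0,0),[U0,U4,U1,D2,D0,D4,U2,D1]),
 ((0,0,0,0,1),[U1,U0,U2,D1,U3,D0,D2,D3])]"

definition outer4 :: "(point \<times> step list) list" where
 "outer4 =
[((0,0,0,0,1),[U2,D4,U1,U3,U0,D2,D1,D0,U4,D3]),
 ((1,0,0,1,0),[U2,U1,D2,D1]),
 ((0,0,0,0,0),[U4,U3,D4,D3]),
 ((0,0,0,0,1),[U1,U0,U2,D1,D4,D0,U3,D2,U4,D3]),
 ((0,0,0,0,1),[U1,U0,U2,D1,D4,D2,U3,D0,U4,D3]),
 ((0,0,0,0,1),[U1,U0,D1,D0]),
 ((0,0,1,0,0),[U0,U4,U1,D2,U3,D4,U2,D0,D3,D1]),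
 ((0,0,0,0,1),[U1,U0,U2,U3,D4,D2,D1,D0,U4,D3]),
 ((1,0,1,0,0),[U0,U4,D0,D4]),
 ((1,0,1,0,1),[U1,U0,D1,D0]),
 ((1,-1,1,0,0),[U1,U4,D1,D4]),
 ((0,-1,0,1,0),[U0,U1,D0,D1]),
 ((1,0,1,0,0),[U4,U1,D4,D1]),
 ((0,0,0,0,1),[U1,U0,D4,U3,D1,D0,U4,D3]),
 ((0,0,0,1,0),[U4,U0,D4,D0]),
 ((1,1,0,1,0),[U2,U0,D2,D0]),
 ((0,-1,0,0,1),[U3,U1,D3,D1]),
 ((0,0,0,0,1),[U1,U0,U2,D1,U3,D0,D2,D3]),
 ((0,-1,0,0,0),[U4,U1,U1,U0,U2,D1,D4,D0,D1,D2]),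
 ((0,-1,0,0,1),[U1,U1,U0,U2,D1,D1,D2,D0]),
 ((1,-1,0,0,0),[U3,U4,D3,D4]),
 ((0,-1,0,0,1),[U1,U3,D4,U0,D1,U4,D3,D0]),
 ((0,0,0,0,1),[U1,U0,U0,D1,U3,D4,D0,D0,U4,D3]),
 ((0,-1,0,0,0),[U4,U0,D4,D0]),
 ((1,0,0,1,0),[U0,U2,U1,D0,D2,D1]),
 ((0,0,0,0,1),[U1,U0,U0,U3,D1,D4,D0,D0,U4,D3]),
 ((0,0,0,0,1),[U1,U0,U0,D4,D1,U3,D0,D0,U4,D3]),
 ((2,0,0,1,1),[U1,U2,D1,D2]),
 ((2,0,1,1,0),[U4,U1,D4,D1]),
 ((2,0,0,1,0),[U4,U2,D4,D2]),
 ((1,0,0,1,0),[U0,U1,D0,D1]),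
 ((0,-1,0,1,0),[U4,U1,D4,D1]),
 ((0,-1,0,0,0),[U3,U1,U0,U1,U2,D0,D3,D1,D1,D2]),
 ((0,-1,0,0,0),[U4,U1,U3,D4,D1,D3]),
 ((1,0,1,0,1),[U0,D2,U1,D0,U2,D1]),
 ((0,-1,0,0,1),[U2,U3,D4,D2,U1,U4,D3,D1]),
 ((0,0,1,0,0),[U0,U0,D2,U3,D0,U1,U2,D0,D3,D1]),
 ((0,0,1,0,0),[U0,U0,U3,D2,D0,U1,U2,D0,D3,D1]),
 ((0,-1,1,0,0),[U4,U3,D4,D3]),
 ((0,-1,0,0,1),[U2,D4,U1,U0,U4,U1,D2,D0,D1,D1]),
 ((0,-1,0,1,0),[U2,D3,U1,U1,U3,U0,D2,D1,D0,D1]),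
 ((2,0,0,0,0),[U2,U1,D2,D1]),
 ((1,0,1,0,0),[U0,D2,U1,U4,D0,U2,D1,D4]),
 ((0,-1,0,0,1),[U2,U3,U1,D2,D3,D1]),
 ((0,-1,0,1,0),[U2,U4,U1,D2,D4,D1]),
 ((2,0,0,0,1),[U2,U3,D2,D3]),
 ((0,-1,0,1,1),[U1,U2,D1,D2]),
 ((2,0,0,0,0),[U3,U2,U4,D3,D2,D4]),
 ((2,0,0,0,0),[U4,U1,D4,D1]),
 ((0,-1,0,0,1),[U1,U3,D4,U0,D1,D3,U4,D0]),
 ((0,-1,0,0,0),[U4,U1,U3,D4,U0,D1,D3,D0]),
 ((1,0,1,0,0),[U0,D2,U4,U1,D0,U2,D1,D4]),
 ((1,0,1,0,0),[U0,U1,D2,U4,D0,U2,D1,D4]),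
 ((0,-1,0,0,1),[U2,U3,D4,U0,D2,U1,D0,U4,D3,D1]),
 ((2,0,0,0,0),[U4,U3,D4,D3]),
 ((0,-1,0,0,0),[U0,U3,U1,U1,U2,D0,D3,D1,D1,D2]),
 ((0,-1,1,1,0),[U4,U1,D2,D4,U0,D1,U2,D0]),
 ((2,0,0,0,0),[U2,U3,U4,D2,D3,D4]),
 ((0,-1,0,1,1),[U0,D4,U1,D0,U4,D1]),
 ((0,0,0,0,1),[U1,U0,U0,D4,U3,D0,D1,D0,U4,D3]),
 ((1,0,1,0,1),[U0,U3,D2,U1,D3,D0,U2,D1]),
 ((1,0,1,0,0),[U0,U3,U4,D2,U1,D3,D0,U2,D1,D4]),
 ((0,-1,0,0,0),[U0,U4,U3,D0,U2,D4,D3,D2]),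
 ((1,0,1,0,0),[U0,U3,U4,D2,D3,U1,D0,U2,D1,D4]),
 ((0,-1,0,0,0),[U0,U4,U3,D0,U2,D3,D4,D2]),
 ((0,-1,1,0,0),[U1,U0,D1,D0]),
 ((0,0,1,0,0),[U0,U0,D2,U1,U3,D0,U2,D0,D3,D1]),
 ((0,-1,1,0,0),[U4,U0,U1,D4,D0,D1]),
 ((0,-1,0,0,0),[U0,U4,U2,U1,D4,D0,D1,D2]),
 ((2,0,0,0,0),[U1,U3,U4,D1,D3,D4]),
 ((0,-1,1,0,1),[U3,U1,D2,D3,U1,U0,U2,D1,D1,D0]),
 ((2,0,0,0,1),[U1,U3,D1,D3]),
 ((0,0,1,0,0),[U0,U0,U1,D2,U3,D0,U2,D0,D3,D1]),
 ((0,-1,0,0,0),[U0,U4,U2,D0,U3,D4,D2,D3]),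
 ((1,0,1,0,0),[U0,U1,U4,D0,D1,D4]),
 ((0,-1,0,1,1),[U0,D3,U2,U1,U1,D2,D0,D1,U3,D1]),
 ((1,1,0,0,1),[U0,U2,D0,D2]),
 ((1,-1,0,0,1),[U3,D4,U1,U0,U4,U2,D3,D0,D1,D2]),
 ((0,-1,1,0,1),[U3,D4,U0,D2,U4,D3,U2,D0]),
 ((0,0,1,0,0),[U0,U0,U1,U3,D0,D0,D3,D1]),
 ((0,0,1,0,0),[U0,U0,U3,U1,D0,D0,D3,D1]),
 ((0,-1,0,1,1),[U2,D4,U0,D2,U1,D0,U4,D1]),
 ((0,0,1,0,0),[U0,D1,D2,U3,U1,U1,U2,D0,D3,D1]),
 ((1,0,0,1,0),[U0,D3,U1,U2,U3,D0,D2,D1]),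
 ((0,-1,0,1,1),[U0,D3,D4,U2,U3,D0,U4,D2]),
 ((2,0,0,0,0),[U1,U2,U3,D1,U4,D2,D3,D4]),
 ((0,-1,0,0,0),[U0,U2,U3,D0,D2,D3]),
 ((0,-1,0,0,0),[U4,U1,U1,U0,U2,D1,D4,D1,D2,D0]),
 ((0,-1,0,0,1),[U1,U1,U0,U2,D1,D4,D1,D2,U4,D0]),
 ((2,0,0,0,1),[U1,D4,U2,U3,D1,U4,D2,D3]),
 ((0,-1,0,0,1),[U2,U3,U0,D4,D2,U1,D0,U4,D3,D1]),
 ((0,-1,0,0,1),[U2,U0,U1,U1,D2,D0,D1,D1]),
 ((0,-1,0,0,1),[U2,U3,U0,D2,D4,U1,D0,U4,D3,D1]),
 ((0,-1,1,1,0),[U4,U0,D4,D0]),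
 ((0,-1,0,0,1),[U1,U3,U2,D1,U0,D2,D3,D0]),
 ((0,-1,0,0,1),[U1,U3,D4,D1,U2,U0,U4,D2,D3,D0]),
 ((0,-1,0,0,1),[U1,U3,D4,D1,U2,U4,U0,D2,D3,D0]),
 ((0,-1,0,0,1),[U2,U3,U0,D2,D3,D0]),
 ((0,0,1,0,0),[U0,U4,U0,U3,D4,U1,D0,D0,D3,D1]),
 ((0,-1,0,0,0),[U0,U4,U3,U2,D0,D4,D3,D2]),
 ((0,-1,0,0,0),[U0,U4,U3,U2,D0,D4,D2,D3]),
 ((0,-1,0,0,0),[U0,U4,U3,U2,D0,U1,D2,D4,D1,D3]),
 ((2,0,0,1,1),[U1,D3,D4,U2,U3,D1,U4,D2]),
 ((0,-1,0,0,0),[U0,U4,U3,U2,D0,D3,D4,D2]),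
 ((0,-1,0,0,0),[U0,U4,U3,U2,D4,D0,D2,D3]),
 ((0,-1,0,0,0),[U0,U4,U3,U2,D4,D0,D3,D2]),
 ((0,-1,0,0,0),[U0,U2,U3,U4,D0,U1,D2,D4,D1,D3]),
 ((0,-1,0,1,1),[U0,U2,D0,D2]),
 ((0,-1,1,0,1),[U3,U0,D3,D0]),
 ((1,-1,0,0,1),[U3,U2,D3,D2]),
 ((0,-1,1,1,1),[U1,D2,D3,U1,U0,U2,D1,D1,U3,D0]),
 ((0,-1,0,0,0),[U0,U4,U2,U3,D0,D4,D2,D3]),
 ((0,-1,0,0,0),[U0,U4,U2,U3,D4,D0,D2,D3]),
 ((1,-1,0,0,0),[U2,U3,U4,D2,D3,D4]),
 ((1,-1,0,1,0),[U4,U2,D4,D2]),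
 ((0,-1,1,1,1),[U1,D2,D4,U0,D1,U2,U4,D0]),
 ((0,-1,1,1,1),[U1,D2,D4,U0,D1,U4,U2,D0]),
 ((0,-1,0,1,1),[U2,U0,D4,D2,U1,D0,U4,D1]),
 ((0,0,1,0,0),[U0,U4,U0,U3,U1,D4,D0,D0,D3,D1]),
 ((1,-1,0,0,0),[U3,U1,U0,U4,U2,D3,D0,D1,D2,D4]),
 ((0,0,0,0,1),[U1,U0,U0,D1,D4,U3,D0,D0,U4,D3]),
 ((1,0,1,0,0),[U0,U3,U4,U1,D3,D0,D1,D4]),
 ((1,0,1,0,0),[U0,U3,U4,U1,D2,D3,D0,U2,D1,D4]),
 ((2,0,0,0,0),[U3,U2,U4,U1,D3,D4,D2,D1]),
 ((2,0,0,0,0),[U3,U4,U2,U1,D3,D4,D2,D1]),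
 ((2,0,0,0,0),[U3,U4,U1,U2,D3,D4,D2,D1]),
 ((0,0,1,0,0),[U0,U4,U1,U0,D4,U3,D0,D0,D3,D1]),
 ((1,0,0,1,0),[U0,U4,U2,U1,D4,D0,D2,D1]),
 ((1,0,0,1,0),[U0,U4,U1,U2,D4,D0,D2,D1]),
 ((2,0,0,0,1),[U1,D4,U2,U3,U4,D1,D2,D3]),
 ((2,1,0,0,0),[U4,U3,U2,D4,D3,D2]),
 ((1,0,1,0,1),[U0,U3,U1,D2,D3,D0,U2,D1]),
 ((2,1,0,0,0),[U3,U4,U2,D3,D4,D2]),
 ((2,0,0,0,0),[U1,U3,U4,U2,D1,D3,D2,D4]),
 ((2,0,0,0,0),[U1,U2,U4,U3,D1,D2,D3,D4]),
 ((2,0,0,0,0),[U1,U2,U4,U3,D2,D1,D3,D4]),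
 ((2,0,0,0,0),[U1,U2,U3,U4,D1,D2,D3,D4]),
 ((2,0,0,0,0),[U1,U2,U3,U4,D2,D1,D3,D4]),
 ((0,0,1,0,0),[U0,U4,U3,U0,U1,D4,D0,D0,D3,D1]),
 ((0,-1,1,0,0),[U1,U1,U3,U0,D2,D1,D1,U2,D0,D3]),
 ((0,-1,1,0,0),[U1,U0,U4,D1,U3,D0,D4,D3]),
 ((0,-1,1,0,0),[U1,U0,U4,D1,U3,D4,D0,D3]),
 ((1,0,1,0,0),[U0,D2,U4,U3,U1,U2,D3,D0,D1,D4]),
 ((1,0,1,0,0),[U0,D2,U4,U3,U2,U1,D3,D0,D1,D4]),
 ((1,0,1,0,1),[U0,U3,D0,D3]),
 ((1,-1,0,0,0),[U2,U1,U4,U3,D1,D2,D3,D4]),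
 ((1,0,1,0,1),[U3,U0,U1,D3,D0,D1]),
 ((1,0,1,0,1),[U3,U0,U1,D2,D3,D0,U2,D1]),
 ((1,0,1,0,1),[U3,U0,D2,D3,U1,D0,U2,D1]),
 ((1,0,1,0,0),[U0,D2,U4,U3,U2,D0,D3,D4]),
 ((1,0,1,0,1),[U3,U0,D2,D3,D4,U1,U2,U4,D0,D1]),
 ((1,0,1,0,1),[U3,U0,D4,D2,D3,U1,U2,U4,D0,D1]),
 ((1,-1,0,0,0),[U3,U1,U0,U4,U2,D0,D3,D1,D2,D4]),
 ((1,-1,1,0,1),[U1,U3,D1,D3]),
 ((0,-1,0,1,0),[U2,U4,U0,U1,U0,D2,D4,D0,D0,D1]),
 ((0,-1,0,0,0),[U0,U4,U3,U2,U1,D3,D4,D0,D1,D2]),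
 ((1,-1,1,0,0),[U1,U4,U3,D1,D4,D3]),
 ((0,-1,1,0,0),[U1,U0,U4,U3,D1,D0,D4,D3]),
 ((0,-1,1,0,0),[U1,U0,U4,U3,D1,D0,D3,D4]),
 ((0,-1,1,0,0),[U1,U0,U4,U3,D1,D4,D0,D3]),
 ((1,0,1,0,1),[U3,U0,D2,U1,D3,D0,U2,D1]),
 ((1,0,1,0,1),[U3,U0,D2,U1,D4,D3,U2,U4,D0,D1]),
 ((1,0,1,0,0),[U0,U3,U4,D0,D3,D4]),
 ((0,0,1,0,0),[U0,U4,U3,U0,D4,U1,D0,D0,D3,D1])]"

lemma inner4_short: "list_all short_closed inner4"
  by code_simp

lemma outer4_short: "list_all short_closed outer4"
  by code_simp

lemma core_coil4:
  assumes s: "sparse k" and c: "list_all k coil4" and k: "core k"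
  shows "list_all (\<lambda>p. k p \<longrightarrow> p \<in> set coil4) unit_cube"
proof (rule ccontr)
  assume n: "\<not> ?thesis"
  have w: "list_all (\<lambda>(p, w). \<not> along k p w) inner4"
    by (rule sparse_list [OF s inner4_short])
  show False
    using c [unfolded coil4_def, simplified] n [unfolded coil4_def unit_cube_def, simplified]
      w [unfolded inner4_def, simplified] k [unfolded core_unfold, simplified] by sat
qed

lemma coil4_blocked:
  assumes s: "sparse s" and c: "list_all s coil4"
    and k0: "core k0" "\<And>a b c d e. k0 (a, b, c, d, e) \<Longrightarrow> s (a + 1, b, c, d, e)"
    and k1: "core k1" "\<And>a b c d e. k1 (a, b, c, d, e) \<Longrightarrow> s (a, b - 1, c, d, e)"
  shows False
proof -
  have w: "list_all (\<lambda>(p, w). \<not> along s p w) outer4"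
    by (rule sparse_list [OF s outer4_short])
  have m0: "list_all (\<lambda>p. k0 p \<longrightarrow> s (go U0 p)) unit_cube"
    using k0(2) by (auto simp: list_all_iff split_paired_all)
  note m0 = m0 [unfolded unit_cube_def, simplified]
  have m1: "list_all (\<lambda>p. k1 p \<longrightarrow> s (go D1 p)) unit_cube"
    using k1(2) by (auto simp: list_all_iff split_paired_all)
  note m1 = m1 [unfolded unit_cube_def, simplified]
  show False
    using c [unfolded coil4_def, simplified] w [unfolded outer4_def, simplified]
      k0(1) [unfolded core_unfold, simplified] m0
      k1(1) [unfolded core_unfold, simplified] m1 by sat
qed

section \<open>A coil of length 12 that is excluded with two opposite neighbours\<close>

definition coil5 :: "point list" where
 "coil5 = [(0,0,0,0,1), (0,0,0,1,1), (0,0,0,1,0), (0,1,0,1,0), (0,1,1,1,0), (1,1,1,1,0), (1,0,1,1,0), (1,0,1,0,0), (1,0,1,0,1), (1,1,1,0,1), (1,1,0,0,1), (0,1,0,0,1)]"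

definition inner5 :: "(point \<times> step list) list" where
 "inner5 =
[((1,0,1,0,0),[U3,U1,D3,D1]),
 ((0,1,0,1,0),[U2,U0,D2,D0]),
 ((0,0,0,0,0),[U4,U3,D4,D3]),
 ((1,0,1,0,0),[U3,U4,D3,D4]),
 ((1,0,1,0,0),[U3,U1,U4,D3,D1,D4]),
 ((0,0,0,0,1),[U1,D4,U3,D1,U4,D3]),
 ((0,0,0,0,1),[U0,U2,D4,U3,U1,D0,D2,D1,U4,D3]),
 ((0,1,0,0,1),[U2,U0,D2,D0]),
 ((0,0,1,1,0),[U0,U1,D0,D1]),
 ((0,0,0,1,0),[U4,U1,D4,D1]),
 ((0,0,0,1,0),[U1,U2,U0,D1,D2,D0]),
 ((0,0,0,0,1),[U2,U0,U1,D2,D0,D1]),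
 ((1,0,0,0,0),[U2,U4,U1,D2,D4,D1]),
 ((0,0,0,0,1),[U1,U0,U3,D1,D0,D3]),
 ((0,0,1,0,0),[U0,U3,U1,D0,D3,D1]),
 ((0,0,0,1,0),[U4,U2,U1,D4,D2,D1])]"

definition outer5 :: "(point \<times> step list) list" where
 "outer5 =
[((0,0,0,0,1),[U1,U0,U2,U3,D4,D0,D2,D1,U4,D3]),
 ((0,0,0,0,1),[U1,U3,D4,D1,U4,D3]),
 ((0,0,0,0,1),[U2,U0,D4,U3,U1,D0,D2,D1,U4,D3]),
 ((0,0,0,0,1),[U1,U0,D1,D0]),
 ((0,0,0,1,0),[U1,U2,U0,D1,D2,D0]),
 ((0,0,0,0,1),[U1,D4,U3,D1,U4,D3]),
 ((1,0,1,0,0),[U3,U4,D3,D4]),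
 ((1,0,1,0,0),[U4,U1,D4,D1]),
 ((0,1,0,0,1),[U2,U0,D2,D0]),
 ((0,0,0,0,0),[U4,U3,D4,D3]),
 ((0,1,0,1,0),[U2,U0,D2,D0]),
 ((0,0,0,1,0),[U2,U0,U1,D0,D2,D1]),
 ((0,-1,0,1,0),[U4,U1,D4,D1]),
 ((1,-1,1,0,0),[U1,U4,D1,D4]),
 ((1,-1,1,0,0),[U1,U3,D1,D3]),
 ((1,-1,1,0,1),[U3,D4,U1,D3,U4,D1]),
 ((1,1,0,0,1),[U3,U1,D3,D1]),
 ((1,1,0,0,1),[U1,U2,D1,D2]),
 ((0,-1,0,0,1),[U2,U0,U1,U1,D2,D0,D1,D1]),
 ((0,-1,0,0,1),[U1,U1,U0,U2,D1,D1,D2,D0]),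
 ((1,-1,0,0,0),[U3,U4,D3,D4]),
 ((0,-1,0,0,0),[U4,U0,D4,D0]),
 ((0,1,0,0,1),[U1,U0,D1,D0]),
 ((0,-1,0,1,0),[U2,U0,U1,U1,D0,D2,D1,D1]),
 ((0,2,0,0,1),[U3,U2,D3,D2]),
 ((0,-1,1,1,0),[U4,U0,D4,D0]),
 ((0,-1,1,1,0),[U4,U1,D2,D4,U1,U2,U0,D1,D1,D0]),
 ((0,2,0,0,0),[U4,U2,D4,D2]),
 ((1,0,0,0,0),[U2,U4,U1,D2,D4,D1]),
 ((0,1,0,1,0),[U1,U2,D1,D2]),
 ((0,1,1,1,0),[U0,U1,D0,D1]),
 ((1,-1,0,0,0),[U1,U2,D1,D2]),
 ((1,0,1,0,0),[U3,U1,U1,D3,U4,D1,D1,D4]),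
 ((0,1,0,1,0),[U1,U0,U2,D1,D0,D2]),
 ((0,0,1,0,0),[U0,U3,U1,D0,D3,D1]),
 ((0,1,1,1,0),[U4,U1,D4,D1]),
 ((0,-1,0,0,0),[U2,U4,D2,D4]),
 ((0,0,0,1,0),[U4,U0,D1,U2,D4,U1,U1,D0,D2,D1]),
 ((0,2,0,1,1),[U2,U0,D2,D0]),
 ((0,-1,0,0,0),[U4,U1,U3,D4,D1,D3]),
 ((0,0,0,0,1),[U1,U1,U3,D4,D1,D1,U4,D3]),
 ((0,0,0,0,1),[U1,U1,D4,U3,D1,D1,U4,D3]),
 ((0,-1,0,0,0),[U2,U3,D2,D3]),
 ((0,-1,0,0,1),[U3,U1,D3,D1]),
 ((0,2,1,0,0),[U3,U4,D3,D4]),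
 ((0,-1,1,0,0),[U4,U3,D4,D3]),
 ((0,1,0,1,0),[U1,D3,U2,U4,U3,D1,D4,D2]),
 ((0,1,0,1,0),[U1,U4,U2,D1,D4,D2]),
 ((0,-1,0,0,1),[U2,U3,D4,D2,U1,U4,D3,D1]),
 ((0,-1,0,0,1),[U2,D4,U3,D2,U1,U4,D3,D1]),
 ((0,2,0,0,0),[U2,U4,U3,D2,D4,D3]),
 ((0,2,0,0,0),[U3,U0,D3,D0]),
 ((0,-1,0,1,0),[U2,U4,U1,D2,D4,D1]),
 ((0,0,0,0,1),[U1,U1,D4,U2,U3,D1,D2,D1,U4,D3]),
 ((0,-1,0,0,0),[U2,U4,U3,U1,D2,D4,D1,D3]),
 ((0,0,0,0,1),[U1,U1,U2,U3,D1,D4,D2,D1,U4,D3]),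
 ((0,-1,0,0,1),[U2,U3,U1,D2,D3,D1]),
 ((0,2,0,1,0),[U4,U0,D4,D0]),
 ((1,2,0,0,0),[U4,U3,D4,D3]),
 ((0,-1,0,0,0),[U4,U1,U3,U2,D1,D4,D3,D2]),
 ((0,-1,0,1,1),[U1,U2,D1,D2]),
 ((0,1,0,0,1),[U1,U3,U0,D1,D3,D0]),
 ((0,-1,0,0,1),[U1,U3,D4,D1,U0,D3,U4,D0]),
 ((0,-1,0,0,0),[U3,U0,D3,D0]),
 ((0,-1,0,0,1),[U1,U3,D4,D1,U0,U4,D3,D0]),
 ((0,2,0,0,0),[U2,U4,U3,D2,U0,D3,D4,D0]),
 ((0,-1,0,0,0),[U0,U3,U4,D0,U2,D4,D3,D2]),
 ((0,2,0,0,0),[U2,U4,U3,D2,U0,D4,D3,D0]),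
 ((0,-1,0,0,0),[U0,U3,U4,D0,U2,D3,D4,D2]),
 ((0,2,0,0,0),[U2,U3,U4,D2,U0,D4,D3,D0]),
 ((0,-1,0,0,0),[U0,U4,U3,D0,U2,D3,D4,D2]),
 ((0,0,0,0,1),[U1,U0,U3,U1,D0,D4,D1,D1,U4,D3]),
 ((0,-1,0,0,0),[U0,U4,U3,D0,U2,D4,D3,D2]),
 ((0,-1,0,1,1),[U0,D3,D4,U2,D0,U4,U3,D2]),
 ((0,-1,0,1,1),[U0,D4,D3,U2,D0,U3,U4,D2]),
 ((0,2,0,0,0),[U2,U3,U4,D2,U0,D3,D4,D0]),
 ((0,2,0,0,0),[U4,U3,U0,D4,D3,D0]),
 ((0,-1,0,1,1),[U0,D4,D3,U2,D0,U4,U3,D2]),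
 ((0,-1,0,1,0),[U0,D3,U2,U1,U3,U1,D0,D2,D1,D1]),
 ((0,1,0,0,1),[U1,D4,U0,U3,U4,D1,D3,D0]),
 ((0,-1,0,0,0),[U2,U0,D2,D0]),
 ((0,1,0,1,0),[U1,U0,D3,U2,D0,U4,U3,D1,D4,D2]),
 ((0,-1,0,1,1),[U0,D3,D4,U2,D0,U3,U4,D2]),
 ((0,1,0,0,1),[U1,U2,D4,U0,D2,U3,U4,D1,D3,D0]),
 ((0,-1,0,0,1),[U2,D4,U0,U1,U4,U1,D2,D0,D1,D1]),
 ((0,-1,0,0,1),[U1,U1,U0,U2,D1,D4,D1,D2,U4,D0]),
 ((0,2,0,0,0),[U0,U2,D0,D2]),
 ((0,-1,0,1,1),[U0,D3,U2,U1,U1,D2,D0,D1,U3,D1]),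
 ((0,-1,0,1,1),[U2,D3,U0,U1,U1,D2,D0,D1,U3,D1]),
 ((0,2,0,1,1),[U0,D3,D4,U2,D0,U4,U3,D2]),
 ((0,-1,0,0,0),[U0,U4,U2,D0,D4,D2]),
 ((0,2,0,1,1),[U0,D3,D4,U2,D0,U3,U4,D2]),
 ((0,-1,1,0,1),[U3,U1,D2,D3,U1,U0,U2,D1,D1,D0]),
 ((0,-1,0,0,0),[U0,U4,U2,D0,U3,D4,D2,D3]),
 ((0,-1,0,1,0),[U0,D3,U4,U2,D0,U3,D4,D2]),
 ((0,-1,0,1,0),[U0,D3,U4,U2,D0,D4,U3,D2]),
 ((0,2,0,1,0),[U4,U2,D3,D4,U0,D2,U3,D0]),
 ((0,-1,0,1,0),[U0,U4,D3,U2,D0,U3,D4,D2]),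
 ((0,2,0,0,1),[U3,U0,D4,D3,U2,D0,U4,D2]),
 ((0,-1,0,1,0),[U0,U4,D3,U2,D0,D4,U3,D2]),
 ((0,2,0,1,1),[U0,D4,D3,U2,D0,U4,U3,D2]),
 ((0,-1,0,0,0),[U3,U0,U4,D3,U2,D0,D4,D2]),
 ((0,2,0,1,1),[U0,D4,D3,U2,D0,U3,U4,D2]),
 ((0,1,0,0,1),[U1,U2,U0,D1,D2,D0]),
 ((1,-1,0,0,1),[U3,D4,U2,U1,D3,U4,D1,D2]),
 ((0,-1,1,0,0),[U4,U0,U1,D4,U3,D1,D0,D3]),
 ((0,1,0,0,1),[U1,U3,U0,D4,D3,U2,U4,D1,D2,D0]),
 ((0,0,0,0,1),[U1,U0,U3,U1,D4,D0,D1,D1,U4,D3]),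
 ((1,-1,0,0,0),[U3,U2,U1,D3,U4,D1,D2,D4]),
 ((0,-1,1,0,1),[U3,D4,U0,U1,D3,U4,D1,D0]),
 ((0,2,1,0,0),[U0,U4,D0,D4]),
 ((0,-1,0,0,0),[U0,U3,U2,D0,D3,D2]),
 ((0,2,0,1,1),[U0,D1,D3,U2,U1,D0,U3,D2]),
 ((0,-1,0,0,1),[U2,U3,D4,U0,D2,D3,U4,D0]),
 ((0,-1,0,1,1),[U2,D4,U0,U1,U1,D0,D2,D1,U4,D1]),
 ((0,-1,0,1,1),[U0,D4,U2,U1,U1,D0,D2,D1,U4,D1]),
 ((0,1,0,0,1),[U1,D4,U2,U0,U4,D1,D2,D0]),
 ((0,1,1,1,0),[U0,D1,D3,U4,U1,U1,D4,D0,U3,D1]),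
 ((0,-1,0,0,0),[U4,U2,U3,D4,U0,D2,D3,D0]),
 ((0,-1,0,0,1),[U2,D4,U3,U0,D2,D3,U4,D0]),
 ((0,-1,0,0,1),[U2,U3,D4,U0,D2,U4,D3,D0]),
 ((0,2,0,1,0),[U4,U2,D3,U0,D4,D2,U3,D0]),
 ((0,-1,0,0,1),[U2,D4,U3,U0,D2,U4,D3,D0]),
 ((0,1,0,0,1),[U1,D4,U0,U2,U4,D1,D2,D0]),
 ((0,-1,0,0,0),[U4,U0,U3,D4,U2,D0,D3,D2]),
 ((0,-1,0,0,0),[U4,U2,U3,U0,D4,D2,D3,D0]),
 ((0,2,0,0,0),[U3,U4,U2,D3,U0,D4,D2,D0]),
 ((1,-1,0,1,0),[U4,U2,D4,D2]),
 ((0,-1,0,0,1),[U2,U3,U0,D2,D3,D0]),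
 ((0,2,0,0,0),[U2,U4,U0,D1,D2,U3,U1,D4,D3,D0]),
 ((0,-1,1,1,1),[U1,D2,D4,U1,U2,U0,D1,D1,U4,D0]),
 ((1,1,0,0,1),[U3,U1,D4,D3,U2,U4,D1,D2]),
 ((0,1,1,1,0),[U0,D1,D3,U4,U1,U1,D0,U3,D1,D4]),
 ((0,-1,0,0,1),[U2,U3,U0,D4,D2,D3,U4,D0]),
 ((0,-1,0,0,1),[U2,D4,U3,U0,U4,D2,D3,D0]),
 ((0,2,0,1,1),[U0,D4,D3,U2,U4,D0,U3,D2]),
 ((1,2,0,0,0),[U2,U3,D2,D3]),
 ((0,-1,0,0,1),[U1,U3,U2,D1,U0,D2,D3,D0]),
 ((0,0,0,0,1),[U1,U1,U3,U2,D1,D4,D2,D1,U4,D3]),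
 ((0,-1,0,0,1),[U1,U3,D4,D1,U2,U4,U0,D2,D3,D0]),
 ((0,1,1,1,0),[U0,U1,D2,U4,D0,U2,D1,D4]),
 ((0,-1,0,0,0),[U4,U0,U3,U2,D0,D4,D3,D2]),
 ((1,0,1,0,0),[U3,U1,U1,D2,U4,D1,D3,U2,D1,D4]),
 ((0,-1,0,0,0),[U4,U0,U3,U2,D4,D0,D3,D2]),
 ((1,-1,0,0,1),[U3,U2,D3,D2]),
 ((0,-1,0,0,0),[U0,U4,U2,U3,D0,D4,D2,D3]),
 ((0,-1,0,0,0),[U0,U4,U3,U2,D0,D4,D2,D3]),
 ((0,2,0,0,0),[U4,U3,U0,D4,U2,D3,D0,D2]),
 ((0,1,1,1,0),[U0,U1,D3,D0,U4,U3,D1,D4]),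
 ((0,-1,0,0,0),[U0,U3,U2,U4,D0,D3,D4,D2]),
 ((0,-1,1,0,0),[U1,U0,D1,D0]),
 ((0,2,0,1,1),[U0,D4,U2,D3,D0,U4,U3,D2]),
 ((0,-1,1,0,0),[U4,U0,U1,D4,D0,D1]),
 ((0,1,0,1,0),[U1,D3,U2,U0,U3,D1,D0,D2]),
 ((0,-1,0,1,0),[U2,D3,U1,U0,U3,U1,D0,D2,D1,D1]),
 ((0,1,0,1,0),[U1,D3,U0,U2,U3,D1,D0,D2]),
 ((0,-1,0,0,0),[U2,U1,U0,U3,U1,D0,D2,D1,D1,D3]),
 ((0,1,1,1,0),[U0,U1,D2,D3,D0,U2,U4,U3,D1,D4]),
 ((0,-1,0,0,0),[U0,U4,U2,U1,D4,D0,D1,D2]),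
 ((0,2,0,0,1),[U3,U0,D4,U2,D3,D0,U4,D2]),
 ((0,-1,0,0,0),[U0,U4,U2,U1,D4,U3,D1,D0,D3,D2]),
 ((1,0,1,0,0),[U3,U1,U1,D3,D2,U4,D1,U2,D1,D4]),
 ((0,-1,0,0,0),[U4,U1,U1,U0,U2,D1,D4,D0,D1,D2]),
 ((0,-1,0,0,1),[U2,D4,U1,U0,U4,U1,D2,D0,D1,D1]),
 ((0,1,0,1,0),[U1,U4,U2,D3,D4,U0,U3,D1,D0,D2]),
 ((1,0,1,0,0),[U3,U1,U1,U4,D3,D1,D1,D4]),
 ((0,-1,0,1,0),[U0,U2,U1,U1,D0,D2,D1,D1]),
 ((0,2,1,0,1),[U0,U3,D0,D3]),
 ((0,1,0,1,0),[U1,U4,U2,U0,D4,D1,D0,D2]),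
 ((0,-1,0,0,0),[U0,U3,U2,U1,D3,U4,D1,D0,D4,D2]),
 ((0,-1,0,0,0),[U0,U3,U2,U1,D3,D0,D1,D2]),
 ((0,2,0,0,0),[U2,U4,U0,U3,D2,D0,D4,D3]),
 ((0,-1,1,0,0),[U1,U0,U3,D1,D0,D3]),
 ((0,2,1,0,0),[U0,U3,U4,D0,D3,D4]),
 ((0,1,1,1,0),[U0,U1,U4,D0,D1,D4]),
 ((0,-1,1,0,1),[U3,U0,D3,D0]),
 ((0,-1,0,0,0),[U2,U4,U3,U0,D2,D4,D0,D3]),
 ((0,-1,0,0,0),[U2,U4,U0,U3,D2,D4,D0,D3]),
 ((0,-1,1,0,0),[U1,U0,U3,D1,U4,D0,D3,D4]),
 ((0,2,0,0,0),[U4,U3,U0,U2,D4,D3,D0,D2]),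
 ((0,-1,0,0,0),[U0,U4,U3,U2,D4,U1,D3,D0,D1,D2]),
 ((0,-1,0,0,0),[U0,U4,U3,U2,D0,D3,D4,D2]),
 ((0,2,0,0,0),[U4,U3,U2,U0,D4,D2,D3,D0]),
 ((0,-1,0,0,0),[U0,U4,U3,U2,D4,D0,D3,D2]),
 ((0,-1,1,0,0),[U1,U0,U4,D1,U3,D0,D4,D3]),
 ((0,2,0,0,0),[U2,U4,U3,U0,D4,D2,D3,D0]),
 ((0,0,0,0,1),[U1,U0,U1,D4,D0,U3,D1,D1,U4,D3]),
 ((0,-1,0,0,0),[U0,U4,U2,U3,D0,D4,D3,D2]),
 ((0,-1,1,1,1),[U1,D2,D3,U1,U0,U2,D1,D1,U3,D0]),
 ((0,1,0,1,0),[U1,D3,U2,U4,U3,U0,D4,D1,D0,D2]),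
 ((0,-1,0,1,1),[U0,U2,D0,D2]),
 ((0,1,0,0,1),[U1,D4,U0,U3,U4,U2,D3,D1,D2,D0]),
 ((1,2,0,1,0),[U2,U4,D2,D4]),
 ((0,-1,0,0,0),[U0,U4,U3,U2,D0,U1,D2,D4,D1,D3]),
 ((0,1,1,1,0),[U0,D1,D3,U4,U1,U1,U3,D0,D1,D4]),
 ((1,1,0,0,1),[U3,U1,U2,D3,D1,D2]),
 ((0,-1,1,0,0),[U3,U4,U0,D2,D3,D4,U2,D0]),
 ((0,2,0,0,0),[U4,U2,U3,U0,D4,D2,D3,D0]),
 ((0,-1,0,0,0),[U0,U4,U3,U2,D0,D4,D3,D2]),
 ((0,1,0,1,0),[U1,U4,U0,U2,D4,D1,D0,D2]),
 ((0,-1,1,0,0),[U4,U3,U0,D2,D3,D4,U2,D0]),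
 ((0,-1,0,0,0),[U0,U3,U4,U2,D3,D0,D4,D2]),
 ((0,1,0,1,0),[U1,U0,U4,U2,D0,D1,D4,D2]),
 ((0,-1,0,1,0),[U0,U4,U2,D3,D0,D4,U3,D2]),
 ((0,-1,1,0,0),[U4,U3,U0,D2,D4,D3,U2,D0]),
 ((0,-1,0,0,0),[U0,U3,U4,U2,D0,D3,D4,D2]),
 ((0,2,0,0,0),[U2,U4,U3,U0,D2,D4,D0,D3]),
 ((0,-1,0,0,0),[U4,U2,U3,U0,D2,D4,D3,D0]),
 ((0,-1,0,0,1),[U2,U3,U0,D2,D4,D0,U1,U4,D3,D1]),
 ((0,-1,0,0,0),[U4,U1,U3,U2,D1,U0,D2,D4,D3,D0]),
 ((0,2,0,0,0),[U4,U2,U3,U0,D4,D3,D2,D0]),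
 ((0,-1,0,0,0),[U0,U3,U4,U2,D0,D4,D3,D2]),
 ((0,-1,0,1,0),[U0,U4,U2,D0,D4,D2]),
 ((0,-1,0,1,0),[U0,U4,U2,D0,U1,D2,D4,D1]),
 ((0,2,0,0,0),[U4,U2,U3,U0,D2,D4,D3,D0]),
 ((0,-1,1,0,0),[U3,U4,U0,D2,D4,D3,U2,D0]),
 ((1,-1,0,0,0),[U3,U4,U2,D3,U1,D4,D2,D1]),
 ((0,-1,0,1,0),[U0,D3,U1,U2,U3,U1,D0,D2,D1,D1]),
 ((0,-1,0,0,0),[U0,U3,U4,U2,D3,U1,D4,D0,D1,D2]),
 ((0,2,0,0,0),[U2,U3,U4,U0,D2,D4,D3,D0]),
 ((0,-1,0,1,0),[U0,D3,U4,U2,U3,D0,D4,D2]),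
 ((0,0,0,0,1),[U1,U0,U2,D1,D1,U3,D2,U1,D0,D3]),
 ((1,0,1,0,0),[U3,U1,U1,U4,D2,D1,D3,U2,D1,D4]),
 ((0,-1,0,0,0),[U0,U1,U2,U3,D1,U4,D0,D3,D4,D2]),
 ((0,-1,0,0,1),[U2,U3,U0,D2,U1,D0,D3,D1]),
 ((0,2,0,0,0),[U4,U3,U2,U0,D4,D3,D0,D2]),
 ((0,-1,0,0,0),[U4,U1,U3,U0,D1,U2,D0,D4,D3,D2]),
 ((0,2,0,0,0),[U4,U3,U2,U0,D4,D3,D2,D0]),
 ((1,-1,0,0,0),[U1,U2,U3,D1,U4,D2,D3,D4]),
 ((0,1,0,0,1),[U1,U2,U3,U0,D2,D1,D3,D0]),
 ((0,2,0,1,0),[U4,U2,U0,D3,D4,D2,U3,D0]),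
 ((0,-1,0,0,0),[U0,U1,U2,U4,D1,U3,D0,D4,D3,D2]),
 ((0,2,1,0,0),[U0,D2,U3,U4,U2,D0,D3,D4]),
 ((0,-1,1,1,1),[U1,D2,U0,D1,U2,D0]),
 ((0,2,0,0,0),[U2,U3,U4,U0,D2,D3,D4,D0]),
 ((0,-1,0,1,0),[U2,U4,U0,D2,U1,D0,D4,D1]),
 ((0,2,0,0,0),[U4,U3,U0,U2,D4,D3,D2,D0]),
 ((0,-1,0,0,0),[U2,U4,U3,U0,D2,U1,D0,D4,D1,D3]),
 ((0,2,0,0,0),[U2,U4,U0,U3,D2,D4,D3,D0]),
 ((0,2,1,0,0),[U0,D2,U4,U3,U2,D0,D4,D3]),
 ((0,-1,1,0,0),[U3,U4,U1,D2,U0,D1,D3,D4,U2,D0]),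
 ((0,2,1,0,0),[U3,U4,U0,D2,D4,D3,U2,D0]),
 ((0,-1,0,0,0),[U0,U4,U3,U1,D0,U2,D1,D4,D3,D2]),
 ((0,2,0,0,1),[U3,U0,U2,D4,D3,D0,U4,D2]),
 ((0,-1,1,0,0),[U4,U3,U1,D2,U0,D1,D3,D4,U2,D0]),
 ((0,1,0,0,1),[U1,U3,U0,U2,D3,D1,D2,D0]),
 ((0,-1,0,0,0),[U0,U4,U3,U1,D0,U2,D1,D3,D4,D2]),
 ((0,0,0,0,1),[U1,U0,U2,D1,D1,D2,U3,U1,D0,D3]),
 ((0,-1,0,1,0),[U2,D3,U0,U1,U3,U1,D0,D2,D1,D1]),
 ((0,-1,0,0,0),[U0,U3,U4,U1,D0,U2,D1,D4,D3,D2]),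
 ((0,2,0,0,0),[U2,U4,U3,U0,D2,D3,D4,D0]),
 ((0,-1,1,0,0),[U3,U4,U1,D2,U0,D1,D4,D3,U2,D0]),
 ((0,1,0,0,1),[U1,U3,U2,U0,D3,D1,D2,D0]),
 ((0,-1,1,0,0),[U4,U3,U1,D2,U0,D1,D4,D3,U2,D0]),
 ((1,-1,0,0,0),[U3,U2,U1,D3,D2,D1]),
 ((0,0,0,1,0),[U4,U0,D1,D4,U2,U1,U1,D0,D2,D1]),
 ((0,-1,0,0,0),[U0,U1,U2,U3,U1,D0,D2,D1,D1,D3]),
 ((0,2,0,0,0),[U2,U4,U3,U0,D2,D4,D3,D0]),
 ((1,2,0,0,0),[U3,U4,U2,D3,D4,D2]),
 ((0,-1,0,0,0),[U0,U1,U2,U3,D1,D0,D3,D2]),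
 ((0,-1,0,0,1),[U1,U3,U0,D1,D3,D0]),
 ((0,2,0,0,0),[U3,U4,U2,U0,D3,D4,D2,D0]),
 ((0,-1,0,0,0),[U4,U1,U1,U0,U2,D1,D4,D2,D1,D0]),
 ((0,2,0,0,0),[U3,U4,U0,U2,D3,D4,D2,D0]),
 ((0,-1,0,1,1),[U1,U0,D1,D0]),
 ((0,2,0,0,0),[U2,U0,U4,U3,D2,D4,D0,D3]),
 ((0,-1,0,0,1),[U0,D4,U1,U2,U4,U1,D2,D0,D1,D1]),
 ((0,2,1,0,0),[U0,D2,U4,U3,U2,D0,D3,D4]),
 ((0,-1,0,0,0),[U0,U4,U3,U1,D0,D4,D1,D3]),
 ((0,-1,0,0,0),[U0,U1,U2,U4,D1,D0,D4,D2]),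
 ((0,-1,0,1,0),[U0,U4,U1,D0,D4,D1]),
 ((1,-1,0,0,0),[U1,U2,U4,D1,D2,D4]),
 ((0,-1,0,0,0),[U4,U1,U3,U0,D1,D4,D3,D0]),
 ((0,2,0,0,0),[U2,U4,U0,U3,D2,D4,D0,D3]),
 ((0,2,0,0,0),[U2,U0,U4,U3,D2,D0,D4,D3]),
 ((0,-1,0,0,0),[U0,U3,U4,U1,D0,U2,D1,D3,D4,D2]),
 ((0,2,0,0,0),[U2,U0,U4,U3,D0,D2,D4,D3])]"

lemma inner5_short: "list_all short_closed inner5"
  by code_simp

lemma outer5_short: "list_all short_closed outer5"
  by code_simp

lemma core_coil5:
  assumes s: "sparse k" and c: "list_all k coil5" and k: "core k"
  shows "list_all (\<lambda>p. k p \<longrightarrow> p \<in> set coil5) unit_cube"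
proof (rule ccontr)
  assume n: "\<not> ?thesis"
  have w: "list_all (\<lambda>(p, w). \<not> along k p w) inner5"
    by (rule sparse_list [OF s inner5_short])
  show False
    using c [unfolded coil5_def, simplified] n [unfolded coil5_def unit_cube_def, simplified]
      w [unfolded inner5_def, simplified] k [unfolded core_unfold, simplified] by sat
qed

lemma coil5_blocked:
  assumes s: "sparse s" and c: "list_all s coil5"
    and k0: "core k0" "\<And>a b c d e. k0 (a, b, c, d, e) \<Longrightarrow> s (a, b + 1, c, d, e)"
    and k1: "core k1" "\<And>a b c d e. k1 (a, b, c, d, e) \<Longrightarrow> s (a, b - 1, c, d, e)"
  shows False
proof -
  have w: "list_all (\<lambda>(p, w). \<not> along s p w) outer5"
    by (rule sparse_list [OF s outer5_short])
  have m0: "list_all (\<lambda>p. k0 p \<longrightarrow> s (go U1 p)) unit_cube"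
    using k0(2) by (auto simp: list_all_iff split_paired_all)
  note m0 = m0 [unfolded unit_cube_def, simplified]
  have m1: "list_all (\<lambda>p. k1 p \<longrightarrow> s (go D1 p)) unit_cube"
    using k1(2) by (auto simp: list_all_iff split_paired_all)
  note m1 = m1 [unfolded unit_cube_def, simplified]
  show False
    using c [unfolded coil5_def, simplified] w [unfolded outer5_def, simplified]
      k0(1) [unfolded core_unfold, simplified] m0
      k1(1) [unfolded core_unfold, simplified] m1 by sat
qed

section \<open>Coils of length 14 that are excluded with a single neighbour\<close>

definition coil6 :: "point list" where
 "coil6 = [(0,0,0,1,0), (0,0,0,1,1), (1,0,0,1,1), (1,0,0,0,1), (1,1,0,0,1), (0,1,0,0,1), (0,1,1,0,1), (0,0,1,0,1), (0,0,1,0,0), (1,0,1,0,0), (1,0,1,1,0), (1,1,1,1,0), (1,1,0,1,0), (0,1,0,1,0)]"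

definition inner6 :: "(point \<times> step list) list" where
 "inner6 =
[((0,0,0,0,0),[U2,U0,U3,U1,D2,D0,D1,D3]),
 ((0,1,0,0,1),[U2,U0,D2,D0]),
 ((0,0,0,0,1),[U1,U0,D1,U3,D0,D3]),
 ((0,0,0,1,0),[U4,U0,D3,U1,U3,D4,D0,D1]),
 ((0,0,1,0,0),[U0,U3,U4,D2,D3,U1,D0,U2,D1,D4]),
 ((1,0,1,0,0),[U3,U1,D3,D1]),
 ((0,0,0,1,0),[U4,U0,D3,U1,D4,U3,D0,D1]),
 ((0,0,0,1,0),[U4,U2,D3,D4,U0,U3,U1,D2,D0,D1]),
 ((0,0,1,0,0),[U0,U4,D0,D4]),
 ((0,1,0,1,0),[U2,U0,D2,D0]),
 ((1,0,0,1,0),[U2,U1,D2,D1]),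
 ((0,0,0,1,0),[U4,U1,D4,D1]),
 ((0,0,1,0,0),[U4,U1,D4,D1]),
 ((0,0,0,1,0),[U4,U0,D3,D4,U2,U3,U1,D2,D0,D1]),
 ((0,0,0,1,0),[U4,U0,D3,U1,D0,D4,U3,D1]),
 ((0,0,0,1,0),[U2,D3,U0,U3,U1,D2,D0,D1]),
 ((0,0,1,0,0),[U0,U3,U1,U4,D0,D3,D1,D4])]"

definition outer6 :: "(point \<times> step list) list" where
 "outer6 =
[((0,0,0,1,0),[U4,U0,D4,D0]),
 ((0,0,0,0,0),[U2,U4,U1,D2,U0,D1,U3,D0,D4,D3]),
 ((0,0,0,1,0),[U4,U2,D3,D4,U0,U3,U1,D2,D0,D1]),
 ((0,0,0,1,0),[U4,U0,U2,D4,U1,D2,D0,D1]),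
 ((0,0,0,1,0),[U2,U0,U1,D2,D0,D1]),
 ((0,0,1,0,0),[U0,D2,U4,U1,D0,U2,D1,D4]),
 ((0,0,0,0,1),[U1,U0,D1,U3,D0,D3]),
 ((0,0,0,1,0),[U4,U0,D3,U2,D4,U3,U1,D2,D0,D1]),
 ((1,-1,0,0,1),[U3,U1,D3,D1]),
 ((1,-1,1,0,0),[U1,U3,D1,D3]),
 ((0,-1,1,0,0),[U4,U1,D4,D1]),
 ((0,-1,1,0,0),[U1,U0,D1,D0]),
 ((0,-1,0,1,0),[U4,U1,D4,D1]),
 ((0,-1,0,1,1),[U1,U0,D1,D0]),
 ((0,-1,0,1,0),[U2,U4,U0,D2,U1,D0,D4,D1]),
 ((0,-1,0,0,1),[U2,U1,U1,D2,U0,D1,D1,D0]),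
 ((0,-1,1,0,1),[U1,U1,D2,U0,D1,D1,U2,D0]),
 ((0,-1,0,1,0),[U1,U1,U0,U2,D1,D1,D2,D0]),
 ((0,-1,0,1,0),[U2,U0,U1,U1,D2,D0,D1,D1]),
 ((0,-1,0,0,0),[U4,U0,D4,D0]),
 ((0,-1,1,0,1),[U3,U0,D3,D0]),
 ((0,-1,0,0,0),[U2,U1,U0,U3,U1,D2,D0,D1,D1,D3]),
 ((0,-1,0,1,1),[U2,D3,U1,U1,D2,U0,D1,U3,D0,D1]),
 ((0,-1,0,0,1),[U3,U1,U0,D3,D1,D0]),
 ((0,-1,0,1,0),[U0,D3,U4,U1,U3,D0,D4,D1]),
 ((0,-1,0,1,0),[U0,U4,U1,D0,D4,D1]),
 ((0,-1,0,1,0),[U0,D3,U2,U1,U3,U1,D2,D0,D1,D1]),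
 ((0,-1,0,1,1),[U2,D4,U0,U1,U1,D2,D0,D1,U4,D1]),
 ((0,0,1,0,0),[U0,D1,D2,U4,U1,U1,D0,U2,D1,D4]),
 ((0,-1,1,0,1),[U1,D4,U0,D1,U4,D0]),
 ((0,-1,1,0,0),[U1,U0,U3,D1,D0,D3]),
 ((0,-1,1,0,1),[U1,D4,U0,U3,D1,D0,U4,D3]),
 ((0,-1,1,0,1),[U1,D4,U0,U3,D1,U4,D0,D3]),
 ((0,-1,1,1,0),[U4,U0,D4,D0]),
 ((0,0,0,1,0),[U4,U0,D1,U2,D4,U1,U1,D2,D0,D1]),
 ((0,-1,1,0,1),[U1,U1,D2,U0,D1,U3,D1,U2,D0,D3]),
 ((0,-1,1,0,1),[U1,D4,U0,U3,D1,U4,D3,D0]),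
 ((1,-1,0,0,0),[U3,U4,U2,D3,D4,D2]),
 ((0,-1,0,1,0),[U2,U4,U0,D3,D2,U1,U3,D0,D4,D1]),
 ((0,-1,0,1,1),[U2,U0,D3,D2,U1,U3,D0,D1]),
 ((1,-1,0,0,0),[U3,U2,U4,D3,D2,D4]),
 ((0,-1,0,1,1),[U2,U0,D4,U1,U1,D2,D0,D1,U4,D1]),
 ((0,-1,0,0,0),[U0,U3,U4,U2,D0,D4,D3,D2]),
 ((0,-1,1,0,1),[U1,U1,D2,U0,D1,U3,D1,U2,D3,D0]),
 ((0,-1,0,0,0),[U0,U2,U1,U3,U1,D2,D0,D1,D1,D3]),
 ((0,-1,0,0,0),[U4,U3,U2,U0,D3,D4,D2,D0]),
 ((0,-1,0,0,0),[U0,U4,U1,U1,D0,U2,D1,D4,D1,D2]),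
 ((0,-1,0,0,0),[U4,U0,U1,U1,D0,U2,D1,D4,D1,D2]),
 ((0,-1,0,0,0),[U0,U4,U1,U3,D0,D4,D1,D3]),
 ((0,-1,0,0,0),[U4,U0,U1,U3,D0,D4,D1,D3]),
 ((0,-1,0,0,0),[U0,U3,U2,U1,D3,D0,D1,D2]),
 ((0,-1,0,0,0),[U4,U3,U2,D4,D3,D2]),
 ((0,-1,0,0,0),[U3,U0,D3,D0]),
 ((0,-1,0,0,0),[U4,U2,U1,D4,U0,D1,D2,D0]),
 ((0,-1,0,0,0),[U4,U2,U3,D4,D2,D3]),
 ((0,-1,0,0,0),[U4,U2,U1,D4,U0,U3,D1,D2,D3,D0])]"

lemma inner6_short: "list_all short_closed inner6"
  by code_simp

lemma outer6_short: "list_all short_closed outer6"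
  by code_simp

lemma core_coil6:
  assumes s: "sparse k" and c: "list_all k coil6" and k: "core k"
  shows "list_all (\<lambda>p. k p \<longrightarrow> p \<in> set coil6) unit_cube"
proof (rule ccontr)
  assume n: "\<not> ?thesis"
  have w: "list_all (\<lambda>(p, w). \<not> along k p w) inner6"
    by (rule sparse_list [OF s inner6_short])
  show False
    using c [unfolded coil6_def, simplified] n [unfolded coil6_def unit_cube_def, simplified]
      w [unfolded inner6_def, simplified] k [unfolded core_unfold, simplified] by sat
qed

lemma coil6_blocked:
  assumes s: "sparse s" and c: "list_all s coil6"
    and k0: "core k0" "\<And>a b c d e. k0 (a, b, c, d, e) \<Longrightarrow> s (a, b - 1, c, d, e)"
  shows False
proof -
  have w: "list_all (\<lambda>(p, w). \<not> along s p w) outer6"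
    by (rule sparse_list [OF s outer6_short])
  have m0: "list_all (\<lambda>p. k0 p \<longrightarrow> s (go D1 p)) unit_cube"
    using k0(2) by (auto simp: list_all_iff split_paired_all)
  note m0 = m0 [unfolded unit_cube_def, simplified]
  show False
    using c [unfolded coil6_def, simplified] w [unfolded outer6_def, simplified]
      k0(1) [unfolded core_unfold, simplified] m0 by sat
qed

text \<open>\<open>coil6\<close> with the corner (1,1,0,1,0) replaced by (0,1,1,1,0), the other way
  round the same square.\<close>

definition coil7 :: "point list" where
 "coil7 = [(0,0,0,1,0), (0,0,0,1,1), (1,0,0,1,1), (1,0,0,0,1), (1,1,0,0,1), (0,1,0,0,1), (0,1,1,0,1), (0,0,1,0,1), (0,0,1,0,0), (1,0,1,0,0), (1,0,1,1,0), (1,1,1,1,0), (0,1,1,1,0), (0,1,0,1,0)]"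

definition inner7 :: "(point \<times> step list) list" where
 "inner7 =
[((0,0,0,0,0),[U2,U4,U1,D2,U0,D1,U3,D0,D4,D3]),
 ((1,0,1,0,0),[U3,U1,D3,D1]),
 ((0,1,0,1,0),[U2,U0,D2,D0]),
 ((0,1,0,0,1),[U2,U0,D2,D0]),
 ((1,0,0,0,1),[U1,U3,D1,D3]),
 ((0,0,0,1,0),[U4,U0,U2,D4,U1,D0,D2,D1]),
 ((0,0,1,0,0),[U0,U4,D0,D4]),
 ((0,0,1,0,0),[U0,U3,D2,U4,D3,U1,D0,U2,D1,D4]),
 ((0,0,1,0,0),[U0,D2,U4,U1,D0,U2,D1,D4]),
 ((0,0,1,0,0),[U0,U3,U1,D0,U4,D3,D1,D4]),
 ((0,0,1,0,0),[U0,U3,U1,D0,D3,D1]),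
 ((0,0,0,1,0),[U4,U1,D4,D1]),
 ((0,0,0,1,0),[U4,U0,D3,U1,D0,D4,U3,D1]),
 ((0,0,0,1,1),[U2,D3,U1,D2,U0,D1,U3,D0]),
 ((0,0,1,1,0),[U0,U1,D0,D1]),
 ((0,0,0,0,1),[U1,U2,D1,D2])]"

definition outer7 :: "(point \<times> step list) list" where
 "outer7 =
[((0,0,0,0,1),[U2,D4,U0,U3,U1,D0,D2,D1,U4,D3]),
 ((0,0,1,0,0),[U0,U3,U1,D0,D3,D1]),
 ((0,0,0,1,0),[U2,D3,U4,U1,D2,U0,D1,U3,D0,D4]),
 ((0,0,0,0,0),[U2,U0,U3,U1,D0,D2,D1,D3]),
 ((0,0,0,1,0),[U4,U0,D3,U1,D0,U3,D4,D1]),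
 ((0,0,1,0,0),[U0,U3,U1,D0,U4,D3,D1,D4]),
 ((0,0,0,1,0),[U4,U2,D3,D4,U0,U3,U1,D0,D2,D1]),
 ((-1,0,1,0,1),[U1,U0,D1,D0]),
 ((-1,1,0,0,1),[U2,U0,D2,D0]),
 ((-1,1,0,1,0),[U2,U0,D2,D0]),
 ((-1,0,0,1,0),[U4,U0,D4,D0]),
 ((-1,0,0,1,0),[U1,U0,D1,D0]),
 ((0,0,0,1,0),[U4,U0,D3,U1,D0,D4,U3,D1]),
 ((-1,0,1,0,0),[U0,U0,U3,U1,D0,D0,D3,D1]),
 ((-1,0,0,0,0),[U1,U2,D1,D2]),
 ((-1,0,0,0,0),[U2,U0,U4,U1,D2,D0,D4,D1]),
 ((-1,0,0,0,0),[U2,U0,U4,U1,D2,D0,D1,D4]),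
 ((-1,0,1,0,0),[U0,U4,U1,D2,D0,D4,U2,D1]),
 ((-1,0,0,1,1),[U2,D3,U0,U1,D2,U0,D1,U3,D0,D0]),
 ((-1,0,0,1,1),[U0,D4,U1,D0,U4,D1]),
 ((-1,0,0,1,1),[U1,U2,D1,D2]),
 ((-1,0,0,0,0),[U4,U3,U0,D4,U1,D0,D3,D1]),
 ((-1,0,0,0,0),[U4,U2,U3,U1,D2,D4,D3,D1]),
 ((-1,0,1,0,0),[U0,U4,D0,D4]),
 ((-1,0,0,0,1),[U1,U0,U0,D1,U3,D0,D0,D3]),
 ((-1,0,0,0,1),[U1,U0,U2,D1,D0,D2]),
 ((-1,1,0,0,0),[U4,U0,U0,D1,U3,D0,D4,U1,D0,D3]),
 ((-1,0,0,1,1),[U0,U0,D3,U1,D0,D0,U3,D1]),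
 ((-1,0,1,0,0),[U0,U0,U3,U1,D0,D2,D0,D3,U2,D1]),
 ((-1,0,1,0,0),[U0,U4,U1,D0,D4,D1]),
 ((-1,0,0,1,1),[U2,D4,U1,U0,D2,D1,U4,D0]),
 ((-1,0,0,1,0),[U2,U1,U0,D2,D1,D0]),
 ((-1,0,1,0,1),[U0,D4,U0,U3,U1,D0,D0,D1,U4,D3]),
 ((-1,0,1,0,0),[U0,U0,U3,U1,D0,D0,D1,D3]),
 ((-1,0,1,1,0),[U1,U4,D1,D4]),
 ((-1,0,1,0,0),[U0,U4,U1,D2,D0,U3,U2,D1,D4,D3]),
 ((-1,0,1,0,1),[U0,U1,D2,D0,U3,U2,D1,D3]),
 ((-1,1,0,0,0),[U4,U3,U2,D4,D3,D2]),
 ((-1,0,1,0,1),[U0,D4,U0,U3,U1,D0,D0,U4,D1,D3]),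
 ((-1,1,1,0,1),[U3,D4,U0,U0,D1,D3,D0,U4,U1,D0]),
 ((-1,0,0,1,1),[U2,U1,D4,U0,D2,D1,U4,D0]),
 ((-1,0,0,1,1),[U0,D4,U1,U2,D0,U4,D2,D1]),
 ((-1,0,0,1,1),[U2,U1,D3,U0,D2,U0,D1,U3,D0,D0]),
 ((-1,0,1,0,0),[U0,U4,U1,D0,U3,D1,D4,D3]),
 ((-1,1,0,0,0),[U3,U4,U2,D3,D4,D2]),
 ((-1,0,0,0,0),[U2,U0,U0,U3,U1,D0,D2,D0,D3,D1]),
 ((-1,0,0,0,0),[U1,U4,U0,U0,D1,U3,D0,D4,D0,D3]),
 ((-1,0,0,0,0),[U4,U1,U0,U0,D1,U3,D0,D4,D0,D3]),
 ((-1,0,0,0,0),[U1,U4,D1,D4]),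
 ((-1,0,0,0,0),[U2,U0,U0,U3,U1,D0,D2,D1,D0,D3]),
 ((-1,0,0,0,0),[U1,U2,U4,U3,D1,D4,D2,D3]),
 ((-1,0,0,1,1),[U0,U0,D3,U1,D0,U2,D0,U3,D2,D1]),
 ((-1,0,0,0,0),[U1,U2,U3,U0,D2,D1,D0,D3]),
 ((-1,0,0,0,0),[U4,U2,U3,D4,D2,D3]),
 ((-1,0,0,0,0),[U4,U3,U0,D4,U1,U2,D0,D3,D2,D1]),
 ((-1,0,0,0,0),[U2,U3,U4,D2,D3,D4])]"

lemma inner7_short: "list_all short_closed inner7"
  by code_simp

lemma outer7_short: "list_all short_closed outer7"
  by code_simp

lemma core_coil7:
  assumes s: "sparse k" and c: "list_all k coil7" and k: "core k"
  shows "list_all (\<lambda>p. k p \<longrightarrow> p \<in> set coil7) unit_cube"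
proof (rule ccontr)
  assume n: "\<not> ?thesis"
  have w: "list_all (\<lambda>(p, w). \<not> along k p w) inner7"
    by (rule sparse_list [OF s inner7_short])
  show False
    using c [unfolded coil7_def, simplified] n [unfolded coil7_def unit_cube_def, simplified]
      w [unfolded inner7_def, simplified] k [unfolded core_unfold, simplified] by sat
qed

lemma coil7_blocked:
  assumes s: "sparse s" and c: "list_all s coil7"
    and k0: "core k0" "\<And>a b c d e. k0 (a, b, c, d, e) \<Longrightarrow> s (a - 1, b, c, d, e)"
  shows False
proof -
  have w: "list_all (\<lambda>(p, w). \<not> along s p w) outer7"
    by (rule sparse_list [OF s outer7_short])
  have m0: "list_all (\<lambda>p. k0 p \<longrightarrow> s (go D0 p)) unit_cube"
    using k0(2) by (auto simp: list_all_iff split_paired_all)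
  note m0 = m0 [unfolded unit_cube_def, simplified]
  show False
    using c [unfolded coil7_def, simplified] w [unfolded outer7_def, simplified]
      k0(1) [unfolded core_unfold, simplified] m0 by sat
qed

section \<open>Walks in the grid\<close>
text \<open>Adjacency in the grid without real distances; \<open>grid_arcs\<close> shows that it is
  the same.\<close>

definition adj :: "int ^ 'n::finite \<Rightarrow> int ^ 'n \<Rightarrow> bool" where
  "adj x y \<longleftrightarrow> (\<exists>i. y = x + axis i 1 \<or> y = x - axis i 1)"

lemma adj_sym: "adj x y \<Longrightarrow> adj y x"
  by (auto simp: adj_def algebra_simps)

lemma not_adj_self [simp]: "\<not> adj x x"
  by (auto simp: adj_def axis_eq_0_iff)

text \<open>Non-backtracking walks in place of paths: they can be extended one step at a time by a
  local condition, and a repeated vertex in one still yields a cycle.\<close>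

fun nbwalk :: "(int ^ 'n::finite) set \<Rightarrow> (int ^ 'n) list \<Rightarrow> bool" where
  "nbwalk S [] = True"
| "nbwalk S [x] = (x \<in> S)"
| "nbwalk S [x, y] = (x \<in> S \<and> y \<in> S \<and> adj x y)"
| "nbwalk S (x # y # z # xs) = (x \<in> S \<and> adj x y \<and> x \<noteq> z \<and> nbwalk S (y # z # xs))"

text \<open>The working form of girth greater than 10, derived in \<open>no_short_of_girth\<close>.
  Eleven entries are ten steps, so no walk returns to a vertex within ten steps.\<close>

definition no_short :: "(int ^ 'n::finite) set \<Rightarrow> bool" where
  "no_short S \<longleftrightarrow> (\<forall>xs. nbwalk S xs \<longrightarrow> length xs \<le> 11 \<longrightarrow> distinct xs)"

lemma nbwalk_tl: "nbwalk S xs \<Longrightarrow> nbwalk S (tl xs)"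
  by (induction S xs rule: nbwalk.induct) auto

lemma nbwalk_butlast: "nbwalk S xs \<Longrightarrow> nbwalk S (butlast xs)"
proof (induction S xs rule: nbwalk.induct)
  case (4 S x y z xs)
  then show ?case by (cases xs) auto
qed auto

lemma nbwalk_snoc:
  "nbwalk S (xs @ [y, z]) \<Longrightarrow> w \<in> S \<Longrightarrow> adj z w \<Longrightarrow> y \<noteq> w \<Longrightarrow> nbwalk S (xs @ [y, z, w])"
proof (induction xs)
  case (Cons a xs)
  show ?case
  proof (cases xs)
    case (Cons b ys)
    with Cons.prems Cons.IH show ?thesis by (cases ys) auto
  qed (use Cons in auto)
qed auto

lemma nbwalk_set: "nbwalk S xs \<Longrightarrow> set xs \<subseteq> S"
  by (induction S xs rule: nbwalk.induct) auto

lemma nbwalk_successively: "nbwalk S xs \<Longrightarrow> successively adj xs"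
  by (induction S xs rule: nbwalk.induct) auto

lemma no_shortD: "no_short S \<Longrightarrow> nbwalk S xs \<Longrightarrow> length xs \<le> 11 \<Longrightarrow> distinct xs"
  by (simp add: no_short_def)

text \<open>Otherwise appending the first vertex would repeat it within 11 entries. With at least
  three distinct entries the appended step is no reversal.\<close>

lemma no_short_closing:
  assumes S: "no_short S" and w: "nbwalk S xs" and l: "3 \<le> length xs" "length xs \<le> 10"
  shows "\<not> adj (last xs) (hd xs)"
proof
  assume a: "adj (last xs) (hd xs)"
  have d: "distinct xs"
    using no_shortD [OF S w] l by simp
  obtain ys y z where xs: "xs = ys @ [y, z]"
  proof -
    obtain us z where 1: "xs = us @ [z]" using l by (cases xs rule: rev_cases) auto
    then obtain ys y where "us = ys @ [y]" using l by (cases us rule: rev_cases) auto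
    with 1 show ?thesis using that by simp
  qed
  then obtain v vs where ys: "ys = v # vs" using l by (cases ys) auto
  have "nbwalk S (ys @ [y, z, v])"
    using nbwalk_snoc [of S ys y z v] w xs ys a d nbwalk_set [OF w] by auto
  then have "distinct (ys @ [y, z, v])"
    by (rule no_shortD [OF S]) (use l xs in simp)
  then show False using ys by simp
qed

section \<open>Coordinate frames for the five-dimensional grid\<close>

definition coord :: "point \<Rightarrow> nat \<Rightarrow> int" where
  "coord p k = (case p of (a, b, c, d, e) \<Rightarrow> [a, b, c, d, e] ! k)"

definition mk :: "(nat \<Rightarrow> int) \<Rightarrow> point" where
  "mk f = (f 0, f 1, f 2, f 3, f 4)"

text \<open>All evaluation and propositional reasoning takes place on tuples; \<open>phi c g\<close>
  carries it into the grid with origin \<open>c\<close> and axes \<open>g\<close>. Multiplication in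
  \<open>int ^ 5\<close> is componentwise, so \<open>of_int\<close> acts as a scalar.\<close>

definition phi :: "int ^ 5 \<Rightarrow> (nat \<Rightarrow> int ^ 5) \<Rightarrow> point \<Rightarrow> int ^ 5" where
  "phi c g p = c + (\<Sum>k<5. of_int (coord p k) * g k)"

text \<open>These are the symmetries of the grid that fix the origin. A fact about one coil in
  coordinates thereby applies to all its images.\<close>

definition frame :: "(nat \<Rightarrow> int ^ 5) \<Rightarrow> bool" where
  "frame g \<longleftrightarrow> (\<exists>\<pi> \<epsilon>. bij_betw \<pi> {..<5} (UNIV :: 5 set) \<and>
     (\<forall>k<5. (\<epsilon> k = 1 \<or> \<epsilon> k = - 1) \<and> g k = axis (\<pi> k) (\<epsilon> k)))"

lemma less5: "k < (5::nat) \<longleftrightarrow> k = 0 \<or> k = 1 \<or> k = 2 \<or> k = 3 \<or> k = 4"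
  by auto

lemma sum5: "(\<Sum>k<5. f k) = f 0 + f 1 + f 2 + f 3 + f (4::nat)"
  by (simp add: eval_nat_numeral add.assoc)

lemma coord_mk [simp]: "k < 5 \<Longrightarrow> coord (mk f) k = f k"
  by (auto simp: less5 coord_def mk_def)

lemma coord_simps [simp]:
  "coord (a, b, c, d, e) 0 = a" "coord (a, b, c, d, e) (Suc 0) = b" "coord (a, b, c, d, e) 2 = c"
  "coord (a, b, c, d, e) 3 = d" "coord (a, b, c, d, e) 4 = e"
  by (simp_all add: coord_def)

lemma point_eqI: "(\<And>k. k < 5 \<Longrightarrow> coord p k = coord q k) \<Longrightarrow> p = q"
  by (cases p; cases q) (use less5 in force)

fun unit_step :: "step \<Rightarrow> nat \<times> int" where
  "unit_step U0 = (0, 1)" | "unit_step U1 = (1, 1)" | "unit_step U2 = (2, 1)"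
| "unit_step U3 = (3, 1)" | "unit_step U4 = (4, 1)"
| "unit_step D0 = (0, - 1)" | "unit_step D1 = (1, - 1)" | "unit_step D2 = (2, - 1)"
| "unit_step D3 = (3, - 1)" | "unit_step D4 = (4, - 1)"

definition vstep :: "(nat \<Rightarrow> int ^ 5) \<Rightarrow> step \<Rightarrow> int ^ 5" where
  "vstep g d = of_int (snd (unit_step d)) * g (fst (unit_step d))"

lemma phi_go: "phi c g (go d p) = phi c g p + vstep g d"
  by (cases p; cases d) (simp_all add: phi_def sum5 vstep_def algebra_simps)

lemma of_int_vec_nth [simp]: "(of_int z :: int ^ 'n::finite) $ i = z"
proof (cases z)
  case (nonneg n)
  then show ?thesis by (simp add: of_nat_index)
next
  case (neg n)
  then show ?thesis by (simp add: of_nat_index)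
qed

lemma vstep_axis:
  assumes "\<forall>k<5. (\<epsilon> k = 1 \<or> \<epsilon> k = - 1) \<and> g k = axis (\<pi> k) (\<epsilon> k)"
  shows "vstep g d = axis (\<pi> (fst (unit_step d))) (snd (unit_step d) * \<epsilon> (fst (unit_step d)))"
  using assms by (cases d) (auto simp: vstep_def vec_eq_iff axis_def)

lemma axis_uminus: "axis i (- 1 :: int) = - axis i 1"
  by (simp add: vec_eq_iff axis_def)

lemma unit_step_simps: "fst (unit_step d) < 5" "snd (unit_step d) = 1 \<or> snd (unit_step d) = - 1"
  by (cases d; simp)+

lemma adj_vstep:
  assumes "frame g"
  shows "adj x (x + vstep g d)"
proof -
  obtain \<pi> \<epsilon> where "bij_betw \<pi> {..<5} (UNIV :: 5 set)"
    and \<epsilon>: "\<forall>k<5. (\<epsilon> k = 1 \<or> \<epsilon> k = - 1) \<and> g k = axis (\<pi> k) (\<epsilon> k)"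
    using assms unfolding frame_def by blast
  show ?thesis
    using unit_step_simps [of d] \<epsilon> unfolding vstep_axis [OF \<epsilon>] adj_def
    by (auto simp: axis_uminus intro!: exI [of _ "\<pi> (fst (unit_step d))"])
qed

text \<open>In the coordinate on the axis of \<open>d\<close>, the first step contributes 1 or -1,
  and only a step along the same axis with the opposite sign can undo that.\<close>

lemma vstep_cancel:
  assumes "frame g" "vstep g d + vstep g d' = 0"
  shows "d' = opp d"
proof -
  obtain \<pi> \<epsilon> where \<pi>: "bij_betw \<pi> {..<5} (UNIV :: 5 set)"
    and \<epsilon>: "\<forall>k<5. (\<epsilon> k = 1 \<or> \<epsilon> k = - 1) \<and> g k = axis (\<pi> k) (\<epsilon> k)"
    using assms(1) unfolding frame_def by blast
  let ?k = "fst (unit_step d)" and ?k' = "fst (unit_step d')"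
  have "(vstep g d + vstep g d') $ \<pi> ?k = 0"
    using assms(2) by simp
  then have "\<pi> ?k = \<pi> ?k'" "snd (unit_step d) * \<epsilon> ?k + snd (unit_step d') * \<epsilon> ?k' = 0"
    using \<epsilon> unit_step_simps [of d] unit_step_simps [of d']
    unfolding vstep_axis [OF \<epsilon>] by (auto simp: axis_def split: if_splits)
  moreover from this(1) have "?k = ?k'"
    using \<pi> unit_step_simps(1) [of d] unit_step_simps(1) [of d'] by (auto simp: bij_betw_def inj_on_def)
  moreover have "\<epsilon> ?k \<noteq> 0"
    using \<epsilon> unit_step_simps(1) [of d] by force
  ultimately have "unit_step d' = (fst (unit_step d), - snd (unit_step d))"
    by (auto simp: prod_eq_iff algebra_simps)
      (metis add.commute add_eq_0_iff distrib_right mult_eq_0_iff)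
  then show ?thesis
    by (cases d; cases d') auto
qed

fun trail :: "point \<Rightarrow> step list \<Rightarrow> point list" where
  "trail p [] = [p]"
| "trail p (d # w) = p # trail (go d p) w"

lemma trail_Cons: "\<exists>qs. trail p w = p # qs"
  by (cases w) auto

lemma last_trail: "last (trail p w) = endpoint p w"
proof (induction w arbitrary: p)
  case (Cons d w)
  then show ?case using trail_Cons [of "go d p" w] by auto
qed simp

lemma length_trail [simp]: "length (trail p w) = Suc (length w)"
  by (induction w arbitrary: p) auto

text \<open>A backtracking triple of vertices would mean two steps that cancel, which
  \<open>reduced\<close> forbids by \<open>vstep_cancel\<close>. The endpoint has a hypothesis of
  its own because \<open>along\<close> does not test it.\<close>

lemma nbwalk_trail:
  assumes g: "frame g"
  shows "reduced w \<Longrightarrow> along (\<lambda>p. phi c g p \<in> S) p w \<Longrightarrow> phi c g (endpoint p w) \<in> S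
    \<Longrightarrow> nbwalk S (map (phi c g) (trail p w))"
proof (induction w arbitrary: p rule: reduced.induct)
  case (1 d e w)
  have "phi c g p \<noteq> phi c g (go e (go d p))"
  proof
    assume "phi c g p = phi c g (go e (go d p))"
    then have "vstep g d + vstep g e = 0"
      by (simp add: phi_go algebra_simps)
    with vstep_cancel [OF g] 1(2) show False by simp
  qed
  moreover have "adj (phi c g p) (phi c g (go d p))"
    by (simp add: phi_go adj_vstep [OF g])
  moreover have "nbwalk S (map (phi c g) (trail (go d p) (e # w)))"
    using 1 by simp
  moreover obtain qs where "trail (go e (go d p)) w = go e (go d p) # qs"
    using trail_Cons by blast
  ultimately show ?case
    using 1(3) by simp
qed (use adj_vstep [OF g] in \<open>auto simp: phi_go\<close>)

text \<open>The vertex list of such a walk has at most 11 entries, and its first entry is also its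
  last.\<close>

lemma sparse_phi:
  assumes S: "no_short S" and g: "frame g"
  shows "sparse (\<lambda>p. phi c g p \<in> S)"
  unfolding sparse_def
proof (intro allI impI notI)
  fix p w assume w: "short_closed (p, w)" and a: "along (\<lambda>p. phi c g p \<in> S) p w"
  have e: "endpoint p w = p" and r: "reduced w" and n: "w \<noteq> []" and l: "length w \<le> 10"
    using w by (auto simp: short_closed_def)
  have "phi c g p \<in> S"
    using a n by (cases w) auto
  with e have "nbwalk S (map (phi c g) (trail p w))"
    using nbwalk_trail [OF g r a] by simp
  then have "distinct (map (phi c g) (trail p w))"
    using no_shortD [OF S] l by simp
  moreover obtain d v where "w = d # v"
    using n by (cases w) auto
  then have "last (tl (trail p w)) = p" "tl (trail p w) \<noteq> []"
    using e last_trail [of "go d p" v] trail_Cons [of "go d p" v] by auto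
  then have "p \<in> set (tl (trail p w))"
    using last_in_set by metis
  ultimately show False
    using trail_Cons [of p w] by auto
qed

section \<open>Unit cubes and their subsets of minimal degree two\<close>

definition cube :: "int ^ 'n::finite \<Rightarrow> (int ^ 'n) set" where
  "cube z = {y. \<forall>i. y $ i = z $ i \<or> y $ i = z $ i + 1}"

definition two_core :: "(int ^ 'n::finite) set \<Rightarrow> bool" where
  "two_core K \<longleftrightarrow> K \<noteq> {} \<and> (\<forall>v\<in>K. \<exists>u\<in>K. \<exists>w\<in>K. u \<noteq> w \<and> adj v u \<and> adj v w)"

text \<open>\<open>c\<close> is some vertex of the cube, not necessarily the lowest one, and the
  axes in \<open>g\<close> point from it into the cube. So one cube has a frame for each choice of a
  vertex and an order of the axes.\<close>

definition framed :: "int ^ 5 \<Rightarrow> int ^ 5 \<Rightarrow> (nat \<Rightarrow> int ^ 5) \<Rightarrow> bool" where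
  "framed z c g \<longleftrightarrow> frame g \<and> phi c g ` set unit_cube = cube z"

lemma mem_unit_cube:
  "(a, b, c, d, e) \<in> set unit_cube \<longleftrightarrow>
    (a = 0 \<or> a = 1) \<and> (b = 0 \<or> b = 1) \<and> (c = 0 \<or> c = 1) \<and> (d = 0 \<or> d = 1) \<and> (e = 0 \<or> e = 1)"
  (is "?l \<longleftrightarrow> ?r")
proof
  assume ?l
  then show ?r unfolding unit_cube_def by (simp, elim disjE, simp_all)
next
  assume ?r
  then show ?l by (elim conjE disjE) (simp_all add: unit_cube_def)
qed

lemma unit_cube_iff: "p \<in> set unit_cube \<longleftrightarrow> (\<forall>k<5. coord p k = 0 \<or> coord p k = 1)"
proof -
  have all5: "(\<forall>k<5. P k) \<longleftrightarrow> P 0 \<and> P (Suc 0) \<and> P 2 \<and> P 3 \<and> P 4" for P :: "nat \<Rightarrow> bool"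
    unfolding less5 by auto
  show ?thesis
    unfolding all5 by (cases p) (simp add: mem_unit_cube)
qed

lemma phi_nth:
  assumes "bij_betw \<pi> {..<5} (UNIV :: 5 set)"
    and "\<forall>k<5. (\<epsilon> k = 1 \<or> \<epsilon> k = - 1) \<and> g k = axis (\<pi> k) (\<epsilon> k)" and "k < 5"
  shows "phi c g p $ \<pi> k = c $ \<pi> k + coord p k * \<epsilon> k"
proof -
  have "(\<Sum>j<5. of_int (coord p j) * g j) $ \<pi> k = (\<Sum>j<5. coord p j * g j $ \<pi> k)"
    by (simp add: sum_component)
  also have "\<dots> = (\<Sum>j<5. if j = k then coord p k * \<epsilon> k else 0)"
  proof (rule sum.cong)
    fix j :: nat assume "j \<in> {..<5}"
    then show "coord p j * g j $ \<pi> k = (if j = k then coord p k * \<epsilon> k else 0)"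
      using assms(2,3) inj_onD [OF bij_betw_imp_inj_on [OF assms(1)], of j k] by (auto simp: axis_def)
  qed simp
  finally have "(\<Sum>j<5. of_int (coord p j) * g j) $ \<pi> k = coord p k * \<epsilon> k"
    using assms(3) by simp
  then show ?thesis
    using assms(3) by (simp add: phi_def)
qed

lemma phi_inj:
  assumes "frame g" "phi c g p = phi c g q"
  shows "p = q"
proof -
  obtain \<pi> \<epsilon> where \<pi>: "bij_betw \<pi> {..<5} (UNIV :: 5 set)"
    and \<epsilon>: "\<forall>k<5. (\<epsilon> k = 1 \<or> \<epsilon> k = - 1) \<and> g k = axis (\<pi> k) (\<epsilon> k)"
    using assms(1) unfolding frame_def by blast
  show ?thesis
  proof (rule point_eqI)
    fix k :: nat assume k: "k < 5"
    show "coord p k = coord q k"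
      using phi_nth [OF \<pi> \<epsilon> k, of c p] phi_nth [OF \<pi> \<epsilon> k, of c q] assms(2) \<epsilon> k by force
  qed
qed

definition fl :: "nat \<Rightarrow> point \<Rightarrow> point" where
  "fl k p = flips p ! k"

lemma fl_simps [simp]:
  "fl 0 (a, b, c, d, e) = (1 - a, b, c, d, e)" "fl (Suc 0) (a, b, c, d, e) = (a, 1 - b, c, d, e)"
  "fl 2 (a, b, c, d, e) = (a, b, 1 - c, d, e)" "fl 3 (a, b, c, d, e) = (a, b, c, 1 - d, e)"
  "fl 4 (a, b, c, d, e) = (a, b, c, d, 1 - e)"
  by (simp_all add: fl_def)

lemma coord_fl: "k < 5 \<Longrightarrow> j < 5 \<Longrightarrow> coord (fl k p) j = (if j = k then 1 - coord p k else coord p j)"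
  by (cases p) (auto simp: less5)

lemma fl_fl: "k < 5 \<Longrightarrow> fl k (fl k p) = p"
  by (rule point_eqI) (simp add: coord_fl)

lemma fl_commute: "k < 5 \<Longrightarrow> j < 5 \<Longrightarrow> fl k (fl j p) = fl j (fl k p)"
  by (rule point_eqI) (simp add: coord_fl)

lemma fl_unit_cube: "k < 5 \<Longrightarrow> p \<in> set unit_cube \<Longrightarrow> fl k p \<in> set unit_cube"
  by (auto simp: unit_cube_iff coord_fl)

lemma fl_inj:
  assumes "k < 5" "j < 5" "fl k p = fl j p" "p \<in> set unit_cube"
  shows "k = j"
proof (rule ccontr)
  assume "k \<noteq> j"
  with assms(1-3) have "1 - coord p k = coord p k"
    using coord_fl [of k k p] coord_fl [of j k p] by simp
  then show False by presburger
qed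

lemma fl_step:
  assumes k: "k < 5" and p: "p \<in> set unit_cube"
  shows "\<exists>d. fl k p = go d p"
proof -
  obtain a b c d e where pp: "p = (a, b, c, d, e)" by (cases p) auto
  have v: "a = 0 \<or> a = 1" "b = 0 \<or> b = 1" "c = 0 \<or> c = 1" "d = 0 \<or> d = 1" "e = 0 \<or> e = 1"
    using p unfolding pp mem_unit_cube by simp_all
  have "fl 0 p = go U0 p \<or> fl 0 p = go D0 p" unfolding pp using v(1) by (elim disjE) simp_all
  moreover have "fl 1 p = go U1 p \<or> fl 1 p = go D1 p" unfolding pp using v(2) by (elim disjE) simp_all
  moreover have "fl 2 p = go U2 p \<or> fl 2 p = go D2 p" unfolding pp using v(3) by (elim disjE) simp_all
  moreover have "fl 3 p = go U3 p \<or> fl 3 p = go D3 p" unfolding pp using v(4) by (elim disjE) simp_all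
  moreover have "fl 4 p = go U4 p \<or> fl 4 p = go D4 p" unfolding pp using v(5) by (elim disjE) simp_all
  ultimately show ?thesis
    using k unfolding less5 by blast
qed

lemma adj_phi_fl:
  assumes "frame g" "k < 5" "p \<in> set unit_cube"
  shows "adj (phi c g p) (phi c g (fl k p))"
proof -
  obtain d where "fl k p = go d p"
    using fl_step [OF assms(2,3)] by blast
  then show ?thesis
    by (simp add: phi_go adj_vstep [OF assms(1)])
qed

lemma adj_phiD:
  assumes g: "frame g" and p: "p \<in> set unit_cube" and q: "q \<in> set unit_cube"
    and a: "adj (phi c g p) (phi c g q)"
  shows "\<exists>k<5. q = fl k p"
proof -
  obtain \<pi> \<epsilon> where \<pi>: "bij_betw \<pi> {..<5} (UNIV :: 5 set)"
    and \<epsilon>: "\<forall>k<5. (\<epsilon> k = 1 \<or> \<epsilon> k = - 1) \<and> g k = axis (\<pi> k) (\<epsilon> k)"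
    using g unfolding frame_def by blast
  obtain i where i: "phi c g q = phi c g p + axis i 1 \<or> phi c g q = phi c g p - axis i 1"
    using a unfolding adj_def by blast
  obtain k where k: "k < 5" "i = \<pi> k"
    using \<pi> unfolding bij_betw_def by (metis UNIV_I imageE lessThan_iff)
  have *: "coord q j * \<epsilon> j = coord p j * \<epsilon> j" if "j < 5" "j \<noteq> k" for j
  proof -
    have "\<pi> j \<noteq> \<pi> k"
      using \<pi> that k by (auto simp: bij_betw_def inj_on_def)
    then show ?thesis
      using i phi_nth [OF \<pi> \<epsilon> that(1), of c p] phi_nth [OF \<pi> \<epsilon> that(1), of c q] k
      by (auto simp: axis_def)
  qed
  have "coord q k * \<epsilon> k \<noteq> coord p k * \<epsilon> k"
    using i phi_nth [OF \<pi> \<epsilon> k(1), of c p] phi_nth [OF \<pi> \<epsilon> k(1), of c q] k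
    by (auto simp: axis_def)
  then have "coord q k = 1 - coord p k"
    using p q k unfolding unit_cube_iff by (metis diff_self diff_zero)
  moreover have "coord q j = coord p j" if "j < 5" "j \<noteq> k" for j
    using * [OF that] \<epsilon> that by force
  ultimately have "q = fl k p"
    using k by (intro point_eqI) (simp add: coord_fl)
  with k show ?thesis by blast
qed

lemma two_core_next:
  assumes z: "framed z c g" and K: "two_core K" "K \<subseteq> cube z"
    and p: "p \<in> set unit_cube" "phi c g p \<in> K"
  shows "\<exists>k<5. \<exists>j<5. k \<noteq> j \<and> phi c g (fl k p) \<in> K \<and> phi c g (fl j p) \<in> K"
proof -
  have g: "frame g" and im: "cube z = phi c g ` set unit_cube"
    using z by (auto simp: framed_def)
  obtain u w where uw: "u \<in> K" "w \<in> K" "u \<noteq> w" "adj (phi c g p) u" "adj (phi c g p) w"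
    using K(1) p(2) unfolding two_core_def by blast
  then obtain q r where qr: "q \<in> set unit_cube" "r \<in> set unit_cube" "u = phi c g q" "w = phi c g r"
    using K(2) im by blast
  obtain k j where "k < 5" "q = fl k p" "j < 5" "r = fl j p"
    using adj_phiD [OF g p(1)] qr uw by metis
  then show ?thesis
    using uw qr by blast
qed

lemma core_phi:
  assumes z: "framed z c g" and K: "two_core K" "K \<subseteq> cube z"
  shows "core (\<lambda>p. phi c g p \<in> K)"
proof -
  obtain v where "v \<in> K" "v \<in> phi c g ` set unit_cube"
    using z K unfolding framed_def two_core_def by auto
  then have "\<exists>p\<in>set unit_cube. phi c g p \<in> K"
    by auto
  moreover have "list_all (list_ex (\<lambda>p. phi c g p \<in> K)) (omit1 (flips p))"
    if p: "p \<in> set unit_cube" "phi c g p \<in> K" for p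
  proof -
    obtain a b d e f where pp: "p = (a, b, d, e, f)" by (cases p) auto
    obtain k j where "k < 5" "j < 5" "k \<noteq> j" "phi c g (fl k p) \<in> K" "phi c g (fl j p) \<in> K"
      using two_core_next [OF z K p] by blast
    then show ?thesis
      unfolding pp less5 by (elim disjE) simp_all
  qed
  ultimately show ?thesis
    by (simp add: core_def list_ex_iff list_all_iff)
qed

section \<open>Cycles of induced subgraphs of the grid\<close>

text \<open>The squared distance is a sum of integer squares, which is 1 only if one term is 1 and
  all others vanish.\<close>

lemma grid_arcs: "(x, y) \<in> parcs grid \<longleftrightarrow> adj x y"
proof -
  let ?d = "\<lambda>i. (real_of_int (x $ i) - real_of_int (y $ i))\<^sup>2"
  have "dist (\<chi> i. real_of_int (x $ i)) (\<chi> i. real_of_int (y $ i)) = sqrt (\<Sum>i\<in>UNIV. ?d i)"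
    by (simp add: dist_vec_def L2_set_def dist_real_def)
  also have "(\<Sum>i\<in>UNIV. ?d i) = of_int (\<Sum>i\<in>UNIV. (x $ i - y $ i)\<^sup>2)"
    by simp
  finally have 1: "(x, y) \<in> parcs grid \<longleftrightarrow> (\<Sum>i\<in>UNIV. (x $ i - y $ i)\<^sup>2) = 1"
    by (simp add: grid_def del: of_int_sum of_int_power of_int_diff)
  have "adj x y" if s: "(\<Sum>i\<in>UNIV. (x $ i - y $ i)\<^sup>2) = 1"
  proof -
    obtain i where i: "(x $ i - y $ i)\<^sup>2 \<noteq> 0"
      using s by (metis (no_types, lifting) sum.neutral zero_neq_one)
    have r: "(x $ i - y $ i)\<^sup>2 + (\<Sum>j\<in>UNIV - {i}. (x $ j - y $ j)\<^sup>2) = 1"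
      using s by (simp add: sum.remove [of UNIV i])
    have nn: "0 \<le> (\<Sum>j\<in>UNIV - {i}. (x $ j - y $ j)\<^sup>2)"
      by (intro sum_nonneg) simp
    have "0 < (x $ i - y $ i)\<^sup>2" using i by simp
    with r nn have "(x $ i - y $ i)\<^sup>2 = 1" and z: "(\<Sum>j\<in>UNIV - {i}. (x $ j - y $ j)\<^sup>2) = 0"
      by linarith+
    then have "x $ i - y $ i = 1 \<or> x $ i - y $ i = - 1"
      by (simp add: power2_eq_1_iff)
    moreover have "x $ j = y $ j" if "j \<noteq> i" for j
    proof -
      have "(x $ j - y $ j)\<^sup>2 = 0"
        using z that by (subst (asm) sum_nonneg_eq_0_iff) auto
      then show ?thesis by simp
    qed
    ultimately have "y = x + axis i 1 \<or> y = x - axis i 1"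
      by (auto simp: vec_eq_iff axis_def)
    then show ?thesis by (auto simp: adj_def)
  qed
  moreover have "(\<Sum>i\<in>UNIV. (x $ i - y $ i)\<^sup>2) = 1" if a: "adj x y"
  proof -
    obtain i where i: "y = x + axis i 1 \<or> y = x - axis i 1"
      using a by (auto simp: adj_def)
    then have "(x $ j - y $ j)\<^sup>2 = (if j = i then 1 else 0)" for j
      by (auto simp: axis_def)
    then show ?thesis by simp
  qed
  ultimately show ?thesis using 1 by blast
qed

lemma grid_verts: "pverts grid = UNIV"
  by (simp add: grid_def)

lemma induced_grid:
  fixes H :: "(int ^ 'n::finite) pair_pre_digraph"
  shows "induced_subgraph (with_proj H) (with_proj grid) \<longleftrightarrow>
    parcs H = {(x, y). x \<in> pverts H \<and> y \<in> pverts H \<and> adj x y}"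
proof -
  have "wf_digraph (with_proj (grid :: (int ^ 'n) pair_pre_digraph))"
    by unfold_locales (auto simp: grid_def)
  moreover have "parcs H = {(x, y). x \<in> pverts H \<and> y \<in> pverts H \<and> adj x y} \<Longrightarrow> wf_digraph (with_proj H)"
    by unfold_locales auto
  moreover have "{e \<in> parcs grid. fst e \<in> V \<and> snd e \<in> V} = {(x, y). x \<in> V \<and> y \<in> V \<and> adj x y}"
    for V :: "(int ^ 'n) set"
    using grid_arcs by auto
  ultimately show ?thesis
    by (auto simp: induced_subgraph_def subgraph_def grid_verts grid_arcs compatible_def)
qed

lemma vwalk_arcs_cas:
  "ys \<noteq> [] \<Longrightarrow> pre_digraph.cas (with_proj H) (hd ys) (vwalk_arcs ys) (last ys) \<and>
     pre_digraph.awalk_verts (with_proj H) (hd ys) (vwalk_arcs ys) = ys"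
  unfolding cas_with_proj_eq awalk_verts_with_proj_eq
  by (induction ys rule: vwalk_arcs.induct) auto

lemma length_vwalk_arcs': "length (vwalk_arcs ys) = length ys - 1"
  by (induction ys rule: vwalk_arcs.induct) auto

lemma set_vwalk_arcs: "successively P ys \<Longrightarrow> set ys \<subseteq> S \<Longrightarrow> (x, y) \<in> set (vwalk_arcs ys) \<Longrightarrow> P x y \<and> x \<in> S \<and> y \<in> S"
  by (induction ys rule: vwalk_arcs.induct) auto

lemma cycle_of_list:
  assumes H: "induced_subgraph (with_proj H) (with_proj grid)"
    and xs: "distinct xs" "set xs \<subseteq> pverts H" "successively adj xs" "adj (last xs) (hd xs)" "xs \<noteq> []"
  shows "\<exists>p. pre_digraph.cycle (with_proj H) p \<and> length p = length xs"
proof -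
  let ?ys = "xs @ [hd xs]"
  have su: "successively adj ?ys"
    using xs by (simp add: successively_append_iff)
  have st: "set ?ys \<subseteq> pverts H"
    using xs by (cases xs) auto
  have "set (vwalk_arcs ?ys) \<subseteq> parcs H"
    using set_vwalk_arcs [OF su st] H unfolding induced_grid by auto
  moreover have "hd ?ys = last ?ys" "hd ?ys \<in> pverts H" "distinct (tl ?ys)"
    using xs by (cases xs; auto)+
  moreover have "vwalk_arcs ?ys \<noteq> []"
    using xs(5) length_vwalk_arcs' [of ?ys] by (metis diff_Suc_1 length_append_singleton length_0_conv)
  ultimately have "pre_digraph.cycle (with_proj H) (vwalk_arcs ?ys)"
    using vwalk_arcs_cas [of ?ys H] unfolding pre_digraph.cycle_def pre_digraph.awalk_def
    by (intro exI [of _ "hd ?ys"]) simp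
  then show ?thesis
    using length_vwalk_arcs' [of ?ys] by auto
qed

lemma cas_verts:
  "pre_digraph.cas (with_proj H) u p v \<Longrightarrow> set p \<subseteq> parcs H \<Longrightarrow>
    (let ys = pre_digraph.awalk_verts (with_proj H) u p in
      length ys = Suc (length p) \<and> hd ys = u \<and> last ys = v \<and> successively (\<lambda>x y. (x, y) \<in> parcs H) ys)"
  unfolding cas_with_proj_eq awalk_verts_with_proj_eq
proof (induction p arbitrary: u)
  case (Cons e p)
  then have IH: "let ys = pawalk_verts (snd e) p in
      length ys = Suc (length p) \<and> hd ys = snd e \<and> last ys = v \<and> successively (\<lambda>x y. (x, y) \<in> parcs H) ys"
    by simp
  then show ?case
    using Cons.prems by (cases "pawalk_verts (snd e) p") (auto simp: Let_def successively_Cons)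
qed simp

lemma list_of_cycle:
  assumes H: "induced_subgraph (with_proj H) (with_proj grid)"
    and p: "pre_digraph.cycle (with_proj H) p"
  shows "\<exists>ys. length ys = Suc (length p) \<and> hd ys = last ys \<and> distinct (tl ys) \<and>
    successively (\<lambda>x y. x \<in> pverts H \<and> y \<in> pverts H \<and> adj x y) ys"
proof -
  obtain u where u: "pre_digraph.cas (with_proj H) u p u" "set p \<subseteq> parcs H"
      "distinct (tl (pre_digraph.awalk_verts (with_proj H) u p))"
    using p unfolding pre_digraph.cycle_def pre_digraph.awalk_def by auto
  have eq: "(\<lambda>x y. (x, y) \<in> parcs H) = (\<lambda>x y. x \<in> pverts H \<and> y \<in> pverts H \<and> adj x y)"
    using H unfolding induced_grid by auto
  show ?thesis
    using cas_verts [OF u(1,2)] u(3) unfolding eq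
    by (intro exI [of _ "pre_digraph.awalk_verts (with_proj H) u p"]) (simp add: Let_def)
qed

text \<open>A walk with a repetition is shortened at either end as long as a repetition remains. In
  the result only the two ends coincide, which makes it a cycle.\<close>

lemma minimal_nbwalk:
  "nbwalk S xs \<Longrightarrow> \<not> distinct xs \<Longrightarrow>
    \<exists>ys. nbwalk S ys \<and> length ys \<le> length xs \<and> \<not> distinct ys \<and> distinct (tl ys) \<and> distinct (butlast ys)"
proof (induction "length xs" arbitrary: xs rule: less_induct)
  case less
  show ?case
  proof (cases "distinct (tl xs) \<and> distinct (butlast xs)")
    case True
    with less.prems show ?thesis by blast
  next
    case False
    have "xs \<noteq> []" using less.prems by auto
    then obtain zs where "nbwalk S zs" "\<not> distinct zs" "length zs < length xs"
      using False less.prems nbwalk_tl nbwalk_butlast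
      by (metis diff_less length_butlast length_greater_0_conv length_tl zero_less_one)
    then show ?thesis using less.hyps [of zs] by (metis less_imp_le order_trans)
  qed
qed

lemma no_short_of_girth:
  assumes H: "induced_subgraph (with_proj H) (with_proj grid)" and g: "\<not> girth H \<le> 10"
  shows "no_short (pverts H)"
  unfolding no_short_def
proof (intro allI impI, rule ccontr)
  fix xs assume "nbwalk (pverts H) xs" "length xs \<le> 11" "\<not> distinct xs"
  then obtain ys where ys: "nbwalk (pverts H) ys" "length ys \<le> 11" "\<not> distinct ys" "distinct (tl ys)" "distinct (butlast ys)"
    using minimal_nbwalk by (metis order_trans)
  then obtain x zs where x: "ys = x # zs" "zs \<noteq> []" by (cases ys; cases "tl ys") auto
  then have "x \<in> set zs" "distinct zs" "x \<notin> set (butlast zs)" using ys by auto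
  then have lx: "last zs = x"
    using x(2) by (metis append_butlast_last_id in_set_conv_decomp insert_iff list.set(2) set_append Un_iff empty_iff list.set(1))
  let ?b = "butlast ys"
  have ysb: "ys = ?b @ [x]" and bx: "?b = x # butlast zs"
    using x lx by auto
  have su: "successively adj (?b @ [x])"
    using nbwalk_successively [OF ys(1)] ysb by simp
  \<comment> \<open>With fewer vertices the walk would be a loop \<open>[x, x]\<close> or a reversal
    \<open>[x, y, x]\<close>, and neither is a non-backtracking walk.\<close>
  have "3 \<le> length ?b"
  proof (rule ccontr)
    assume "\<not> 3 \<le> length ?b"
    then have "length (butlast zs) < 2" using bx by (metis length_Cons not_less_eq_eq not_le numeral_2_eq_2 numeral_3_eq_3)
    then obtain y where "butlast zs = [] \<or> butlast zs = [y]"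
      by (metis One_nat_def length_0_conv length_Suc_conv less_2_cases)
    then have "ys = [x, x] \<or> ys = [x, y, x]" using ysb bx by auto
    then show False using ys(1) by auto
  qed
  moreover have "set ?b \<subseteq> pverts H"
    using nbwalk_set [OF ys(1)] in_set_butlastD [of _ ys] by blast
  moreover have "successively adj ?b" "adj (last ?b) (hd ?b)"
    using su bx unfolding successively_append_iff by simp_all
  ultimately obtain p where p: "pre_digraph.cycle (with_proj H) p" "length p = length ?b" "3 \<le> length p"
    using cycle_of_list [OF H ys(5)] bx by fastforce
  have "length ?b \<le> 10" using ys(2) by simp
  then have "enat (length p) \<le> 10"
    using p(2) by (simp add: numeral_eq_enat)
  moreover have "girth H \<le> enat (length p)"
    unfolding girth_def using p by (intro INF_lower) simp
  ultimately show False using g by (meson order_trans)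
qed

section \<open>A 4-regular induced subgraph of girth 10\<close>

lemma unit_step_surj: "k < 5 \<Longrightarrow> s = 1 \<or> s = - 1 \<Longrightarrow> \<exists>d. unit_step d = (k, s)"
  using unit_step.simps unfolding less5 by metis

lemma adj_vstepE:
  assumes g: "frame g" and a: "adj x y"
  shows "\<exists>d. y = x + vstep g d"
proof -
  obtain \<pi> \<epsilon> where \<pi>: "bij_betw \<pi> {..<5} (UNIV :: 5 set)"
    and \<epsilon>: "\<forall>k<5. (\<epsilon> k = 1 \<or> \<epsilon> k = - 1) \<and> g k = axis (\<pi> k) (\<epsilon> k)"
    using g unfolding frame_def by blast
  obtain i where i: "y = x + axis i 1 \<or> y = x - axis i 1"
    using a by (auto simp: adj_def)
  obtain k where k: "k < 5" "i = \<pi> k"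
    using \<pi> unfolding bij_betw_def by (metis UNIV_I imageE lessThan_iff)
  obtain s where s: "s = 1 \<or> s = - 1" "y = x + axis i (s * \<epsilon> k)"
  proof (cases "y = x + axis i (\<epsilon> k)")
    case True
    then show ?thesis using that [of 1] by simp
  next
    case False
    then have "y = x + axis i (- \<epsilon> k)"
      using i \<epsilon> k by (auto simp: axis_uminus)
    then show ?thesis using that [of "- 1"] by simp
  qed
  obtain d where "unit_step d = (k, s)"
    using unit_step_surj k(1) s(1) by blast
  then have "y = x + vstep g d"
    using s(2) k(2) unfolding vstep_axis [OF \<epsilon>] by simp
  then show ?thesis ..
qed

section \<open>The pattern of squares modulo 11\<close>

definition weight :: "point \<Rightarrow> int" where
  "weight = (\<lambda>(a, b, c, d, e). a + 2 * b + 3 * c + 4 * d + 5 * e)"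

fun step_weight :: "step \<Rightarrow> int" where
  "step_weight U0 = 1" | "step_weight U1 = 2" | "step_weight U2 = 3"
| "step_weight U3 = 4" | "step_weight U4 = 5"
| "step_weight D0 = - 1" | "step_weight D1 = - 2" | "step_weight D2 = - 3"
| "step_weight D3 = - 4" | "step_weight D4 = - 5"

definition squares :: "int list" where
  "squares = [1, 3, 4, 5, 9]"

definition pattern :: "point \<Rightarrow> bool" where
  "pattern p \<longleftrightarrow> weight p mod 11 \<in> set squares"

text \<open>Tabulated so that the search below does no residue arithmetic: the residues of the
  neighbours inside the pattern, each with the step leading there. The last branch is for the
  residue 9.\<close>

definition moves :: "int \<Rightarrow> (int \<times> step) list" where
  "moves r =
    (if r = 1 then [(3, U1), (4, U2), (5, U3), (9, D2)]
     else if r = 3 then [(4, U0), (5, U1), (1, D1), (9, D4)]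
     else if r = 4 then [(5, U0), (9, U4), (3, D0), (1, D2)]
     else if r = 5 then [(9, U3), (4, D0), (3, D1), (1, D3)]
     else [(1, U2), (3, U4), (5, D3), (4, D4)])"

lemma weight_go: "weight (go d p) mod 11 = (weight p mod 11 + step_weight d) mod 11"
proof -
  have "weight (go d p) = weight p + step_weight d"
    by (cases p; cases d) (simp_all add: weight_def)
  then show ?thesis by (simp add: mod_add_left_eq)
qed

lemma set_moves:
  assumes "r \<in> set squares"
  shows "(r', d) \<in> set (moves r) \<longleftrightarrow> r' = (r + step_weight d) mod 11 \<and> r' \<in> set squares"
  using assms by (cases d) (auto simp: squares_def moves_def)

lemma card_moves:
  assumes "r \<in> set squares"
  shows "card (snd ` set (moves r)) = 4"
  using assms by (auto simp: squares_def moves_def)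

lemma pattern_go:
  assumes "pattern p"
  shows "pattern (go d p) \<longleftrightarrow> (weight (go d p) mod 11, d) \<in> set (moves (weight p mod 11))"
  using assms set_moves weight_go unfolding pattern_def by metis

lemma card_pattern_go:
  assumes "pattern p"
  shows "card {d. pattern (go d p)} = 4"
proof -
  let ?r = "weight p mod 11"
  have r: "?r \<in> set squares" using assms by (simp add: pattern_def)
  have "pattern (go d p) \<longleftrightarrow> d \<in> snd ` set (moves ?r)" for d
  proof
    assume "pattern (go d p)"
    then have "(weight (go d p) mod 11, d) \<in> set (moves ?r)"
      using pattern_go [OF assms] by blast
    then show "d \<in> snd ` set (moves ?r)" by (rule rev_image_eqI) simp
  next
    assume "d \<in> snd ` set (moves ?r)"
    then obtain r' where "(r', d) \<in> set (moves ?r)" by (metis imageE prod.collapse)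
    then show "pattern (go d p)"
      unfolding set_moves [OF r] pattern_def weight_go by metis
  qed
  then have "{d. pattern (go d p)} = snd ` set (moves ?r)" by blast
  then show ?thesis
    using card_moves [OF r] by simp
qed

text \<open>A lower bound for the number of steps back to the origin, by which the search
  prunes.\<close>

definition taxicab :: "point \<Rightarrow> int" where
  "taxicab = (\<lambda>(a, b, c, d, e). \<bar>a\<bar> + \<bar>b\<bar> + \<bar>c\<bar> + \<bar>d\<bar> + \<bar>e\<bar>)"

lemma taxicab_endpoint: "taxicab p \<le> taxicab (endpoint p w) + int (length w)"
proof (induction w arbitrary: p)
  case (Cons d w)
  have "taxicab p \<le> taxicab (go d p) + 1"
    by (cases p; cases d) (simp_all add: taxicab_def)
  with Cons [of "go d p"] show ?case by simp
qed simp

text \<open>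
  A walk that has arrived at a point of residue \<open>r\<close> by the step \<open>l\<close>, at displacement \<open>q\<close> from
  its start, can return to the start in at most \<open>n\<close> steps.
\<close>

fun closes :: "nat \<Rightarrow> int \<Rightarrow> step \<Rightarrow> point \<Rightarrow> bool" where
  "closes 0 r l q \<longleftrightarrow> q = (0, 0, 0, 0, 0)"
| "closes (Suc n) r l q \<longleftrightarrow> q = (0, 0, 0, 0, 0) \<or> taxicab q \<le> 1 + int n \<and>
     list_ex (\<lambda>(r', d). d \<noteq> opp l \<and> closes n r' d (go d q)) (moves r)"

text \<open>The residue of a point determines which steps stay in the pattern, so the search need
  not know the position \<open>p\<close>. Keeping the displacement \<open>q\<close> apart from it
  lets one search per residue serve all starting points.\<close>

lemma closes_complete:
  "along pattern p w \<Longrightarrow> pattern (endpoint p w) \<Longrightarrow> reduced (l # w) \<Longrightarrow>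
    endpoint q w = (0, 0, 0, 0, 0) \<Longrightarrow> length w \<le> n \<Longrightarrow> closes n (weight p mod 11) l q"
proof (induction w arbitrary: p l q n)
  case Nil
  then show ?case by (cases n) auto
next
  case (Cons d w)
  then obtain m where n: "n = Suc m" by (cases n) auto
  have "pattern p" "pattern (go d p)"
    using Cons.prems(1,2) by (cases w; simp)+
  then have "(weight (go d p) mod 11, d) \<in> set (moves (weight p mod 11))"
    using pattern_go by blast
  moreover have "closes m (weight (go d p) mod 11) d (go d q)"
    using Cons.prems n by (intro Cons.IH) auto
  moreover have "d \<noteq> opp l" using Cons.prems(3) by simp
  moreover have "taxicab q \<le> 1 + int m"
    using taxicab_endpoint [of q "d # w"] Cons.prems n by (simp add: taxicab_def)
  ultimately show ?case
    using n by (auto simp: list_ex_iff)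
qed

text \<open>A first step and up to 8 more, hence no closed walk of at most 9 steps. One step more
  would succeed, by \<open>ten_cycle\<close>.\<close>

lemma not_closes:
  "list_all (\<lambda>r. list_all (\<lambda>(r', d). \<not> closes 8 r' d (go d (0, 0, 0, 0, 0))) (moves r)) squares"
  by code_simp

lemma endpoint_add: "endpoint (p + q) w = p + endpoint q w"
proof (induction w arbitrary: q)
  case (Cons d w)
  have "go d (p + q) = p + go d q"
    by (cases p; cases q; cases d) simp_all
  with Cons show ?case by simp
qed simp

lemma pattern_no_short_cycle:
  assumes "along pattern p w" "reduced w" "endpoint p w = p" "w \<noteq> []"
  shows "10 \<le> length w"
proof (rule ccontr)
  assume l: "\<not> 10 \<le> length w"
  obtain d v where w: "w = d # v" using assms(4) by (cases w) auto
  have "p + endpoint 0 w = p"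
    using endpoint_add [of p 0 w] assms(3) by simp
  then have e: "endpoint (go d (0, 0, 0, 0, 0)) v = (0, 0, 0, 0, 0)"
    using w by (simp add: zero_prod_def)
  have p: "pattern p" "pattern (endpoint (go d p) v)" using assms(1,3) w by auto
  then have pd: "pattern (go d p)" using assms(1) w by (cases v) auto
  have "closes 8 (weight (go d p) mod 11) d (go d (0, 0, 0, 0, 0))"
    using assms w e l p by (intro closes_complete) auto
  moreover have "(weight (go d p) mod 11, d) \<in> set (moves (weight p mod 11))"
    using pattern_go p(1) pd by blast
  ultimately show False
    using not_closes p(1) unfolding pattern_def list_all_iff by fastforce
qed

lemma go_opp: "go (opp d) (go d p) = p"
  by (cases p; cases d) simp_all

lemma go_eq_iff: "go d p = go e p \<longleftrightarrow> d = e"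
  by (cases p; cases d; cases e) simp_all

lemma reduced_of_distinct: "distinct (trail p w) \<Longrightarrow> reduced w"
proof (induction w arbitrary: p rule: reduced.induct)
  case (1 d e w)
  have "e \<noteq> opp d"
    using 1(2) go_opp [of d p] trail_Cons [of "go e (go d p)" w] by auto
  with 1(1) [of "go d p"] 1(2) show ?case by simp
qed auto

text \<open>Distinctness of the tail rules out reversals after the first step. A reversal of the
  first step would make \<open>p\<close> the second entry of the tail, which also ends with
  \<open>p\<close>; by the length bound these are two different places.\<close>

lemma reduced_of_cycle:
  assumes "distinct (tl (trail p w))" "endpoint p w = p" "3 \<le> length w"
  shows "reduced w"
proof -
  obtain d e f v where w: "w = d # e # f # v"
    using assms(3) by (metis length_Cons list.exhaust list.size(3) not_less_eq_eq numeral_3_eq_3 zero_le)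
  have dis: "distinct (trail (go d p) (e # f # v))" using assms(1) w by simp
  have "p \<in> set (trail (go f (go e (go d p))) v)"
    using assms(2) w last_trail [of "go f (go e (go d p))" v] trail_Cons last_in_set
    by (metis endpoint.simps(2) list.distinct(1))
  then have "e \<noteq> opp d" using dis go_opp [of d p] by auto
  then show ?thesis using reduced_of_distinct [OF dis] w by simp
qed

text \<open>Grid neighbours of an embedded point are reached by steps, and injectivity of
  \<open>phi\<close> turns membership in the image back into \<open>s\<close>.\<close>

lemma list_trail:
  assumes g: "frame g"
  shows "successively (\<lambda>x y. x \<in> phi c g ` Collect s \<and> y \<in> phi c g ` Collect s \<and> adj x y) (phi c g p # ys)
    \<Longrightarrow> \<exists>w. phi c g p # ys = map (phi c g) (trail p w) \<and> along s p w"
proof (induction ys arbitrary: p)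
  case Nil
  show ?case by (intro exI [of _ "[]"]) simp
next
  case (Cons y ys)
  then have a: "adj (phi c g p) y" and p: "phi c g p \<in> phi c g ` Collect s"
    and su: "successively (\<lambda>x y. x \<in> phi c g ` Collect s \<and> y \<in> phi c g ` Collect s \<and> adj x y) (y # ys)"
    by auto
  obtain d where d: "y = phi c g (go d p)"
    using adj_vstepE [OF g a] by (auto simp: phi_go)
  obtain w where "phi c g (go d p) # ys = map (phi c g) (trail (go d p) w)" "along s (go d p) w"
    using Cons.IH [OF su [unfolded d]] by (elim exE conjE) (rule that)
  moreover have "s p" using p phi_inj [OF g] by (metis imageE mem_Collect_eq)
  ultimately show ?case
    using d by (intro exI [of _ "d # w"]) simp
qed

lemma trail_successively:
  "frame g \<Longrightarrow> successively adj (map (phi c g) (trail p w))"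
proof (induction w arbitrary: p)
  case (Cons d w)
  obtain qs where "trail (go d p) w = go d p # qs" using trail_Cons by blast
  then show ?case
    using Cons.IH [of "go d p"] Cons.prems adj_vstep [of g "phi c g p" d] by (simp add: phi_go)
qed simp

lemma ten_cycle:
  assumes g: "frame g"
  shows "\<exists>xs. length xs = 10 \<and> distinct xs \<and> set xs \<subseteq> phi c g ` Collect pattern \<and>
    successively adj xs \<and> adj (last xs) (hd xs)"
proof -
  \<comment> \<open>With the closing step \<open>D3\<close> these steps cancel in pairs. The
    residues along the walk are 1, 4, 3, 1, 9, 3, 5, 9, 4, 5, all of them squares modulo 11.\<close>
  let ?p = "(1, 0, 0, 0, 0) :: point" and ?w = "[U2, D0, D1, D2, U4, U1, U3, D4, U0]"
  let ?xs = "map (phi c g) (trail ?p ?w)"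
  have "length ?xs = 10" by simp
  moreover have "inj (phi c g)" using phi_inj [OF g] by (auto intro: injI)
  then have "distinct ?xs"
    by (simp add: inj_eq)
  moreover have "set ?xs \<subseteq> phi c g ` Collect pattern"
    by (simp add: pattern_def weight_def squares_def)
  moreover have "last ?xs = phi c g (1, 0, 0, 1, 0)" "hd ?xs = phi c g (go D3 (1, 0, 0, 1, 0))"
    by simp_all
  then have "adj (last ?xs) (hd ?xs)"
    unfolding phi_go using adj_vstep [OF g] by simp
  ultimately show ?thesis using trail_successively [OF g] by blast
qed

lemma ex_girth_ten:
  "\<exists>H :: (int ^ 5) pair_pre_digraph.
    induced_subgraph (with_proj H) (with_proj grid) \<and> regular_graph 4 H \<and> girth H = 10"
proof -
  obtain \<pi> :: "nat \<Rightarrow> 5" where \<pi>: "bij_betw \<pi> {..<5} UNIV"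
    using ex_bij_betw_nat_finite [of "UNIV :: 5 set"] by (auto simp: atLeast0LessThan)
  define g where "g k = axis (\<pi> k) (1 :: int)" for k
  have g: "frame g"
    unfolding frame_def using \<pi> by (intro exI [of _ \<pi>] exI [of _ "\<lambda>_. 1"]) (simp add: g_def)
  define S where "S = phi 0 g ` Collect pattern"
  define H where "H = \<lparr>pverts = S, parcs = {(x, y). x \<in> S \<and> y \<in> S \<and> adj x y}\<rparr>"
  have H: "induced_subgraph (with_proj H) (with_proj grid)"
    unfolding induced_grid by (simp add: H_def)
  have inj: "inj (phi 0 g)" using phi_inj [OF g] by (auto intro: injI)
  have S: "phi 0 g p \<in> S \<longleftrightarrow> pattern p" for p
    using inj by (auto simp: S_def inj_eq)
  have "pattern (1, 0, 0, 0, 0)" by (simp add: pattern_def weight_def squares_def)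
  then have "S \<noteq> {}" using S by blast
  have "finite (neighbours H v) \<and> card (neighbours H v) = 4" if v: "v \<in> S" for v
  proof -
    obtain p where p: "v = phi 0 g p" "pattern p" using v by (auto simp: S_def)
    have go: "adj v (phi 0 g (go d p))" for d
      by (simp add: p phi_go adj_vstep [OF g])
    have ex: "\<exists>d. y = phi 0 g (go d p)" if "adj v y" for y
      using adj_vstepE [OF g that] by (auto simp: p phi_go)
    have "neighbours H v = {w \<in> S. adj v w}"
      using v by (auto simp: neighbours_def H_def)
    also have "\<dots> = (\<lambda>d. phi 0 g (go d p)) ` {d. pattern (go d p)}"
    proof (intro equalityI subsetI)
      fix w assume w: "w \<in> {w \<in> S. adj v w}"
      then obtain d where "w = phi 0 g (go d p)" using ex by blast
      then show "w \<in> (\<lambda>d. phi 0 g (go d p)) ` {d. pattern (go d p)}"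
        using w S by simp
    next
      fix w assume "w \<in> (\<lambda>d. phi 0 g (go d p)) ` {d. pattern (go d p)}"
      then show "w \<in> {w \<in> S. adj v w}" by (auto simp: go S)
    qed
    finally have n: "neighbours H v = (\<lambda>d. phi 0 g (go d p)) ` {d. pattern (go d p)}" .
    have "inj_on (\<lambda>d. phi 0 g (go d p)) {d. pattern (go d p)}"
    proof (rule inj_onI)
      fix d e assume "phi 0 g (go d p) = phi 0 g (go e p)"
      then show "d = e" using injD [OF inj] go_eq_iff by blast
    qed
    then have "card (neighbours H v) = card {d. pattern (go d p)}"
      unfolding n by (rule card_image)
    then have "card (neighbours H v) = 4"
      using card_pattern_go [OF p(2)] by simp
    then show ?thesis by (simp add: card_ge_0_finite)
  qed
  then have "regular_graph 4 H"
    using \<open>S \<noteq> {}\<close> by (simp add: regular_graph_def H_def)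
  \<comment> \<open>Read in coordinates, a cycle of \<open>H\<close> is the trail of a reduced
    closed walk inside the pattern.\<close>
  moreover have "10 \<le> length p" if p: "pre_digraph.cycle (with_proj H) p" "3 \<le> length p" for p
  proof -
    obtain ys where ys: "length ys = Suc (length p)" "hd ys = last ys" "distinct (tl ys)"
      "successively (\<lambda>x y. x \<in> S \<and> y \<in> S \<and> adj x y) ys"
      using list_of_cycle [OF H p(1)] by (auto simp: H_def)
    then obtain x y zs where x: "ys = x # y # zs"
      using p(2) by (cases ys; cases "tl ys") auto
    then have "x \<in> S" using ys(4) by simp
    then obtain q where q: "x = phi 0 g q" by (auto simp: S_def)
    obtain w where w: "phi 0 g q # y # zs = map (phi 0 g) (trail q w)" "along pattern q w"
      using list_trail [OF g ys(4) [unfolded x q S_def]] by (elim exE conjE) (rule that)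
    then have w: "ys = map (phi 0 g) (trail q w)" "along pattern q w" using x q by simp_all
    have lw: "length w = length p" using ys(1) w(1) by simp
    have "trail q w \<noteq> []" using trail_Cons [of q w] by auto
    then have "phi 0 g (endpoint q w) = phi 0 g q"
      using ys(2) w(1) trail_Cons [of q w] by (auto simp: last_map last_trail [symmetric])
    then have e: "endpoint q w = q" using inj by (simp add: inj_eq)
    have "distinct (tl (trail q w))"
      using ys(3) w(1) by (simp add: distinct_map flip: map_tl)
    then have "reduced w" using reduced_of_cycle e lw p(2) by simp
    then show ?thesis using pattern_no_short_cycle [OF w(2) _ e] lw p(2) by (cases w) auto
  qed
  then have "10 \<le> girth H"
    unfolding girth_def by (intro INF_greatest) (simp add: numeral_eq_enat)
  moreover obtain p where "pre_digraph.cycle (with_proj H) p" "length p = 10"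
  proof -
    obtain xs where "length xs = 10" "distinct xs" "set xs \<subseteq> S" "successively adj xs" "adj (last xs) (hd xs)"
      using ten_cycle [OF g] unfolding S_def by blast
    moreover from this(1) have "xs \<noteq> []" by auto
    ultimately show ?thesis using cycle_of_list [OF H, of xs] that by (auto simp: H_def)
  qed
  then have "girth H \<le> enat 10"
    unfolding girth_def by (intro INF_lower2 [of p]) auto
  ultimately show ?thesis
    using H by (metis antisym numeral_eq_enat)
qed

section \<open>Cycles in a unit cube\<close>

text \<open>The symmetry of the unit cube that takes the origin to \<open>b\<close> and permutes the
  coordinates by \<tau>: for entries 0 and 1 the formula is the exclusive or of
  \<open>coord b j\<close> and \<open>coord x (\<tau> j)\<close>.\<close>

definition remap :: "point \<Rightarrow> (nat \<Rightarrow> nat) \<Rightarrow> point \<Rightarrow> point" where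
  "remap b \<tau> x = mk (\<lambda>j. coord b j + (1 - 2 * coord b j) * coord x (\<tau> j))"

text \<open>A symmetry of the cube is absorbed into the frame: the origin moves to the image of
  \<open>b\<close>, and the axes along which \<open>b\<close> has entry 1 are reversed. This is why
  each coil needs to be treated in one position only.\<close>

lemma phi_remap:
  assumes \<tau>: "bij_betw \<tau> {..<5} {..<5}" and \<sigma>: "\<And>j. j < 5 \<Longrightarrow> \<sigma> (\<tau> j) = j"
  shows "phi (phi c g b) (\<lambda>k. of_int (1 - 2 * coord b (\<sigma> k)) * g (\<sigma> k)) x = phi c g (remap b \<tau> x)"
proof -
  let ?f = "\<lambda>k. of_int (coord x k) * (of_int (1 - 2 * coord b (\<sigma> k)) * g (\<sigma> k))"
  have "(\<Sum>k<5. ?f k) = (\<Sum>j<5. ?f (\<tau> j))"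
    by (rule sum.reindex_bij_betw [OF \<tau>, symmetric])
  also have "\<dots> = (\<Sum>j<5. of_int ((1 - 2 * coord b j) * coord x (\<tau> j)) * g j)"
    by (rule sum.cong) (simp_all add: \<sigma> mult_ac)
  also have "(\<Sum>j<5. of_int (coord b j) * g j) + \<dots> = (\<Sum>j<5. of_int (coord (remap b \<tau> x) j) * g j)"
    unfolding sum.distrib [symmetric]
    by (rule sum.cong) (simp_all add: remap_def distrib_right)
  finally show ?thesis
    by (simp add: phi_def add.assoc)
qed

lemma framed_remap:
  assumes z: "framed z c g" and b: "b \<in> set unit_cube"
    and \<tau>: "bij_betw \<tau> {..<5} {..<5}" and \<sigma>: "\<And>j. j < 5 \<Longrightarrow> \<sigma> (\<tau> j) = j"
  shows "framed z (phi c g b) (\<lambda>k. of_int (1 - 2 * coord b (\<sigma> k)) * g (\<sigma> k))"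
proof -
  have \<sigma>': "\<sigma> k < 5" "\<tau> (\<sigma> k) = k" if "k < 5" for k
    using \<tau> \<sigma> that unfolding bij_betw_def by (metis imageE lessThan_iff)+
  have \<sigma>b: "bij_betw \<sigma> {..<5} {..<5}"
    by (rule bij_betw_byWitness [where f' = \<tau>]) (use \<tau> \<sigma> \<sigma>' in \<open>auto simp: bij_betw_def\<close>)
  obtain \<pi> \<epsilon> where \<pi>: "bij_betw \<pi> {..<5} (UNIV :: 5 set)"
    and \<epsilon>: "\<forall>k<5. (\<epsilon> k = 1 \<or> \<epsilon> k = - 1) \<and> g k = axis (\<pi> k) (\<epsilon> k)"
    using z unfolding framed_def frame_def by blast
  have cb: "coord b k = 0 \<or> coord b k = 1" if "k < 5" for k
    using b that by (simp add: unit_cube_iff)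
  have "bij_betw (\<pi> \<circ> \<sigma>) {..<5} UNIV"
    using bij_betw_trans [OF \<sigma>b \<pi>] .
  moreover have "\<forall>k<5. ((1 - 2 * coord b (\<sigma> k)) * \<epsilon> (\<sigma> k) = 1 \<or> (1 - 2 * coord b (\<sigma> k)) * \<epsilon> (\<sigma> k) = - 1) \<and>
      of_int (1 - 2 * coord b (\<sigma> k)) * g (\<sigma> k) =
        axis ((\<pi> \<circ> \<sigma>) k) ((1 - 2 * coord b (\<sigma> k)) * \<epsilon> (\<sigma> k))"
  proof (intro allI impI conjI)
    fix k :: nat assume k: "k < 5"
    have e: "\<epsilon> (\<sigma> k) = 1 \<or> \<epsilon> (\<sigma> k) = - 1" "g (\<sigma> k) = axis (\<pi> (\<sigma> k)) (\<epsilon> (\<sigma> k))"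
      using \<epsilon> \<sigma>'(1) [OF k] by blast+
    show "(1 - 2 * coord b (\<sigma> k)) * \<epsilon> (\<sigma> k) = 1 \<or> (1 - 2 * coord b (\<sigma> k)) * \<epsilon> (\<sigma> k) = - 1"
      using cb [OF \<sigma>'(1) [OF k]] e(1) by (elim disjE) simp_all
    show "of_int (1 - 2 * coord b (\<sigma> k)) * g (\<sigma> k) =
        axis ((\<pi> \<circ> \<sigma>) k) ((1 - 2 * coord b (\<sigma> k)) * \<epsilon> (\<sigma> k))"
      unfolding e(2) vec_eq_iff vector_mult_component of_int_vec_nth by (simp add: axis_def)
  qed
  ultimately have "frame (\<lambda>k. of_int (1 - 2 * coord b (\<sigma> k)) * g (\<sigma> k))"
    unfolding frame_def
    by (intro exI [of _ "\<pi> \<circ> \<sigma>"] exI [of _ "\<lambda>k. (1 - 2 * coord b (\<sigma> k)) * \<epsilon> (\<sigma> k)"] conjI)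
  moreover have "remap b \<tau> ` set unit_cube = set unit_cube"
  proof (intro equalityI subsetI)
    fix y assume "y \<in> remap b \<tau> ` set unit_cube"
    then obtain x where x: "x \<in> set unit_cube" "y = remap b \<tau> x" by blast
    show "y \<in> set unit_cube"
      unfolding unit_cube_iff
    proof (intro allI impI)
      fix j :: nat assume j: "j < 5"
      then have "\<tau> j < 5" using \<tau> by (auto simp: bij_betw_def)
      then have "coord x (\<tau> j) = 0 \<or> coord x (\<tau> j) = 1"
        using x(1) by (simp add: unit_cube_iff)
      then show "coord y j = 0 \<or> coord y j = 1"
        using cb [OF j] j unfolding x(2) by (elim disjE) (simp_all add: remap_def)
    qed
  next
    fix y assume y: "y \<in> set unit_cube"
    \<comment> \<open>The preimage of \<open>y\<close>: the exclusive or with \<open>b\<close> is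
      its own inverse, and \<sigma> undoes the permutation.\<close>
    let ?x = "mk (\<lambda>k. coord b (\<sigma> k) + (1 - 2 * coord b (\<sigma> k)) * coord y (\<sigma> k))"
    have "?x \<in> set unit_cube"
      unfolding unit_cube_iff
    proof (intro allI impI)
      fix k :: nat assume k: "k < 5"
      show "coord ?x k = 0 \<or> coord ?x k = 1"
        using cb [OF \<sigma>'(1) [OF k]] y [unfolded unit_cube_iff, rule_format, OF \<sigma>'(1) [OF k]] k
        by (elim disjE) simp_all
    qed
    then show "y \<in> remap b \<tau> ` set unit_cube"
    proof (rule image_eqI [rotated])
      have "remap b \<tau> ?x = y"
      proof (rule point_eqI)
        fix j :: nat assume j: "j < 5"
        then have "\<tau> j < 5" using \<tau> by (auto simp: bij_betw_def)
        then show "coord (remap b \<tau> ?x) j = coord y j"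
          using cb [OF j] j by (elim disjE) (simp_all add: remap_def \<sigma>)
      qed
      then show "y = remap b \<tau> ?x" ..
    qed
  qed
  moreover have "phi (phi c g b) (\<lambda>k. of_int (1 - 2 * coord b (\<sigma> k)) * g (\<sigma> k)) ` set unit_cube
      = phi c g ` (remap b \<tau> ` set unit_cube)"
    unfolding image_image by (rule image_cong [OF refl phi_remap [OF \<tau> \<sigma>]])
  ultimately show ?thesis
    using z by (simp add: framed_def)
qed

text \<open>
  A walk in the cube is the list of the coordinates it flips, the last one first. Two of its points
  differ in the coordinates flipped an odd number of times in between, which \<open>tgl\<close> collects.
  They must not coincide, nor be adjacent unless they are close along the walk. As the coordinates
  may be permuted, the search need only use the least coordinate not used so far as a new one.
\<close>

fun tgl :: "nat \<Rightarrow> nat list \<Rightarrow> nat list" where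
  "tgl a [] = [a]"
| "tgl a (b # xs) = (if a = b then xs else b # tgl a xs)"

text \<open>Stage \<open>j\<close> compares the newest point with the one \<open>j\<close> flips
  earlier, with \<open>od\<close> accumulating the coordinates in which they differ. An empty list
  would be the same point, a singleton an adjacent one; from \<open>j = 3\<close> on, adjacency
  would close a cycle.\<close>

fun chk :: "nat \<Rightarrow> nat list \<Rightarrow> nat list \<Rightarrow> bool" where
  "chk j od [] = True"
| "chk j od (a # w) = (let od' = tgl a od in od' \<noteq> [] \<and> (j < 3 \<or> tl od' \<noteq> []) \<and> chk (Suc j) od' w)"

fun pos :: "nat list \<Rightarrow> point" where
  "pos [] = (0, 0, 0, 0, 0)"
| "pos (a # w) = fl a (pos w)"

fun poss :: "nat list \<Rightarrow> point list" where
  "poss [] = [pos []]"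
| "poss (a # w) = pos (a # w) # poss w"

text \<open>\<open>m\<close> bounds the coordinates in use. Only the last 10 flips are tested
  because shorter returns are all that the girth forbids. A branch stops once it has at least 12
  points and its end is adjacent to its start. Branches that run out of fuel are returned as well,
  since a walk may meet itself elsewhere than at its start.\<close>

fun search :: "nat \<Rightarrow> nat list \<Rightarrow> nat \<Rightarrow> nat list list" where
  "search 0 w m = [w]"
| "search (Suc n) w m = (if 11 \<le> length w \<and> length (fold tgl w []) = 1 then [w]
    else concat (map (\<lambda>a. if (w = [] \<or> a \<noteq> hd w) \<and> chk 1 [] (take 10 (a # w))
        then search n (a # w) (max m (Suc a)) else []) [0..<min (Suc m) 5]))"

lemma pos_unit_cube: "set w \<subseteq> {..<5} \<Longrightarrow> pos w \<in> set unit_cube"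
proof (induction w)
  case Nil
  then show ?case by (simp add: mem_unit_cube)
qed (simp add: fl_unit_cube)

lemma coord_pos_0: "set w \<subseteq> {..<5} \<Longrightarrow> j < 5 \<Longrightarrow> j \<notin> set w \<Longrightarrow> coord (pos w) j = 0"
proof (induction w)
  case Nil
  then show ?case by (auto simp: less5)
qed (auto simp: coord_fl)

lemma length_poss [simp]: "length (poss w) = Suc (length w)"
  by (induction w) auto

lemma poss_nth: "i \<le> length w \<Longrightarrow> poss w ! i = pos (drop i w)"
proof (induction w arbitrary: i)
  case (Cons a w)
  then show ?case by (cases i) auto
qed simp

lemma set_poss: "set (poss w) = {pos (drop i w) |i. i \<le> length w}"
  unfolding set_conv_nth using poss_nth by (auto simp: less_Suc_eq_le) metis+

lemma poss_hd: "\<exists>qs. poss w = pos w # qs"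
  by (cases w) auto

lemma fl_foldr: "a < 5 \<Longrightarrow> set u \<subseteq> {..<5} \<Longrightarrow> fl a (foldr fl u p) = foldr fl u (fl a p)"
  by (induction u) (auto simp: fl_commute)

lemma foldr_tgl: "a < 5 \<Longrightarrow> set os \<subseteq> {..<5} \<Longrightarrow> foldr fl (tgl a os) p = fl a (foldr fl os p)"
  by (induction os) (auto simp: fl_fl fl_commute)

lemma set_tgl: "set (tgl a os) \<subseteq> insert a (set os)"
  by (induction os) auto

lemma foldr_fold_tgl:
  "set u \<subseteq> {..<5} \<Longrightarrow> set os \<subseteq> {..<5} \<Longrightarrow> foldr fl (fold tgl u os) p = foldr fl u (foldr fl os p)"
proof (induction u arbitrary: os)
  case (Cons a u)
  moreover have "set (tgl a os) \<subseteq> {..<5}"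
    using set_tgl [of a os] Cons.prems by auto
  ultimately show ?case
    using fl_foldr by (simp add: foldr_tgl)
qed simp

lemma pos_append: "pos (u @ v) = foldr fl u (pos v)"
  by (induction u) auto

lemma pos_fold_tgl: "set u \<subseteq> {..<5} \<Longrightarrow> pos (u @ v) = foldr fl (fold tgl u []) (pos v)"
  by (simp add: pos_append foldr_fold_tgl)

lemma chk_iff:
  "chk j od v \<longleftrightarrow> (\<forall>i<length v. fold tgl (take (Suc i) v) od \<noteq> [] \<and>
     (j + i < 3 \<or> tl (fold tgl (take (Suc i) v) od) \<noteq> []))"
proof (induction v arbitrary: j od)
  case (Cons a v)
  show ?case
    unfolding length_Cons All_less_Suc2 by (simp add: Let_def Cons)
qed simp

lemma nbwalk_take: "nbwalk S xs \<Longrightarrow> nbwalk S (take n xs)"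
proof (induction S xs arbitrary: n rule: nbwalk.induct)
  case (4 S x y z xs)
  show ?case
  proof (cases n)
    case (Suc m)
    then show ?thesis
      using 4(1) [of m] 4(2) by (cases m; cases "m - 1") auto
  qed simp
qed (auto simp: take_Cons split: nat.splits)

lemma nbwalk_poss:
  assumes g: "frame g"
  shows "set w \<subseteq> {..<5} \<Longrightarrow> distinct_adj w \<Longrightarrow> phi c g ` set (poss w) \<subseteq> S \<Longrightarrow> nbwalk S (map (phi c g) (poss w))"
proof (induction w)
  case (Cons a w)
  have *: "adj (phi c g (pos (a # w))) (phi c g (pos w))"
    using adj_sym [OF adj_phi_fl [OF g, of a "pos w" c]] pos_unit_cube [of w] Cons.prems by simp
  show ?case
  proof (cases w)
    case Nil
    then show ?thesis using * Cons.prems by auto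
  next
    case w: (Cons b v)
    have "fl a (fl b (pos v)) \<noteq> pos v"
    proof
      assume "fl a (fl b (pos v)) = pos v"
      then have "fl b (pos v) = fl a (pos v)"
        using Cons.prems w by (metis fl_fl insert_subset lessThan_iff list.simps(15))
      then have "a = b"
        using fl_inj [of b a "pos v"] pos_unit_cube [of v] Cons.prems w by auto
      then show False using Cons.prems w by simp
    qed
    then have "phi c g (fl a (fl b (pos v))) \<noteq> phi c g (pos v)"
      using phi_inj [OF g] by blast
    then have "phi c g (pos (a # w)) \<noteq> phi c g (pos v)"
      by (simp add: w)
    moreover obtain qs where "poss v = pos v # qs"
      using poss_hd by blast
    ultimately show ?thesis
      using Cons * w by (auto simp: distinct_adj_Cons)
  qed
qed auto

text \<open>The pruning loses no walk inside \<open>S\<close>: a failed test would exhibit a return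
  or an adjacency that closes a cycle of length at most 10.\<close>

lemma chk_walk:
  assumes S: "no_short S" and g: "frame g" and w: "set w \<subseteq> {..<5}" "distinct_adj w"
    and K: "phi c g ` set (poss w) \<subseteq> S"
  shows "chk 1 [] (take 10 w)"
  unfolding chk_iff
proof (intro allI impI)
  fix i assume i: "i < length (take 10 w)"
  define u where "u = take (Suc i) w"
  let ?od = "fold tgl u []"
  have i': "i < 10" "i < length w"
    using i by auto
  have t: "take (Suc i) (take 10 w) = u" and lu: "length u = Suc i"
    using i' by (simp_all add: u_def min_absorb1)
  have u5: "set u \<subseteq> {..<5}"
    using w(1) set_take_subset unfolding u_def by fastforce
  have wu: "w = u @ drop (Suc i) w"
    by (simp add: u_def)
  define xs where "xs = map (phi c g) (take (Suc (Suc i)) (poss w))"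
  have nb: "nbwalk S xs"
    using nbwalk_take [OF nbwalk_poss [OF g w K]] by (simp add: xs_def take_map)
  have len: "length xs = Suc (Suc i)"
    using i by (auto simp: xs_def)
  then have ne: "xs \<noteq> []"
    by auto
  have dist: "distinct xs"
    by (rule no_shortD [OF S nb]) (use i len in auto)
  have hd: "hd xs = phi c g (pos w)"
    using poss_hd [of w] by (auto simp: xs_def)
  have "last xs = xs ! Suc i"
    using last_conv_nth [OF ne] len by simp
  then have last: "last xs = phi c g (pos (drop (Suc i) w))"
    using i poss_nth [of "Suc i" w] by (simp add: xs_def)
  have pw: "pos w = foldr fl ?od (pos (drop (Suc i) w))"
    using pos_fold_tgl [OF u5, of "drop (Suc i) w"] wu by simp
  have "?od \<noteq> []"
  proof
    assume "?od = []"
    then have "hd xs = last xs"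
      using hd last pw by simp
    with dist len show False by (cases xs) (auto split: if_splits)
  qed
  moreover have "tl ?od \<noteq> []" if "\<not> 1 + i < 3"
  proof
    assume "tl ?od = []"
    with \<open>?od \<noteq> []\<close> obtain b where b: "?od = [b]"
      by (cases ?od) auto
    have "set (fold tgl u os) \<subseteq> set u \<union> set os" for os
    proof (induction u arbitrary: os)
      case (Cons a u)
      then show ?case using Cons [of "tgl a os"] set_tgl [of a os] by auto
    qed simp
    from this [of "[]"] have "b < 5"
      using b u5 by auto
    moreover have "drop (Suc i) w \<in> lists {..<5}"
      using w(1) set_drop_subset by fastforce
    ultimately have a: "adj (last xs) (hd xs)"
      using hd last pw b adj_phi_fl [OF g, of b "pos (drop (Suc i) w)" c] pos_unit_cube
      by (auto simp: lists_eq_set)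
    have "3 \<le> length xs" using that len by simp
    moreover have "length xs \<le> 10"
    proof (rule ccontr)
      assume "\<not> length xs \<le> 10"
      \<comment> \<open>The points are 10 flips apart, just beyond the reach of
        \<open>no_short_closing\<close>. Parity decides: after an even number of flips two points
        cannot differ in exactly one coordinate.\<close>
      then have "i = 9" using len i by simp
      have par: "even (length (tgl a os)) \<longleftrightarrow> odd (length os)" for a os
        by (induction os) auto
      have "even (length (fold tgl u os)) \<longleftrightarrow> even (length u + length os)" for os
        by (induction u arbitrary: os) (auto simp: par)
      from this [of "[]"] show False
        using b lu \<open>i = 9\<close> by simp
    qed
    ultimately show False
      using no_short_closing [OF S nb] a by blast
  qed
  ultimately show "fold tgl (take (Suc i) (take 10 w)) [] \<noteq> [] \<and>
      (1 + i < 3 \<or> tl (fold tgl (take (Suc i) (take 10 w)) []) \<noteq> [])"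
    unfolding t by blast
qed

text \<open>A frame is a function on \<open>nat\<close> that matters only below 5, so two
  descriptions of the same frame may differ as functions.\<close>

lemma framed_cong:
  assumes h: "framed z c h" and e: "\<And>k. k < 5 \<Longrightarrow> h k = h' k"
  shows "framed z c h'"
proof -
  have "phi c h p = phi c h' p" for p
    unfolding phi_def using e by (simp cong: sum.cong_simp)
  then have "phi c h = phi c h'" by (rule ext)
  moreover have "frame h'"
  proof -
    obtain \<pi> \<epsilon> where "bij_betw \<pi> {..<5} (UNIV :: 5 set)"
      and "\<forall>k<5. (\<epsilon> k = 1 \<or> \<epsilon> k = - 1) \<and> h k = axis (\<pi> k) (\<epsilon> k)"
      using h unfolding framed_def frame_def by blast
    with e show ?thesis
      unfolding frame_def by (intro exI [of _ \<pi>] exI [of _ \<epsilon>] conjI) simp_all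
  qed
  ultimately show ?thesis
    using h by (simp add: framed_def)
qed

lemma search_sound:
  assumes S: "no_short S" and K: "two_core K" "K \<subseteq> S \<inter> cube z"
  shows "framed z c g \<Longrightarrow> set w \<subseteq> {..<m} \<Longrightarrow> m \<le> 5 \<Longrightarrow> distinct_adj w \<Longrightarrow> phi c g ` set (poss w) \<subseteq> K
    \<Longrightarrow> \<exists>g' w'. framed z c g' \<and> w' \<in> set (search n w m) \<and> phi c g' ` set (poss w') \<subseteq> K"
proof (induction n arbitrary: g w m)
  case 0
  then show ?case by auto
next
  case (Suc n)
  show ?case
  proof (cases "11 \<le> length w \<and> length (fold tgl w []) = 1")
    case True
    with Suc.prems show ?thesis by auto
  next
    case False
    have w5: "set w \<subseteq> {..<5}"
      using Suc.prems by auto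
    have pu: "pos w \<in> set unit_cube"
      by (rule pos_unit_cube [OF w5])
    have pK: "phi c g (pos w) \<in> K"
      using Suc.prems(5) poss_hd [of w] by auto
    obtain a where a: "a < 5" "phi c g (fl a (pos w)) \<in> K" "w = [] \<or> a \<noteq> hd w"
      using two_core_next [OF Suc.prems(1) K(1) _ pu pK] K(2) by auto
    \<comment> \<open>A coordinate below \<open>m\<close> is kept; a new one is renamed to
      \<open>m\<close>, the only new coordinate that \<open>search\<close> tries.\<close>
    define b where "b = min a m"
    define \<tau> where "\<tau> = (\<lambda>j. if j = a then b else if j = b then a else j)"
    define g' where "g' = g \<circ> \<tau>"
    have b5: "b < 5" and bm: "b < Suc m"
      using a by (auto simp: b_def)
    have \<tau>\<tau>: "\<tau> (\<tau> j) = j" for j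
      by (simp add: \<tau>_def)
    have \<tau>5: "bij_betw \<tau> {..<5} {..<5}"
      by (rule bij_betw_byWitness [where f' = \<tau>]) (use a(1) b5 \<tau>\<tau> in \<open>auto simp: \<tau>_def\<close>)
    have o: "(0, 0, 0, 0, 0) \<in> set unit_cube"
      by (simp add: mem_unit_cube)
    have co: "coord (0, 0, 0, 0, 0) j = 0" if "j < 5" for j
      using that by (auto simp: less5)
    have \<tau>l: "\<tau> j < 5" if "j < 5" for j
      using that a(1) b5 by (simp add: \<tau>_def)
    have ph: "phi c g' x = phi c g (mk (\<lambda>j. coord x (\<tau> j)))" for x
    proof -
      have "(\<Sum>k<5. of_int (coord x k) * g (\<tau> k)) = (\<Sum>j<5. of_int (coord x (\<tau> j)) * g (\<tau> (\<tau> j)))"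
        by (rule sum.reindex_bij_betw [OF \<tau>5, symmetric])
      also have "\<dots> = (\<Sum>j<5. of_int (coord (mk (\<lambda>j. coord x (\<tau> j))) j) * g j)"
        by (rule sum.cong) (simp_all add: \<tau>\<tau>)
      finally show ?thesis
        by (simp add: phi_def g'_def)
    qed
    have fr: "framed z c g'"
    proof -
      have "phi c g (0, 0, 0, 0, 0) = c"
        by (simp add: phi_def co)
      moreover have "(\<lambda>k. of_int (1 - 2 * coord (0, 0, 0, 0, 0) (\<tau> k)) * g (\<tau> k)) k = g' k" if "k < 5" for k
        using co [OF \<tau>l [OF that]] by (simp add: g'_def)
      ultimately show ?thesis
        using framed_cong [OF framed_remap [OF Suc.prems(1) o \<tau>5 \<tau>\<tau>]] by simp
    qed
    have same: "phi c g' (pos v) = phi c g (pos v)" if "set v \<subseteq> {..<m}" for v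
    proof -
      have "mk (\<lambda>j. coord (pos v) (\<tau> j)) = pos v"
      proof (rule point_eqI)
        fix j :: nat assume j: "j < 5"
        have "coord (pos v) a = 0 \<and> coord (pos v) b = 0 \<or> a = b"
        proof (cases "a < m")
          case False
          then have "a \<notin> set v" "b \<notin> set v" using that by (auto simp: b_def)
          moreover have "set v \<subseteq> {..<5}" using that Suc.prems(3) by auto
          ultimately show ?thesis
            using coord_pos_0 [of v a] coord_pos_0 [of v b] a(1) b5 by simp
        qed (simp add: b_def)
        then show "coord (mk (\<lambda>j. coord (pos v) (\<tau> j))) j = coord (pos v) j"
          using j by (auto simp: \<tau>_def)
      qed
      then show ?thesis by (simp add: ph)
    qed
    have new: "phi c g' (pos (b # w)) = phi c g (fl a (pos w))"
    proof -
      have "mk (\<lambda>j. coord (fl b (pos w)) (\<tau> j)) = fl a (pos w)"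
      proof (rule point_eqI)
        fix j :: nat assume j: "j < 5"
        have z: "coord (pos w) a = 0 \<and> coord (pos w) b = 0 \<or> a = b"
        proof (cases "a < m")
          case False
          then have "a \<notin> set w" "b \<notin> set w" using Suc.prems(2) by (auto simp: b_def)
          then show ?thesis
            using coord_pos_0 [OF w5, of a] coord_pos_0 [OF w5, of b] a(1) b5 by simp
        qed (simp add: b_def)
        show "coord (mk (\<lambda>j. coord (fl b (pos w)) (\<tau> j))) j = coord (fl a (pos w)) j"
          using j z a(1) b5 \<tau>l [OF j] by (auto simp: coord_fl \<tau>_def)
      qed
      then show ?thesis by (simp add: ph)
    qed
    have "phi c g' ` set (poss w) = phi c g ` set (poss w)"
    proof (rule image_cong [OF refl])
      fix p assume "p \<in> set (poss w)"
      then obtain i where "p = pos (drop i w)" by (auto simp: set_poss)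
      then show "phi c g' p = phi c g p"
        using same [of "drop i w"] Suc.prems(2) set_drop_subset [of i w] by auto
    qed
    then have sub: "phi c g' ` set (poss (b # w)) \<subseteq> K"
      using new a(2) Suc.prems(5) by auto
    have bh: "w = [] \<or> b \<noteq> hd w"
    proof (cases "a < m")
      case False
      then show ?thesis using Suc.prems(2) by (cases w) (auto simp: b_def)
    qed (use a(3) in \<open>simp add: b_def\<close>)
    have da: "distinct_adj (b # w)"
      using bh Suc.prems(4) by (cases w) auto
    have bw5: "set (b # w) \<subseteq> {..<5}"
      using b5 w5 by auto
    have ck: "chk 1 [] (take 10 (b # w))"
      by (rule chk_walk [OF S _ bw5 da]) (use fr sub K(2) in \<open>auto simp: framed_def\<close>)
    have "\<exists>g'' w'. framed z c g'' \<and> w' \<in> set (search n (b # w) (max m (Suc b))) \<and> phi c g'' ` set (poss w') \<subseteq> K"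
      by (rule Suc.IH [OF fr _ _ da sub]) (use Suc.prems(2,3) b5 in auto)
    moreover have "b \<in> set [0..<min (Suc m) 5]"
      unfolding set_upt atLeastLessThan_iff min_less_iff_conj using b5 bm by (intro conjI) (rule le0)
    ultimately show ?thesis
      using False bh ck by (fastforce simp del: chk.simps)
  qed
qed

definition coils :: "point list list" where
  "coils = [coil0, coil1, coil2, coil3, coil4, coil5, coil6, coil7]"

definition table :: "(point \<times> nat list \<times> nat) list" where
 "table = [((0,0,0,1,0),[0,1,2,3,4],4),
 ((0,1,0,1,0),[0,1,3,4,2],6),
 ((0,1,1,1,1),[0,1,3,2,4],2),
 ((1,1,0,1,0),[0,3,1,4,2],3),
 ((0,0,0,1,0),[0,3,1,2,4],1),
 ((1,0,0,1,0),[0,1,3,2,4],4),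
 ((0,0,1,0,0),[0,1,4,3,2],0),
 ((0,1,0,1,0),[0,1,3,4,2],7),
 ((0,0,0,1,0),[1,0,2,3,4],6),
 ((0,0,0,1,0),[0,3,1,2,4],7),
 ((0,1,0,0,1),[0,3,1,2,4],6),
 ((0,1,0,0,1),[1,2,0,3,4],6),
 ((1,1,1,0,1),[0,3,1,4,2],4),
 ((1,1,0,0,1),[3,4,0,1,2],1),
 ((1,1,0,0,1),[3,4,0,1,2],1),
 ((1,1,0,1,0),[1,2,0,4,3],0),
 ((0,1,1,0,1),[1,3,0,2,4],3),
 ((0,0,0,1,0),[0,3,1,2,4],5),
 ((0,0,0,1,0),[1,2,0,3,4],1),
 ((0,1,0,0,1),[3,1,0,4,2],2),
 ((0,0,0,0,0),[4,1,0,3,2],3),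
 ((0,0,0,1,0),[1,0,2,4,3],5),
 ((1,0,1,1,0),[0,1,2,3,4],3),
 ((0,0,1,0,0),[0,1,4,3,2],1),
 ((0,1,0,0,1),[0,4,3,1,2],3),
 ((0,1,0,1,0),[0,3,4,1,2],2),
 ((0,1,1,0,1),[0,2,1,4,3],4),
 ((1,1,0,1,0),[0,1,3,4,2],4),
 ((0,1,1,1,1),[0,1,4,2,3],0),
 ((0,1,0,1,0),[0,3,1,4,2],1),
 ((1,1,1,0,1),[3,1,4,0,2],6),
 ((0,1,0,1,0),[4,0,2,1,3],7),
 ((0,1,1,1,1),[0,1,4,3,2],0),
 ((0,0,0,1,0),[0,3,1,2,4],6),
 ((0,0,1,1,0),[0,2,1,4,3],4),
 ((1,0,0,1,0),[0,4,1,2,3],7),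
 ((1,0,0,1,0),[1,4,0,3,2],6),
 ((0,0,0,1,0),[0,4,1,2,3],4),
 ((1,1,0,1,1),[3,1,0,4,2],2),
 ((1,0,0,1,0),[3,1,0,4,2],3),
 ((0,1,1,0,1),[1,4,0,2,3],3),
 ((0,0,0,1,0),[0,4,1,2,3],5),
 ((0,0,0,1,0),[3,2,0,1,4],1),
 ((0,1,0,0,0),[1,3,0,4,2],1),
 ((0,1,0,0,0),[1,3,0,4,2],1),
 ((1,1,1,0,1),[3,4,0,1,2],4),
 ((1,1,0,0,1),[2,3,1,0,4],4),
 ((1,1,0,1,1),[3,2,0,1,4],6),
 ((0,1,0,0,0),[1,3,0,4,2],0),
 ((1,1,0,0,1),[1,4,0,3,2],6),
 ((1,0,1,1,0),[0,2,1,4,3],7),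
 ((0,0,1,1,0),[0,2,1,3,4],6),
 ((1,0,1,0,0),[0,4,3,1,2],4),
 ((1,1,1,0,1),[1,3,2,0,4],0),
 ((1,0,1,0,0),[3,2,4,0,1],1),
 ((1,0,1,0,0),[3,2,4,0,1],1),
 ((1,0,0,1,0),[3,0,1,4,2],1),
 ((1,0,1,1,1),[1,0,4,2,3],0),
 ((1,0,0,1,0),[3,0,1,4,2],1),
 ((0,1,0,1,0),[3,0,1,2,4],3),
 ((0,0,1,0,0),[1,0,3,4,2],2),
 ((1,0,1,1,1),[3,1,2,0,4],4),
 ((0,0,1,1,0),[3,1,0,2,4],5),
 ((0,0,1,1,0),[2,0,1,3,4],1),
 ((0,0,1,0,0),[1,0,4,3,2],3),
 ((0,0,1,1,0),[3,0,2,1,4],4),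
 ((0,0,1,1,0),[2,0,1,3,4],7),
 ((1,0,0,0,1),[4,1,0,2,3],6),
 ((1,0,0,0,1),[3,1,0,2,4],4),
 ((1,0,1,0,1),[2,0,1,3,4],6),
 ((1,0,0,0,1),[4,0,3,1,2],1),
 ((1,1,0,0,1),[3,1,0,4,2],4),
 ((1,0,0,1,0),[1,0,2,3,4],0),
 ((0,0,1,0,0),[4,0,3,1,2],7),
 ((0,0,1,0,0),[4,0,3,1,2],6),
 ((1,1,1,0,1),[1,3,4,0,2],0),
 ((0,0,1,0,0),[4,1,2,0,3],6),
 ((0,1,1,1,0),[2,0,3,1,4],4),
 ((0,1,1,0,0),[2,3,4,0,1],1),
 ((0,1,1,0,0),[2,1,4,0,3],6),
 ((1,1,1,0,1),[2,0,1,3,4],4),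
 ((1,0,0,0,1),[4,0,3,1,2],6),
 ((0,1,1,0,0),[2,1,4,0,3],7),
 ((1,0,0,1,1),[4,2,0,1,3],1),
 ((0,0,1,1,0),[0,2,1,4,3],5),
 ((0,1,0,1,0),[1,2,0,3,4],3),
 ((1,1,0,0,1),[1,4,0,3,2],0),
 ((0,1,0,0,0),[3,4,0,1,2],4),
 ((0,1,0,0,0),[2,4,0,3,1],1),
 ((0,1,0,1,1),[2,4,0,1,3],1),
 ((1,0,1,0,1),[4,3,0,1,2],3),
 ((1,0,0,1,0),[1,2,0,3,4],2)]"

text \<open>
  For each walk found by the search: the point and the permutation of coordinates that map a coil
  into the walk, and the index of that coil.
\<close>

definition entry_ok :: "nat list \<Rightarrow> point \<times> nat list \<times> nat \<Rightarrow> bool" where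
  "entry_ok w = (\<lambda>(b, t, i). i < 8 \<and> length t = 5 \<and> distinct t \<and> list_all (\<lambda>k. k < 5) t \<and>
     List.member unit_cube b \<and> (let ps = poss w in list_all (\<lambda>x. List.member ps (remap b ((!) t) x)) (coils ! i)))"

text \<open>The fuel 14 needs no argument of its own: the check shows that every walk returned,
  closed or not, contains an image of a coil among its points.\<close>

lemma table_ok: "list_all2 entry_ok (search 14 [] 0) table"
  by code_simp

lemma ex_frame:
  assumes v: "v \<in> cube z"
  shows "\<exists>g. framed z v g"
proof -
  obtain \<pi> :: "nat \<Rightarrow> 5" where \<pi>: "bij_betw \<pi> {..<5} UNIV"
    using ex_bij_betw_nat_finite [of "UNIV :: 5 set"] by (auto simp: atLeast0LessThan)
  \<comment> \<open>Each axis is directed from \<open>v\<close> towards the other value that the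
    cube allows.\<close>
  define \<epsilon> :: "nat \<Rightarrow> int" where "\<epsilon> k = (if v $ \<pi> k = z $ \<pi> k then 1 else - 1)" for k
  define g where "g k = axis (\<pi> k) (\<epsilon> k)" for k
  have \<epsilon>: "\<forall>k<5. (\<epsilon> k = 1 \<or> \<epsilon> k = - 1) \<and> g k = axis (\<pi> k) (\<epsilon> k)"
    by (simp add: \<epsilon>_def g_def)
  then have "frame g"
    using \<pi> unfolding frame_def by (intro exI [of _ \<pi>] exI [of _ \<epsilon>] conjI)
  have vk: "v $ i = z $ i \<or> v $ i = z $ i + 1" for i
    using v by (simp add: cube_def)
  have onto: "\<exists>k<5. i = \<pi> k" for i
    using \<pi> unfolding bij_betw_def by (metis UNIV_I imageE lessThan_iff)
  have "phi v g ` set unit_cube = cube z"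
  proof (intro equalityI subsetI)
    fix y assume "y \<in> phi v g ` set unit_cube"
    then obtain p where p: "p \<in> set unit_cube" "y = phi v g p" by blast
    have "y $ i = z $ i \<or> y $ i = z $ i + 1" for i
    proof -
      obtain k where k: "k < 5" "i = \<pi> k" using onto by blast
      have "coord p k = 0 \<or> coord p k = 1" using p(1) k(1) by (simp add: unit_cube_iff)
      then show ?thesis
        using phi_nth [OF \<pi> \<epsilon> k(1), of v p] vk [of i] k(2) p(2) by (auto simp: \<epsilon>_def)
    qed
    then show "y \<in> cube z" by (simp add: cube_def)
  next
    fix y assume y: "y \<in> cube z"
    let ?p = "mk (\<lambda>k. \<bar>y $ \<pi> k - v $ \<pi> k\<bar>)"
    have yi: "y $ i = z $ i \<or> y $ i = z $ i + 1" for i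
      using y by (simp add: cube_def)
    have "?p \<in> set unit_cube"
      unfolding unit_cube_iff
    proof (intro allI impI)
      fix k :: nat assume "k < 5"
      then show "coord ?p k = 0 \<or> coord ?p k = 1"
        using yi [of "\<pi> k"] vk [of "\<pi> k"] by auto
    qed
    moreover have "y = phi v g ?p"
      unfolding vec_eq_iff
    proof
      fix i
      obtain k where k: "k < 5" "i = \<pi> k" using onto by blast
      show "y $ i = phi v g ?p $ i"
        unfolding k(2) phi_nth [OF \<pi> \<epsilon> k(1)] coord_mk [OF k(1)]
        using yi [of "\<pi> k"] vk [of "\<pi> k"] by (auto simp: \<epsilon>_def)
    qed
    ultimately show "y \<in> phi v g ` set unit_cube" by (rule image_eqI [rotated])
  qed
  with \<open>frame g\<close> show ?thesis
    by (auto simp: framed_def)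
qed

text \<open>The search is started with the empty walk at an arbitrary point of \<open>K\<close>,
  taken as origin. The symmetry recorded in the table then goes into the frame, by
  \<open>phi_remap\<close>.\<close>

lemma coil_in_core:
  assumes S: "no_short S" and K: "two_core K" "K \<subseteq> S \<inter> cube z"
  shows "\<exists>c g. \<exists>i<8. framed z c g \<and> phi c g ` set (coils ! i) \<subseteq> K"
proof -
  obtain c where c: "c \<in> K" using K(1) by (auto simp: two_core_def)
  then obtain g where g: "framed z c g" using ex_frame K(2) by blast
  have "phi c g (0, 0, 0, 0, 0) = c"
    by (simp add: phi_def sum5)
  then have "\<exists>g' w'. framed z c g' \<and> w' \<in> set (search 14 [] 0) \<and> phi c g' ` set (poss w') \<subseteq> K"
    using c by (intro search_sound [OF S K g]) auto
  then obtain g' w where g': "framed z c g'" and w: "w \<in> set (search 14 [] 0)" and wK: "phi c g' ` set (poss w) \<subseteq> K"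
    by blast
  obtain b t i where e: "entry_ok w (b, t, i)"
    using w table_ok unfolding list_all2_conv_all_nth in_set_conv_nth by (metis prod_cases3)
  then have i: "i < 8" and t: "length t = 5" "distinct t" "\<forall>k\<in>set t. k < 5" and b: "b \<in> set unit_cube"
    and r: "\<forall>x\<in>set (coils ! i). remap b ((!) t) x \<in> set (poss w)"
    by (auto simp: entry_ok_def list_all_iff Let_def)
  have "card (set t) = card {..<5::nat}" using distinct_card [OF t(2)] t(1) by simp
  then have st: "set t = {..<5}" using t(3) by (intro card_subset_eq) auto
  have \<tau>: "bij_betw ((!) t) {..<5} {..<5}"
    by (rule bij_betw_nth) (use t st in auto)
  define \<sigma> where "\<sigma> = inv_into {..<5} ((!) t)"
  have \<sigma>: "\<sigma> (t ! j) = j" if "j < 5" for j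
    unfolding \<sigma>_def using inv_into_f_f [of "(!) t" "{..<5}" j] \<tau> that by (simp add: bij_betw_def)
  let ?g = "\<lambda>k. of_int (1 - 2 * coord b (\<sigma> k)) * g' (\<sigma> k)"
  have "phi (phi c g' b) ?g ` set (coils ! i) \<subseteq> K"
    using phi_remap [OF \<tau> \<sigma>, of c g' b] r wK by (auto simp: image_subset_iff)
  moreover have "framed z (phi c g' b) ?g"
    by (rule framed_remap [OF g' b \<tau> \<sigma>])
  ultimately show ?thesis using i by blast
qed

section \<open>Cores of neighbouring cubes\<close>

definition has_core :: "(int ^ 'n::finite) set \<Rightarrow> int ^ 'n \<Rightarrow> bool" where
  "has_core S z \<longleftrightarrow> (\<exists>K. two_core K \<and> K \<subseteq> S \<inter> cube z)"

lemma nbwalk_mono: "nbwalk K xs \<Longrightarrow> K \<subseteq> S \<Longrightarrow> nbwalk S xs"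
  by (induction K xs rule: nbwalk.induct) auto

lemma no_short_mono: "no_short S \<Longrightarrow> K \<subseteq> S \<Longrightarrow> no_short K"
  unfolding no_short_def using nbwalk_mono by blast

lemma cube_shift: "cube (z + v) = (\<lambda>x. x + v) ` cube z"
proof (intro equalityI subsetI)
  fix y assume "y \<in> cube (z + v)"
  then have "y - v \<in> cube z"
    by (simp add: cube_def algebra_simps)
  then show "y \<in> (\<lambda>x. x + v) ` cube z"
    by (intro image_eqI [of _ _ "y - v"]) simp_all
qed (auto simp: cube_def)

lemma framed_shift: "framed z c g \<Longrightarrow> framed (z + v) (c + v) g"
proof -
  assume z: "framed z c g"
  have "phi (c + v) g ` set unit_cube = (\<lambda>x. x + v) ` (phi c g ` set unit_cube)"
    unfolding image_image by (rule image_cong) (simp_all add: phi_def algebra_simps)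
  with z show ?thesis
    by (simp add: framed_def cube_shift)
qed

text \<open>The neighbouring cube has the same axes and an origin moved by one step, so its points
  are the \<open>go d p\<close> in the coordinates of the first cube. This is the form in which the
  blocking lemmas take their cores.\<close>

lemma neighbour_core:
  assumes z: "framed z c g" and h: "has_core S (z + vstep g d)"
  shows "\<exists>k. core k \<and> (\<forall>p. k p \<longrightarrow> phi c g (go d p) \<in> S)"
proof -
  obtain K where K: "two_core K" "K \<subseteq> S \<inter> cube (z + vstep g d)"
    using h by (auto simp: has_core_def)
  have "core (\<lambda>p. phi (c + vstep g d) g p \<in> K)"
    by (rule core_phi [OF framed_shift [OF z] K(1)]) (use K(2) in blast)
  moreover have "phi (c + vstep g d) g p = phi c g (go d p)" for p
    unfolding phi_go by (simp add: phi_def)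
  ultimately show ?thesis
    using K(2) by (intro exI [of _ "\<lambda>p. phi (c + vstep g d) g p \<in> K"]) auto
qed

text \<open>Wherever the coil has an edge along an axis, the adjacent cubes on both sides along that
  axis contain points of it and so are nonempty. If all nonempty neighbours had cores, the blocking
  lemma of the coil would apply.\<close>

lemma neighbour_without_core:
  fixes S :: "(int ^ 5) set"
  assumes S: "no_short S" and h: "has_core S z"
  shows "\<exists>z'. adj z z' \<and> \<not> has_core S z' \<and> S \<inter> cube z' \<noteq> {}"
proof (rule ccontr)
  assume n: "\<not> ?thesis"
  obtain K where K: "two_core K" "K \<subseteq> S \<inter> cube z"
    using h by (auto simp: has_core_def)
  obtain c g i where i: "i < 8" and z: "framed z c g" and c: "phi c g ` set (coils ! i) \<subseteq> K"
    using coil_in_core [OF S K] by blast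
  define s where "s = (\<lambda>p. phi c g p \<in> S)"
  have g: "frame g" using z by (simp add: framed_def)
  have sp: "sparse s"
    unfolding s_def by (rule sparse_phi [OF S g])
  have cs: "list_all s (coils ! i)"
    using c K(2) by (auto simp: list_all_iff s_def)
  \<comment> \<open>If the step \<open>d\<close> leads from some point of the cube into
    \<open>s\<close>, the neighbour on that side meets \<open>S\<close>; by the assumption to be
    refuted it then has a core.\<close>
  have nb: "\<exists>k. core k \<and> (\<forall>p. k p \<longrightarrow> s (go d p))" if "s (go d y)" "y \<in> set unit_cube" for d y
  proof -
    have "phi c g (go d y) \<in> cube (z + vstep g d)"
      unfolding phi_go cube_shift using z that(2) by (auto simp: framed_def)
    then have "S \<inter> cube (z + vstep g d) \<noteq> {}"
      using that(1) by (auto simp: s_def)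
    then have "has_core S (z + vstep g d)"
      using n adj_vstep [OF g] by blast
    then show ?thesis
      using neighbour_core [OF z] by (simp add: s_def)
  qed
  consider "i = 0" | "i = 1" | "i = 2" | "i = 3" | "i = 4" | "i = 5" | "i = 6" | "i = 7"
    using i by linarith
  then show False
  proof cases
    case 1
    then have ci: "list_all s coil0"
      using cs by (simp add: coils_def)
    \<comment> \<open>Both ends of this step are on the coil, so it witnesses that the neighbour in
      direction \<open>U0\<close> is nonempty. The witnesses in the other cases are edges of their
      coils as well.\<close>
    have "s (go U0 (0,0,1,0,0))"
      using ci by (simp add: coil0_def)
    then obtain k0 where k0: "core k0" "\<And>p. k0 p \<Longrightarrow> s (go U0 p)"
      using nb [of U0 "(0,0,1,0,0)"] by (auto simp: mem_unit_cube)
    have "s (go D0 (1,0,0,0,1))"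
      using ci by (simp add: coil0_def)
    then obtain k1 where k1: "core k1" "\<And>p. k1 p \<Longrightarrow> s (go D0 p)"
      using nb [of D0 "(1,0,0,0,1)"] by (auto simp: mem_unit_cube)
    show False
      by (rule coil0_blocked [OF sp ci k0(1) k0(2) [of "(a, b, c, d, e)" for a b c d e, unfolded go.simps] k1(1) k1(2) [of "(a, b, c, d, e)" for a b c d e, unfolded go.simps]])
  next
    case 2
    then have ci: "list_all s coil1"
      using cs by (simp add: coils_def)
    have "s (go U0 (0,0,1,0,0))"
      using ci by (simp add: coil1_def)
    then obtain k0 where k0: "core k0" "\<And>p. k0 p \<Longrightarrow> s (go U0 p)"
      using nb [of U0 "(0,0,1,0,0)"] by (auto simp: mem_unit_cube)
    have "s (go D0 (1,0,0,0,1))"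
      using ci by (simp add: coil1_def)
    then obtain k1 where k1: "core k1" "\<And>p. k1 p \<Longrightarrow> s (go D0 p)"
      using nb [of D0 "(1,0,0,0,1)"] by (auto simp: mem_unit_cube)
    show False
      by (rule coil1_blocked [OF sp ci k0(1) k0(2) [of "(a, b, c, d, e)" for a b c d e, unfolded go.simps] k1(1) k1(2) [of "(a, b, c, d, e)" for a b c d e, unfolded go.simps]])
  next
    case 3
    then have ci: "list_all s coil2"
      using cs by (simp add: coils_def)
    have "s (go U0 (0,0,1,0,1))"
      using ci by (simp add: coil2_def)
    then obtain k0 where k0: "core k0" "\<And>p. k0 p \<Longrightarrow> s (go U0 p)"
      using nb [of U0 "(0,0,1,0,1)"] by (auto simp: mem_unit_cube)
    show False
      by (rule coil2_blocked [OF sp ci k0(1) k0(2) [of "(a, b, c, d, e)" for a b c d e, unfolded go.simps]])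
  next
    case 4
    then have ci: "list_all s coil3"
      using cs by (simp add: coils_def)
    have "s (go U0 (0,0,1,0,1))"
      using ci by (simp add: coil3_def)
    then obtain k0 where k0: "core k0" "\<And>p. k0 p \<Longrightarrow> s (go U0 p)"
      using nb [of U0 "(0,0,1,0,1)"] by (auto simp: mem_unit_cube)
    show False
      by (rule coil3_blocked [OF sp ci k0(1) k0(2) [of "(a, b, c, d, e)" for a b c d e, unfolded go.simps]])
  next
    case 5
    then have ci: "list_all s coil4"
      using cs by (simp add: coils_def)
    have "s (go U0 (0,0,0,1,0))"
      using ci by (simp add: coil4_def)
    then obtain k0 where k0: "core k0" "\<And>p. k0 p \<Longrightarrow> s (go U0 p)"
      using nb [of U0 "(0,0,0,1,0)"] by (auto simp: mem_unit_cube)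
    have "s (go D1 (0,1,0,0,1))"
      using ci by (simp add: coil4_def)
    then obtain k1 where k1: "core k1" "\<And>p. k1 p \<Longrightarrow> s (go D1 p)"
      using nb [of D1 "(0,1,0,0,1)"] by (auto simp: mem_unit_cube)
    show False
      by (rule coil4_blocked [OF sp ci k0(1) k0(2) [of "(a, b, c, d, e)" for a b c d e, unfolded go.simps] k1(1) k1(2) [of "(a, b, c, d, e)" for a b c d e, unfolded go.simps]])
  next
    case 6
    then have ci: "list_all s coil5"
      using cs by (simp add: coils_def)
    have "s (go U1 (0,0,0,1,0))"
      using ci by (simp add: coil5_def)
    then obtain k0 where k0: "core k0" "\<And>p. k0 p \<Longrightarrow> s (go U1 p)"
      using nb [of U1 "(0,0,0,1,0)"] by (auto simp: mem_unit_cube)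
    have "s (go D1 (0,1,0,0,1))"
      using ci by (simp add: coil5_def)
    then obtain k1 where k1: "core k1" "\<And>p. k1 p \<Longrightarrow> s (go D1 p)"
      using nb [of D1 "(0,1,0,0,1)"] by (auto simp: mem_unit_cube)
    show False
      by (rule coil5_blocked [OF sp ci k0(1) k0(2) [of "(a, b, c, d, e)" for a b c d e, unfolded go.simps] k1(1) k1(2) [of "(a, b, c, d, e)" for a b c d e, unfolded go.simps]])
  next
    case 7
    then have ci: "list_all s coil6"
      using cs by (simp add: coils_def)
    have "s (go D1 (0,1,0,1,0))"
      using ci by (simp add: coil6_def)
    then obtain k0 where k0: "core k0" "\<And>p. k0 p \<Longrightarrow> s (go D1 p)"
      using nb [of D1 "(0,1,0,1,0)"] by (auto simp: mem_unit_cube)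
    show False
      by (rule coil6_blocked [OF sp ci k0(1) k0(2) [of "(a, b, c, d, e)" for a b c d e, unfolded go.simps]])
  next
    case 8
    then have ci: "list_all s coil7"
      using cs by (simp add: coils_def)
    have "s (go D0 (1,0,0,1,0))"
      using ci by (simp add: coil7_def)
    then obtain k0 where k0: "core k0" "\<And>p. k0 p \<Longrightarrow> s (go D0 p)"
      using nb [of D0 "(1,0,0,1,0)"] by (auto simp: mem_unit_cube)
    show False
      by (rule coil7_blocked [OF sp ci k0(1) k0(2) [of "(a, b, c, d, e)" for a b c d e, unfolded go.simps]])
  qed
qed

lemma coil_degree:
  "list_all (\<lambda>C. list_all (\<lambda>p. length (filter (List.member C) (flips p)) \<le> 2) C) coils"
  by code_simp

text \<open>\<open>K\<close> contains a coil and therefore coincides with it, and the coils are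
  induced cycles. The sparseness used is that of \<open>K\<close> itself, so the rest of
  \<open>S\<close> in the cube does not interfere.\<close>

lemma core_degree:
  fixes S :: "(int ^ 5) set"
  assumes S: "no_short S" and K: "two_core K" "K \<subseteq> S \<inter> cube z" and v: "v \<in> K"
  shows "card {u \<in> K. adj v u} \<le> 2"
proof -
  obtain c g i where i: "i < 8" and z: "framed z c g" and c: "phi c g ` set (coils ! i) \<subseteq> K"
    using coil_in_core [OF S K] by blast
  have g: "frame g" and im: "phi c g ` set unit_cube = cube z" using z by (simp_all add: framed_def)
  define k where "k = (\<lambda>p. phi c g p \<in> K)"
  have sp: "sparse k"
    unfolding k_def using sparse_phi [OF no_short_mono [OF S] g] K(2) by blast
  have cs: "list_all k (coils ! i)"
    using c by (auto simp: list_all_iff k_def)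
  have ck: "core k"
    unfolding k_def by (rule core_phi [OF z K(1)]) (use K(2) in blast)
  consider "i = 0" | "i = 1" | "i = 2" | "i = 3" | "i = 4" | "i = 5" | "i = 6" | "i = 7"
    using i by linarith
  then have "list_all (\<lambda>p. k p \<longrightarrow> p \<in> set (coils ! i)) unit_cube"
  proof cases
    case 1
    then have e: "coils ! i = coil0" by (simp add: coils_def)
    show ?thesis unfolding e by (rule core_coil0 [OF sp cs [unfolded e] ck])
  next
    case 2
    then have e: "coils ! i = coil1" by (simp add: coils_def)
    show ?thesis unfolding e by (rule core_coil1 [OF sp cs [unfolded e] ck])
  next
    case 3
    then have e: "coils ! i = coil2" by (simp add: coils_def)
    show ?thesis unfolding e by (rule core_coil2 [OF sp cs [unfolded e] ck])
  next
    case 4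
    then have e: "coils ! i = coil3" by (simp add: coils_def)
    show ?thesis unfolding e by (rule core_coil3 [OF sp cs [unfolded e] ck])
  next
    case 5
    then have e: "coils ! i = coil4" by (simp add: coils_def)
    show ?thesis unfolding e by (rule core_coil4 [OF sp cs [unfolded e] ck])
  next
    case 6
    then have e: "coils ! i = coil5" by (simp add: coils_def)
    show ?thesis unfolding e by (rule core_coil5 [OF sp cs [unfolded e] ck])
  next
    case 7
    then have e: "coils ! i = coil6" by (simp add: coils_def)
    show ?thesis unfolding e by (rule core_coil6 [OF sp cs [unfolded e] ck])
  next
    case 8
    then have e: "coils ! i = coil7" by (simp add: coils_def)
    show ?thesis unfolding e by (rule core_coil7 [OF sp cs [unfolded e] ck])
  qed
  then have only: "p \<in> set (coils ! i)" if "p \<in> set unit_cube" "phi c g p \<in> K" for p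
    using that by (simp add: list_all_iff k_def)
  obtain p where p: "p \<in> set unit_cube" "v = phi c g p"
    using v K(2) im by blast
  let ?ns = "filter (List.member (coils ! i)) (flips p)"
  have "{u \<in> K. adj v u} \<subseteq> phi c g ` set ?ns"
  proof
    fix u assume "u \<in> {u \<in> K. adj v u}"
    then have u: "u \<in> K" "adj v u" by auto
    then obtain q where q: "q \<in> set unit_cube" "u = phi c g q"
      using K(2) im by blast
    then obtain j where "j < 5" "q = fl j p"
      using adj_phiD [OF g p(1) q(1)] u(2) p(2) by blast
    then have "q \<in> set (flips p)"
      unfolding fl_def by (cases p) (auto simp: less5)
    with only [OF q(1)] u(1) q(2) show "u \<in> phi c g ` set ?ns"
      by (auto simp: List.member_iff)
  qed
  then have "card {u \<in> K. adj v u} \<le> card (phi c g ` set ?ns)"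
    by (intro card_mono) auto
  also have "\<dots> \<le> length ?ns"
    using card_image_le [of "set ?ns" "phi c g"] card_length [of ?ns] by simp
  also have "\<dots> \<le> 2"
  proof -
    have "p \<in> set (coils ! i)" using only p v by blast
    moreover have "coils ! i \<in> set coils"
      by (rule nth_mem) (use i in \<open>simp add: coils_def\<close>)
    ultimately show ?thesis
      using coil_degree by (auto simp: list_all_iff)
  qed
  finally show ?thesis .
qed

section \<open>Averaging over unit cubes\<close>

text \<open>Counts ordered pairs, hence twice the number of edges; this avoids halving in the
  averages.\<close>

definition edges :: "(int ^ 'n::finite) set \<Rightarrow> nat" where
  "edges T = (\<Sum>u\<in>T. card {v \<in> T. adj u v})"

lemma edges_remove:
  assumes T: "finite T" and v: "v \<in> T"
  shows "edges T = edges (T - {v}) + 2 * card {u \<in> T. adj v u}"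
proof -
  have 1: "card {w \<in> T. adj u w} = card {w \<in> T - {v}. adj u w} + (if adj v u then 1 else 0)"
    if u: "u \<in> T - {v}" for u
  proof -
    have "{w \<in> T. adj u w} = (if adj v u then insert v {w \<in> T - {v}. adj u w} else {w \<in> T - {v}. adj u w})"
      using v adj_sym [of u v] adj_sym [of v u] by auto
    then show ?thesis using T by auto
  qed
  have "(\<Sum>u\<in>T - {v}. if adj v u then 1 else 0) = card {u \<in> T - {v}. adj v u}"
    using T by (simp add: sum.If_cases Int_def)
  also have "{u \<in> T - {v}. adj v u} = {u \<in> T. adj v u}"
    by auto
  finally have 2: "(\<Sum>u\<in>T - {v}. if adj v u then 1 else 0) = card {u \<in> T. adj v u}" .
  have "edges T = card {u \<in> T. adj v u} + (\<Sum>u\<in>T - {v}. card {w \<in> T. adj u w})"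
    using T v by (simp add: edges_def sum.remove)
  also have "(\<Sum>u\<in>T - {v}. card {w \<in> T. adj u w}) =
      (\<Sum>u\<in>T - {v}. card {w \<in> T - {v}. adj u w} + (if adj v u then 1 else 0))"
    by (rule sum.cong [OF refl 1])
  finally show ?thesis
    unfolding sum.distrib 2 by (simp add: edges_def)
qed

lemma two_of_card:
  assumes "\<not> card A \<le> 1"
  shows "\<exists>u\<in>A. \<exists>w\<in>A. u \<noteq> w"
proof -
  have "finite A" using assms by (metis card.infinite zero_le)
  then show ?thesis
    using assms card_le_Suc0_iff_eq [of A] by auto
qed

text \<open>Vertices of degree at most 1 are stripped, each taking at most one edge with it. What
  resists stripping has minimal degree 2, and there the hypothesis bounds all degrees by 2. If no
  such part exists, the last vertex stripped takes no edge, which saves one edge, counted as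
  2.\<close>

lemma edges_bound:
  assumes "finite T" "\<And>K v. K \<subseteq> T \<Longrightarrow> two_core K \<Longrightarrow> v \<in> K \<Longrightarrow> card {u \<in> K. adj v u} \<le> 2"
  shows "edges T \<le> 2 * card T \<and> (T \<noteq> {} \<and> (\<forall>K\<subseteq>T. \<not> two_core K) \<longrightarrow> edges T + 2 \<le> 2 * card T)"
  using assms
proof (induction "card T" arbitrary: T rule: less_induct)
  case less
  show ?case
  proof (cases "\<exists>v\<in>T. card {u \<in> T. adj v u} \<le> 1")
    case True
    then obtain v where v: "v \<in> T" "card {u \<in> T. adj v u} \<le> 1" by blast
    have c: "card T = Suc (card (T - {v}))"
      by (rule card.remove [OF less.prems(1) v(1)])
    have IH: "edges (T - {v}) \<le> 2 * card (T - {v}) \<and> (T - {v} \<noteq> {} \<and> (\<forall>K\<subseteq>T - {v}. \<not> two_core K) \<longrightarrow>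
        edges (T - {v}) + 2 \<le> 2 * card (T - {v}))"
      by (rule less.hyps) (use c less.prems in auto)
    have e: "edges T = edges (T - {v}) + 2 * card {u \<in> T. adj v u}"
      by (rule edges_remove [OF less.prems(1) v(1)])
    have "edges T + 2 \<le> 2 * card T" if "\<forall>K\<subseteq>T. \<not> two_core K"
    proof (cases "T - {v} = {}")
      case True
      then have "{u \<in> T. adj v u} = {}" by auto
      then have "card {u \<in> T. adj v u} = 0" by (simp only: card.empty)
      moreover have "edges (T - {v}) = 0" unfolding True by (simp add: edges_def)
      ultimately show ?thesis using e c by linarith
    next
      case False
      then show ?thesis using IH that e c v(2) by auto
    qed
    then show ?thesis using IH e c v(2) by auto
  next
    case False
    show ?thesis
    proof (cases "T = {}")
      case ne: False
      have core: "two_core T"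
        unfolding two_core_def
      proof (intro conjI ballI)
        fix v assume "v \<in> T"
        then show "\<exists>u\<in>T. \<exists>w\<in>T. u \<noteq> w \<and> adj v u \<and> adj v w"
          using two_of_card [of "{u \<in> T. adj v u}"] False by blast
      qed (rule ne)
      then have "edges T \<le> (\<Sum>u\<in>T. 2)"
        unfolding edges_def using less.prems(2) [OF subset_refl] by (intro sum_mono) blast
      then show ?thesis using core by auto
    qed (simp add: edges_def)
  qed
qed

section \<open>Counting unit cubes and points in boxes\<close>

lemma card_vec_set:
  fixes A :: "'n::finite \<Rightarrow> int set"
  assumes "\<And>i. finite (A i)"
  shows "finite {x :: int ^ 'n. \<forall>i. x $ i \<in> A i}" "card {x :: int ^ 'n. \<forall>i. x $ i \<in> A i} = (\<Prod>i\<in>UNIV. card (A i))"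
proof -
  have b: "bij_betw vec_nth {x :: int ^ 'n. \<forall>i. x $ i \<in> A i} (PiE UNIV A)"
    by (rule bij_betw_byWitness [where f' = vec_lambda]) auto
  have "finite (PiE UNIV A)" using assms by (intro finite_PiE) auto
  then show "finite {x :: int ^ 'n. \<forall>i. x $ i \<in> A i}"
    using bij_betw_finite [OF b] by simp
  show "card {x :: int ^ 'n. \<forall>i. x $ i \<in> A i} = (\<Prod>i\<in>UNIV. card (A i))"
    using bij_betw_same_card [OF b] by (simp add: card_PiE)
qed

definition box :: "nat \<Rightarrow> (int ^ 'n::finite) set" where
  "box L = {x. \<forall>i. x $ i \<in> {- int L..int L}}"

lemma finite_box [simp]: "finite (box L)"
  unfolding box_def by (rule card_vec_set) simp

lemma card_box: "card (box L :: (int ^ 5) set) = (2 * L + 1) ^ 5"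
proof -
  have "card {- int L..int L} = 2 * L + 1" by simp
  then show ?thesis
    unfolding box_def by (subst card_vec_set) simp_all
qed

lemma cube_iff: "y \<in> cube z \<longleftrightarrow> (\<forall>i. z $ i \<in> {y $ i - 1, y $ i})"
proof -
  have "y $ i = z $ i \<or> y $ i = z $ i + 1 \<longleftrightarrow> z $ i \<in> {y $ i - 1, y $ i}" for i
    by auto
  then show ?thesis by (simp add: cube_def)
qed

lemma finite_cubes: "finite {z. y \<in> cube z}"
  unfolding cube_iff by (rule card_vec_set) simp

lemma card_cubes: "card {z :: int ^ 5. y \<in> cube z} = 32"
proof -
  have "card {a - 1, a} = 2" for a :: int by simp
  then show ?thesis
    unfolding cube_iff by (subst card_vec_set) (simp_all add: eval_nat_numeral)
qed

text \<open>The two ends leave one value for the lowest corner along the axis of the edge and two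
  values along each of the four other axes.\<close>

lemma card_cubes_edge:
  assumes "adj u v"
  shows "card {z :: int ^ 5. u \<in> cube z \<and> v \<in> cube z} = 16"
proof -
  obtain i where i: "v = u + axis i 1 \<or> v = u - axis i 1"
    using assms by (auto simp: adj_def)
  have vi: "v $ i = u $ i + 1 \<or> v $ i = u $ i - 1" 
    using i by auto
  have vj: "v $ j = u $ j" if "j \<noteq> i" for j
    using i that by (auto simp: axis_def)
  \<comment> \<open>The smaller of the two ends' coordinates on this axis.\<close>
  define a where "a = (if v $ i = u $ i + 1 then u $ i else u $ i - 1)"
  have "{z. u \<in> cube z \<and> v \<in> cube z} = {z. \<forall>j. z $ j \<in> (if j = i then {a} else {u $ j - 1, u $ j})}"
    (is "?l = ?r")
  proof (intro equalityI subsetI)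
    fix z assume "z \<in> ?l"
    then have z: "z $ j \<in> {u $ j - 1, u $ j}" "z $ j \<in> {v $ j - 1, v $ j}" for j
      by (auto simp: cube_iff)
    have "z $ i = a"
      using vi z [of i] by (auto simp: a_def)
    then show "z \<in> ?r"
      using z by auto
  next
    fix z assume z: "z \<in> ?r"
    have "z $ j \<in> {u $ j - 1, u $ j} \<and> z $ j \<in> {v $ j - 1, v $ j}" for j
    proof (cases "j = i")
      case True
      then have "z $ j = a" using z by (auto dest: spec [of _ i])
      then show ?thesis using vi True by (auto simp: a_def)
    next
      case False
      then have "z $ j \<in> {u $ j - 1, u $ j}" using z by (auto dest: spec [of _ j])
      with vj [OF False] show ?thesis by simp
    qed
    then show "z \<in> ?l" by (auto simp: cube_iff)
  qed
  then have "card {z. u \<in> cube z \<and> v \<in> cube z} = (\<Prod>j\<in>UNIV. card (if j = i then {a} else {u $ j - 1, u $ j}))"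
    by (simp only:) (subst card_vec_set, simp_all)
  also have "\<dots> = (\<Prod>j\<in>UNIV - {i}. card (if j = i then {a} else {u $ j - 1, u $ j}))"
    by (subst prod.remove [of UNIV i]) simp_all
  also have "\<dots> = (\<Prod>j\<in>UNIV - {i}. 2)"
    by (rule prod.cong) auto
  also have "\<dots> = 2 ^ card (UNIV - {i})"
    by simp
  also have "card (UNIV - {i}) = 4"
    by simp
  finally show ?thesis
    by simp
qed

lemma boxI: "(\<And>i. \<bar>x $ i\<bar> \<le> int L) \<Longrightarrow> x \<in> box L"
  by (auto simp: box_def abs_le_iff minus_le_iff)

lemma box_nth: "x \<in> box L \<Longrightarrow> \<bar>x $ i\<bar> \<le> int L"
  by (auto simp: box_def abs_le_iff minus_le_iff)

lemma cube_nth: "y \<in> cube z \<Longrightarrow> y $ i = z $ i \<or> y $ i = z $ i + 1"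
  by (simp add: cube_def)

lemma cube_box: "z \<in> box L \<Longrightarrow> cube z \<subseteq> box (Suc L)"
proof
  fix y assume z: "z \<in> box L" and y: "y \<in> cube z"
  show "y \<in> box (Suc L)"
  proof (rule boxI)
    fix i
    show "\<bar>y $ i\<bar> \<le> int (Suc L)"
      using box_nth [OF z, of i] cube_nth [OF y, of i] by auto
  qed
qed

lemma box_cube: "y \<in> box L \<Longrightarrow> y \<in> cube z \<Longrightarrow> z \<in> box (Suc L)"
proof -
  assume y: "y \<in> box L" and z: "y \<in> cube z"
  show "z \<in> box (Suc L)"
  proof (rule boxI)
    fix i
    show "\<bar>z $ i\<bar> \<le> int (Suc L)"
      using box_nth [OF y, of i] cube_nth [OF z, of i] by auto
  qed
qed

lemma adj_nth: "adj x y \<Longrightarrow> \<bar>y $ i - x $ i\<bar> \<le> 1"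
  by (auto simp: adj_def axis_def)

lemma adj_box: "adj x y \<Longrightarrow> x \<in> box L \<Longrightarrow> y \<in> box (Suc L)"
proof -
  assume a: "adj x y" and x: "x \<in> box L"
  show "y \<in> box (Suc L)"
  proof (rule boxI)
    fix i
    show "\<bar>y $ i\<bar> \<le> int (Suc L)"
      using box_nth [OF x, of i] adj_nth [OF a, of i] by auto
  qed
qed

lemma box_Suc: "x \<in> box L \<Longrightarrow> x \<in> box (Suc L)"
  using box_nth [of x L] by (intro boxI) (simp add: add_increasing)

lemma card_adj: "finite {y. adj (x :: int ^ 5) y} \<and> card {y. adj x y} \<le> 10"
proof -
  have e: "{y. adj x y} = (\<lambda>i. x + axis i 1) ` UNIV \<union> (\<lambda>i. x - axis i 1) ` UNIV"
    by (auto simp: adj_def)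
  have "card ((\<lambda>i. x + axis i 1) ` (UNIV :: 5 set)) \<le> 5" "card ((\<lambda>i. x - axis i 1) ` (UNIV :: 5 set)) \<le> 5"
    using card_image_le [of "UNIV :: 5 set"] by auto
  then show ?thesis
    unfolding e using card_Un_le [of "(\<lambda>i. x + axis i 1) ` UNIV" "(\<lambda>i. x - axis i 1) ` UNIV"] by auto
qed

text \<open>Let t and t' be the numbers of points of \<open>S\<close> in the two boxes and b the
  number of deficient cubes. Double counting gives 64 t + 2 b <= 64 t', and covering gives t <= 11
  b. Eliminating b leaves 706 t <= 704 t', which is twice the claim.\<close>

lemma growth_step:
  fixes S :: "(int ^ 5) set"
  assumes reg: "\<And>u. u \<in> S \<Longrightarrow> card {v \<in> S. adj u v} = 4"
    and core2: "\<And>K z v. two_core K \<Longrightarrow> K \<subseteq> S \<inter> cube z \<Longrightarrow> v \<in> K \<Longrightarrow> card {u \<in> K. adj v u} \<le> 2"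
    and nbr: "\<And>z. has_core S z \<Longrightarrow> \<exists>z'. adj z z' \<and> \<not> has_core S z' \<and> S \<inter> cube z' \<noteq> {}"
  shows "353 * card (S \<inter> box L) \<le> 352 * card (S \<inter> box (L + 2))"
proof -
  \<comment> \<open>The margin on both sides: every cube that meets \<open>box L\<close> has its
    lowest corner in \<open>B\<close>, and every cube with lowest corner in \<open>B\<close> lies in
    \<open>box (L + 2)\<close>.\<close>
  define B where "B = (box (Suc L) :: (int ^ 5) set)"
  define bad where "bad = {z \<in> B. \<not> has_core S z \<and> S \<inter> cube z \<noteq> {}}"
  have fB: "finite B" and fb: "finite bad" by (simp_all add: B_def bad_def)
  have fT: "finite (S \<inter> cube z)" if "z \<in> B" for z
    using cube_box [of z "Suc L"] that finite_subset [OF _ finite_box] by (auto simp: B_def)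
  have eb: "edges (S \<inter> cube z) + (if z \<in> bad then 2 else 0) \<le> 2 * card (S \<inter> cube z)" if z: "z \<in> B" for z
  proof -
    have "edges (S \<inter> cube z) \<le> 2 * card (S \<inter> cube z) \<and>
        (S \<inter> cube z \<noteq> {} \<and> (\<forall>K\<subseteq>S \<inter> cube z. \<not> two_core K) \<longrightarrow> edges (S \<inter> cube z) + 2 \<le> 2 * card (S \<inter> cube z))"
      by (rule edges_bound [OF fT [OF z]]) (use core2 in blast)
    then show ?thesis
      by (auto simp: bad_def has_core_def)
  qed
  have upper: "(\<Sum>z\<in>B. card (S \<inter> cube z)) \<le> 32 * card (S \<inter> box (L + 2))"
  proof -
    have "(\<Sum>z\<in>B. card (S \<inter> cube z)) = (\<Sum>z\<in>B. \<Sum>s\<in>S \<inter> box (L + 2). if s \<in> cube z then 1 else 0)"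
    proof (rule sum.cong [OF refl])
      fix z assume "z \<in> B"
      then have "cube z \<subseteq> box (L + 2)" using cube_box [of z "Suc L"] by (simp add: B_def)
      then have "S \<inter> cube z = (S \<inter> box (L + 2)) \<inter> {s. s \<in> cube z}" by auto
      then show "card (S \<inter> cube z) = (\<Sum>s\<in>S \<inter> box (L + 2). if s \<in> cube z then 1 else 0)"
        by (simp add: sum.If_cases)
    qed
    also have "\<dots> = (\<Sum>s\<in>S \<inter> box (L + 2). \<Sum>z\<in>B. if s \<in> cube z then 1 else 0)"
      by (rule sum.swap)
    also have "\<dots> \<le> (\<Sum>s\<in>S \<inter> box (L + 2). 32)"
    proof (rule sum_mono)
      fix s
      have "(\<Sum>z\<in>B. if s \<in> cube z then 1 else 0) = card (B \<inter> {z. s \<in> cube z})"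
        using fB by (simp add: sum.If_cases)
      also have "\<dots> \<le> card {z. s \<in> cube z}"
        by (intro card_mono finite_cubes) auto
      finally show "(\<Sum>z\<in>B. if s \<in> cube z then 1 else 0) \<le> (32 :: nat)"
        by (simp add: card_cubes)
    qed
    finally show ?thesis by simp
  qed
  have lower: "64 * card (S \<inter> box L) \<le> (\<Sum>z\<in>B. edges (S \<inter> cube z))"
  proof -
    \<comment> \<open>Four neighbours for each point, and 16 cubes for each of these edges. Edges
      that leave \<open>box L\<close> are included, as their cubes still have lowest corners in
      \<open>B\<close>.\<close>
    have "64 * card (S \<inter> box L) = (\<Sum>u\<in>S \<inter> box L. \<Sum>v\<in>{v \<in> S. adj u v}. 16)"
      by (simp add: reg)
    also have "\<dots> = (\<Sum>u\<in>S \<inter> box L. \<Sum>v\<in>{v \<in> S. adj u v}. \<Sum>z\<in>B. if u \<in> cube z \<and> v \<in> cube z then 1 else 0)"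
    proof (intro sum.cong refl)
      fix u v assume u: "u \<in> S \<inter> box L" and v: "v \<in> {v \<in> S. adj u v}"
      have "B \<inter> {z. u \<in> cube z \<and> v \<in> cube z} = {z. u \<in> cube z \<and> v \<in> cube z}"
        using u box_cube by (auto simp: B_def)
      then show "16 = (\<Sum>z\<in>B. if u \<in> cube z \<and> v \<in> cube z then 1 else 0 :: nat)"
        using v fB card_cubes_edge by (simp add: sum.If_cases)
    qed
    also have "\<dots> = (\<Sum>u\<in>S \<inter> box L. \<Sum>z\<in>B. \<Sum>v\<in>{v \<in> S. adj u v}. if u \<in> cube z \<and> v \<in> cube z then 1 else 0)"
      by (rule sum.cong [OF refl]) (rule sum.swap)
    also have "\<dots> = (\<Sum>z\<in>B. \<Sum>u\<in>S \<inter> box L. \<Sum>v\<in>{v \<in> S. adj u v}. if u \<in> cube z \<and> v \<in> cube z then 1 else 0)"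
      by (rule sum.swap)
    also have "\<dots> \<le> (\<Sum>z\<in>B. edges (S \<inter> cube z))"
    proof (rule sum_mono)
      fix z assume z: "z \<in> B"
      have "(\<Sum>u\<in>S \<inter> box L. \<Sum>v\<in>{v \<in> S. adj u v}. if u \<in> cube z \<and> v \<in> cube z then 1 else 0)
          = (\<Sum>u\<in>S \<inter> box L. if u \<in> cube z then card {v \<in> S \<inter> cube z. adj u v} else 0)"
      proof (rule sum.cong [OF refl])
        fix u assume "u \<in> S \<inter> box L"
        then have f: "finite {v \<in> S. adj u v}"
          using reg by (metis IntD1 card.infinite zero_neq_numeral)
        have "{v \<in> S. adj u v} \<inter> {v. v \<in> cube z} = {v \<in> S \<inter> cube z. adj u v}" by auto
        then show "(\<Sum>v\<in>{v \<in> S. adj u v}. if u \<in> cube z \<and> v \<in> cube z then 1 else 0)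
            = (if u \<in> cube z then card {v \<in> S \<inter> cube z. adj u v} else 0)"
          using f by (simp add: sum.If_cases)
      qed
      also have "\<dots> = (\<Sum>u\<in>(S \<inter> box L) \<inter> cube z. card {v \<in> S \<inter> cube z. adj u v})"
        by (rule sum.inter_restrict [symmetric]) simp
      also have "\<dots> \<le> edges (S \<inter> cube z)"
        unfolding edges_def by (intro sum_mono2 fT [OF z]) auto
      finally show "(\<Sum>u\<in>S \<inter> box L. \<Sum>v\<in>{v \<in> S. adj u v}. if u \<in> cube z \<and> v \<in> cube z then 1 else 0)
          \<le> edges (S \<inter> cube z)" .
    qed
    finally show ?thesis .
  qed
  have "(\<Sum>z\<in>B. edges (S \<inter> cube z) + (if z \<in> bad then 2 else 0)) \<le> (\<Sum>z\<in>B. 2 * card (S \<inter> cube z))"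
    by (intro sum_mono eb)
  moreover have "(\<Sum>z\<in>B. if z \<in> bad then 2 else 0) = 2 * card bad"
  proof -
    have "B \<inter> bad = bad" by (auto simp: bad_def)
    then show ?thesis using fB by (simp add: sum.If_cases)
  qed
  ultimately have main: "64 * card (S \<inter> box L) + 2 * card bad \<le> 64 * card (S \<inter> box (L + 2))"
    using lower upper by (simp add: sum.distrib sum_distrib_left [symmetric])
  have "S \<inter> box L \<subseteq> (\<Union>z\<in>bad. insert z {y. adj z y})"
  proof
    fix s assume s: "s \<in> S \<inter> box L"
    \<comment> \<open>Each point is the lowest corner of a cube that contains it, so points of
      \<open>S\<close> can be charged to cubes.\<close>
    then have sc: "s \<in> S \<inter> cube s" by (simp add: cube_def)
    show "s \<in> (\<Union>z\<in>bad. insert z {y. adj z y})"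
    proof (cases "has_core S s")
      case True
      then obtain z' where z': "adj s z'" "\<not> has_core S z'" "S \<inter> cube z' \<noteq> {}" using nbr by blast
      then have "z' \<in> bad" using adj_box s by (auto simp: bad_def B_def)
      then show ?thesis using adj_sym [OF z'(1)] by blast
    next
      case False
      moreover have "s \<in> B" using s by (simp add: B_def box_Suc)
      ultimately have "s \<in> bad" using sc by (auto simp: bad_def)
      then show ?thesis by blast
    qed
  qed
  then have "card (S \<inter> box L) \<le> card (\<Union>z\<in>bad. insert z {y. adj z y})"
    using fb card_adj by (intro card_mono) auto
  also have "\<dots> \<le> (\<Sum>z\<in>bad. card (insert z {y. adj z y}))"
    by (rule card_UN_le [OF fb])
  \<comment> \<open>The corner of the deficient cube itself and its ten neighbours.\<close>
  also have "\<dots> \<le> (\<Sum>z\<in>bad. 11)"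
  proof (rule sum_mono)
    fix z :: "int ^ 5"
    show "card (insert z {y. adj z y}) \<le> 11"
      using card_adj [of z] card_insert_le_m1 [of 11 "{y. adj z y}" z] by simp
  qed
  finally have "card (S \<inter> box L) \<le> 11 * card bad" by simp
  with main show ?thesis by linarith
qed

lemma growth_contradiction:
  fixes t :: "nat \<Rightarrow> nat"
  assumes step: "\<And>L. 353 * t L \<le> 352 * t (L + 2)" and pos: "0 < t L" and bound: "\<And>L. t L \<le> (2 * L + 1) ^ 5"
  shows False
proof -
  \<comment> \<open>Each factor 353/352 costs an enlargement of the box by only 2, so exponential
    growth in \<open>n\<close> meets a bound of degree 5 in \<open>n\<close>.\<close>
  have grow: "(353 / 352) ^ n * real (t L) \<le> real (t (L + 2 * n))" for n
  proof (induction n)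
    case (Suc n)
    have "353 * real (t (L + 2 * n)) \<le> 352 * real (t (L + 2 * Suc n))"
      using of_nat_mono [OF step [of "L + 2 * n"], where 'a = real] by simp
    with Suc show ?case by simp
  qed simp
  have "\<forall>\<^sub>F n in sequentially. (2 * real L + 4 * real n + 1) ^ 5 < (353 / 352) ^ n"
    by real_asymp
  then obtain n where n: "(2 * real L + 4 * real n + 1) ^ 5 < (353 / 352) ^ n"
    using eventually_happens' sequentially_bot by blast
  have "real (t (L + 2 * n)) \<le> real ((2 * (L + 2 * n) + 1) ^ 5)"
    using bound of_nat_le_iff by blast
  also have "\<dots> = (2 * real L + 4 * real n + 1) ^ 5"
    by (simp add: algebra_simps)
  also have "\<dots> < (353 / 352) ^ n * 1" using n by simp
  also have "\<dots> \<le> (353 / 352) ^ n * real (t L)"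
    using pos by (intro mult_left_mono) auto
  finally show False using grow [of n] by simp
qed

lemma ex_box: "\<exists>L. x \<in> box L"
proof -
  have "\<bar>x $ i\<bar> \<le> (\<Sum>j\<in>UNIV. \<bar>x $ j\<bar>)" for i
    by (rule member_le_sum) auto
  moreover have "0 \<le> (\<Sum>j\<in>UNIV. \<bar>x $ j\<bar>)"
    by (intro sum_nonneg) simp
  ultimately have "x \<in> box (nat (\<Sum>j\<in>UNIV. \<bar>x $ j\<bar>))"
    by (intro boxI) simp
  then show ?thesis ..
qed

theorem mainTheorem6:
  shows "(\<exists>H :: (int ^ 5) pair_pre_digraph.
            induced_subgraph (with_proj H) (with_proj grid) \<and> regular_graph 4 H \<and> girth H = 10) \<and>
         (\<forall>H :: (int ^ 5) pair_pre_digraph.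
            induced_subgraph (with_proj H) (with_proj grid) \<and> regular_graph 4 H \<longrightarrow> girth H \<le> 10)"
proof (rule conjI [OF ex_girth_ten], intro allI impI, rule ccontr)
  fix H :: "(int ^ 5) pair_pre_digraph"
  assume H: "induced_subgraph (with_proj H) (with_proj grid) \<and> regular_graph 4 H" and g: "\<not> girth H \<le> 10"
  define S where "S = pverts H"
  have ns: "no_short S"
    unfolding S_def using H g by (intro no_short_of_girth) auto
  have reg: "card {v \<in> S. adj u v} = 4" if "u \<in> S" for u
  proof -
    have "{v \<in> S. adj u v} = neighbours H u"
      using H that unfolding induced_grid neighbours_def S_def by auto
    then show ?thesis using H that by (simp add: regular_graph_def S_def)
  qed
  have step: "353 * card (S \<inter> box L) \<le> 352 * card (S \<inter> box (L + 2))" for L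
    by (rule growth_step [OF reg core_degree [OF ns] neighbour_without_core [OF ns]])
  obtain x where x: "x \<in> S" using H by (auto simp: regular_graph_def S_def)
  obtain L where "x \<in> box L" using ex_box by blast
  with x have pos: "0 < card (S \<inter> box L)" by (auto simp: card_gt_0_iff)
  have bound: "card (S \<inter> box L) \<le> (2 * L + 1) ^ 5" for L
    unfolding card_box [symmetric] by (intro card_mono) auto
  show False
    using growth_contradiction [of "\<lambda>L. card (S \<inter> box L)", OF step pos bound] .
qed

end
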